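(* Let $m\ge 1$ be an integer, let $(\Gamma,\gamma)$ be a twist graph with coefficients in $\mathbb{Z}/m\mathbb{Z}$, and let $v$ be a vertex of $\Gamma$ (the empty vertex). (A) If $\Gamma=\Theta_5$ and $\varphi_\gamma$ is surjective, then the group of solvable ordered pairs $(\vec{x},\sigma)\in S(m,4)$ is: (1) $\{(\vec{x},\sigma)\in S(m,4)\mid \sigma\in A_4,\ \sum_{i=1}^4 x_i\equiv q(\sigma)\pmod 3\}$ if $m$ is divisible by 3 and $\sum_{i=1}^6\gamma_{e_i}\equiv 0\pmod 3$, and (2) $\{(\vec{x},\sigma)\in S(m,4)\mid \sigma\in A_4\}$ otherwise. (B) If $\Gamma=\Theta_7$ and $\varphi_\gamma$ is surjective, then the group of solvable ordered pairs $(\vec{x},\sigma)\in S(m,6)$ is: (1) $\{(\vec{x},\sigma)\in S(m,6)\mid \sigma\in\mathrm{PGL}(2,5),\ \sum_{i=1}^6 x_i\equiv\mathrm{sign}(\sigma)\pmod 2\}$ if $m$ is even and $(\Theta_7,\gamma)$ is twist bipartite, and (2) $\{(\vec{x},\sigma)\in S(m,6)\mid \sigma\in\mathrm{PGL}(2,5)\}$ otherwise.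
   Context: For an oriented edge $e$, $\overline{e}$ is the same edge with opposite orientation. A 1-chain $\gamma$ on $\Gamma$ with coefficients in $\mathbb{Z}/m\mathbb{Z}$ assigns $\gamma_e\in\mathbb{Z}/m\mathbb{Z}$ to each oriented edge $e$ with $\gamma_{\overline{e}}=-\gamma_e$. A twist graph is a pair $(\Gamma,\gamma)$ with $\Gamma$ a finite graph and $\gamma$ such a 1-chain. $H_1(\Gamma,\mathbb{Z}/m\mathbb{Z})$ is the group of 1-chains $\omega$ with $\sum_{e\to w}\omega_e=0$ for every vertex $w$ (sum over oriented edges with head $w$). The homomorphism $\varphi_\gamma:H_1(\Gamma,\mathbb{Z}/m\mathbb{Z})\to\mathbb{Z}/m\mathbb{Z}$ is $\varphi_\gamma(\omega)=\sum_{e\in E(\Gamma)}\gamma_e\omega_e$ (each edge taken once, with either orientation). $(\Gamma,\gamma)$ is twist bipartite if $m$ is even and the vertices can be 2-colored so that the endpoints of $e$ have different colors when $\gamma_e$ is even and the same color when $\gamma_e$ is odd. $\Theta_5$ has vertices $l,r,t,c,b$ and six edges, oriented as follows: $e_1:l\to t$, $e_2:t\to r$, $e_3:l\to c$, $e_4:c\to r$, $e_5:l\to b$, $e_6:b\to r$. $K\subset A_4$ is the Klein 4-group, which is normal in $A_4$, and $q:A_4\to A_4/K\cong\mathbb{Z}/3\mathbb{Z}$ denotes the quotient map. $\Theta_7$ has vertices $\infty,0,1,2,3,4,c$ and edges $\{\infty,0\},\{0,1\},\{1,2\},\{2,3\},\{3,4\},\{4,\infty\},\{\infty,c\},\{c,2\}$.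 $\mathrm{PGL}(2,5)\cong S_5$ denotes the "exotic" subgroup of $S_6$ isomorphic to $S_5$ (the image of the standard copy of $S_5$ under the non-trivial outer automorphism of $S_6$); it acts on the vertices of $\Theta_7$ labeled $\infty,0,1,2,3,4$, viewed as the points of $\mathbb{P}^1(\mathbb{F}_5)$, by fractional linear transformations. For a finite set $X$, the generalized symmetric group on $X$ is $(\mathbb{Z}/m\mathbb{Z})^X\rtimes \mathrm{Sym}(X)$, with product $(\vec{x},\sigma)(\vec{y},\tau)=(\vec{x}+\sigma\cdot\vec{y},\sigma\tau)$, where $(\sigma\cdot\vec{y})_w=\vec{y}_{\sigma^{-1}(w)}$ and permutations compose right to left. For $|X|=n$ it is denoted $S(m,n)$. $\mathrm{sign}(\sigma)\in\mathbb{Z}/2\mathbb{Z}$ is $0$ for even and $1$ for odd permutations. For an oriented edge $e$, let $\sigma_e$ be the permutation of $V(\Gamma)$ transposing the head and tail of $e$, and let $\vec{x}(e)\in(\mathbb{Z}/m\mathbb{Z})^{V(\Gamma)}$ have entry $\gamma_e$ at the tail of $e$ and $0$ elsewhere. For a path $p=f_1f_2\cdots f_k$ (the head of $f_i$ is the tail of $f_{i+1}$), set $(\vec{x}(p),\sigma_p)=(\vec{x}(f_k),\sigma_{f_k})\cdots(\vec{x}(f_1),\sigma_{f_1})$, computed in the generalized symmetric group on $V(\Gamma)$. If $p$ is a closed path starting and ending at $v$, then $\sigma_p(v)=v$ and $\vec{x}(p)_v=0$, so $(\vec{x}(p),\sigma_p)$ is regarded as an element of $S(m,n)$, the generalized symmetric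 group on the $n$-element set $V(\Gamma)\smallsetminus\{v\}$ (here $n=|V(\Gamma)|-1$). The group of solvable ordered pairs is the set of all $(\vec{x}(p),\sigma_p)$ with $p$ a closed path starting and ending at $v$. *)

theory Defs
  imports
    "HOL-Algebra.Coset"
    "HOL-Algebra.Elementary_Groups"
    "HOL-Combinatorics.Permutations"
    "HOL-Number_Theory.Modular_Inverse"
    "Graph_Theory.Arc_Walk"
    "Graph_Theory.Bidirected_Digraph"
begin

section \<open>Twist graphs\<close>

text \<open>
  A graph is given by its set of oriented edges, i.e. as a digraph with an arc reversal
  \<open>rv\<close> (compare the locale \<^locale>\<open>bidirected_digraph\<close>).
  The group of integers modulo \<open>m\<close> is represented by the residues \<open>{0..<int m}\<close>, which is the
  carrier of \<^term>\<open>integer_mod_group m\<close> for \<open>m > 0\<close>.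
\<close>

definition one_chains :: "nat \<Rightarrow> ('v, 'e) pre_digraph \<Rightarrow> ('e \<Rightarrow> 'e) \<Rightarrow> ('e \<Rightarrow> int) set" where
  "one_chains m G rv =
     {\<gamma> \<in> arcs G \<rightarrow>\<^sub>E {0..<int m}. \<forall>e\<in>arcs G. \<gamma> (rv e) = (- \<gamma> e) mod int m}"

definition H1 :: "nat \<Rightarrow> ('v, 'e) pre_digraph \<Rightarrow> ('e \<Rightarrow> 'e) \<Rightarrow> ('e \<Rightarrow> int) set" where
  "H1 m G rv =
     {\<omega> \<in> one_chains m G rv. \<forall>w\<in>verts G. (\<Sum>e\<in>in_arcs G w. \<omega> e) mod int m = 0}"

definition edges :: "('v, 'e) pre_digraph \<Rightarrow> ('e \<Rightarrow> 'e) \<Rightarrow> 'e set set" where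
  "edges G rv = (\<lambda>e. {e, rv e}) ` arcs G"

text \<open>
  Each unoriented edge contributes once; the choice of its orientation is immaterial by
  \<open>one_chains_mult_rev\<close> below.
\<close>

definition \<phi> :: "nat \<Rightarrow> ('v, 'e) pre_digraph \<Rightarrow> ('e \<Rightarrow> 'e) \<Rightarrow> ('e \<Rightarrow> int) \<Rightarrow> ('e \<Rightarrow> int) \<Rightarrow> int" where
  "\<phi> m G rv \<gamma> \<omega> =
     (\<Sum>E\<in>edges G rv. (let e = (SOME e. e \<in> E) in \<gamma> e * \<omega> e)) mod int m"

lemma one_chains_mult_rev:
  assumes "\<gamma> \<in> one_chains m G rv" "\<omega> \<in> one_chains m G rv" "e \<in> arcs G"
  shows "(\<gamma> (rv e) * \<omega> (rv e)) mod int m = (\<gamma> e * \<omega> e) mod int m"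
  using assms by (simp add: one_chains_def mod_mult_eq)

definition twist_bipartite :: "nat \<Rightarrow> ('v, 'e) pre_digraph \<Rightarrow> ('e \<Rightarrow> int) \<Rightarrow> bool" where
  "twist_bipartite m G \<gamma> \<longleftrightarrow> even m \<and>
     (\<exists>col :: 'v \<Rightarrow> bool. \<forall>e\<in>arcs G.
        (even (\<gamma> e) \<longrightarrow> col (tail G e) \<noteq> col (head G e)) \<and>
        (odd (\<gamma> e) \<longrightarrow> col (tail G e) = col (head G e)))"


section \<open>Generalized symmetric groups and solvable ordered pairs\<close>

text \<open>
  Vectors indexed by \<open>X\<close> are functions vanishing outside \<open>X\<close>, and permutations of \<open>X\<close> fix every
  point outside \<open>X\<close>. Hence the group on \<open>X - {v}\<close> is literally the subset of the group on \<open>X\<close>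
  given by \<open>\<sigma> v = v\<close> and \<open>x v = 0\<close>.
\<close>

definition gen_sym :: "nat \<Rightarrow> 'v set \<Rightarrow> (('v \<Rightarrow> int) \<times> ('v \<Rightarrow> 'v)) monoid" where
  "gen_sym m X =
     \<lparr>carrier = {(x, \<sigma>). (\<forall>w\<in>X. x w \<in> {0..<int m}) \<and> (\<forall>w. w \<notin> X \<longrightarrow> x w = 0) \<and> \<sigma> permutes X},
      monoid.mult = (\<lambda>(x, \<sigma>) (y, \<tau>). (\<lambda>w. (x w + y (inv_into UNIV \<sigma> w)) mod int m, \<sigma> \<circ> \<tau>)),
      one = (\<lambda>_. 0, id)\<rparr>"

definition arc_pair :: "('v, 'e) pre_digraph \<Rightarrow> ('e \<Rightarrow> int) \<Rightarrow> 'e \<Rightarrow> ('v \<Rightarrow> int) \<times> ('v \<Rightarrow> 'v)" where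
  "arc_pair G \<gamma> e = ((\<lambda>_. 0)(tail G e := \<gamma> e), transpose (tail G e) (head G e))"

primrec walk_pair ::
    "nat \<Rightarrow> ('v, 'e) pre_digraph \<Rightarrow> ('e \<Rightarrow> int) \<Rightarrow> 'e list \<Rightarrow> ('v \<Rightarrow> int) \<times> ('v \<Rightarrow> 'v)" where
  "walk_pair m G \<gamma> [] = \<one>\<^bsub>gen_sym m (verts G)\<^esub>"
| "walk_pair m G \<gamma> (f # p) = walk_pair m G \<gamma> p \<otimes>\<^bsub>gen_sym m (verts G)\<^esub> arc_pair G \<gamma> f"

definition solvable_pairs ::
    "nat \<Rightarrow> ('v, 'e) pre_digraph \<Rightarrow> ('e \<Rightarrow> int) \<Rightarrow> 'v \<Rightarrow> (('v \<Rightarrow> int) \<times> ('v \<Rightarrow> 'v)) set" where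
  "solvable_pairs m G \<gamma> v = {walk_pair m G \<gamma> p | p. pre_digraph.awalk G v p v}"


section \<open>Alternating groups and the Klein four-group\<close>

text \<open>
  For \<open>card X = 4\<close> the quotient \<open>alt X Mod klein X\<close> has two identifications with the integers
  modulo 3. Replacing \<open>\<gamma>\<close> by its negative negates the vectors of all solvable pairs and so
  exchanges the two; the identification therefore cannot be fixed independently of \<open>\<gamma>\<close>.
\<close>

definition alt :: "'v set \<Rightarrow> ('v \<Rightarrow> 'v) monoid" where
  "alt X = \<lparr>carrier = {\<sigma>. \<sigma> permutes X \<and> evenperm \<sigma>}, monoid.mult = (\<circ>), one = id\<rparr>"

definition klein :: "'v set \<Rightarrow> ('v \<Rightarrow> 'v) set" where
  "klein X = insert id {transpose a b \<circ> transpose c d | a b c d.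
     distinct [a, b, c, d] \<and> {a, b, c, d} \<subseteq> X}"


section \<open>The theta graphs\<close>

definition graph_of :: "'v set \<Rightarrow> ('v \<times> 'v) set \<Rightarrow> ('v, 'v \<times> 'v) pre_digraph" where
  "graph_of V A = \<lparr>verts = V, arcs = A \<union> prod.swap ` A, tail = fst, head = snd\<rparr>"

definition edge_rev :: "('v, 'v \<times> 'v) pre_digraph \<Rightarrow> 'v \<times> 'v \<Rightarrow> 'v \<times> 'v" where
  "edge_rev G e = (if e \<in> arcs G then prod.swap e else e)"

datatype theta5_vertex = VL | VR | VT | VC | VB

definition theta5_edges :: "(theta5_vertex \<times> theta5_vertex) set" where
  "theta5_edges = {(VL, VT), (VT, VR), (VL, VC), (VC, VR), (VL, VB), (VB, VR)}"

definition theta5 :: "(theta5_vertex, theta5_vertex \<times> theta5_vertex) pre_digraph" where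
  "theta5 = graph_of {VL, VR, VT, VC, VB} theta5_edges"

text \<open>
  The vertices \<open>Infty\<close> and \<open>Fin 0, \<dots>, Fin 4\<close> of the second graph are the points of the projective
  line over the field with five elements.
\<close>

datatype theta7_vertex = Infty | Fin int | Center

definition P1F5 :: "theta7_vertex set" where
  "P1F5 = insert Infty (Fin ` {0..4})"

definition theta7 :: "(theta7_vertex, theta7_vertex \<times> theta7_vertex) pre_digraph" where
  "theta7 = graph_of (insert Center P1F5)
     {(Infty, Fin 0), (Fin 0, Fin 1), (Fin 1, Fin 2), (Fin 2, Fin 3), (Fin 3, Fin 4),
      (Fin 4, Infty), (Infty, Center), (Center, Fin 2)}"

fun frac_linear :: "int \<Rightarrow> int \<Rightarrow> int \<Rightarrow> int \<Rightarrow> theta7_vertex \<Rightarrow> theta7_vertex" where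
  "frac_linear a b c d Infty =
     (if 5 dvd c then Infty else Fin ((a * modular_inverse 5 c) mod 5))"
| "frac_linear a b c d (Fin z) =
     (if 5 dvd (c * z + d) then Infty
      else Fin (((a * z + b) * modular_inverse 5 (c * z + d)) mod 5))"
| "frac_linear a b c d Center = Center"

definition PGL25 :: "(theta7_vertex \<Rightarrow> theta7_vertex) set" where
  "PGL25 = {g. g permutes P1F5 \<and>
     (\<exists>a b c d. \<not> 5 dvd (a * d - b * c) \<and> (\<forall>z\<in>P1F5. g z = frac_linear a b c d z))}"

text \<open>
  The permutations of \<open>X\<close> that \<open>PGL25\<close> induces through a labelling \<open>\<beta>\<close> of \<open>X\<close> by the points of
  the projective line.
\<close>

definition PGL25_on :: "(theta7_vertex \<Rightarrow> 'v) \<Rightarrow> 'v set \<Rightarrow> ('v \<Rightarrow> 'v) set" where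
  "PGL25_on \<beta> X = {\<sigma>. \<sigma> permutes X \<and> (\<exists>g\<in>PGL25. \<forall>z\<in>P1F5. \<sigma> (\<beta> z) = \<beta> (g z))}"


section \<open>Well-formedness\<close>

lemma bidirected_graph_of:
  assumes "A \<subseteq> V \<times> V" "\<And>a. (a, a) \<notin> A"
  shows "bidirected_digraph (graph_of V A) (edge_rev (graph_of V A))"
proof
  fix e assume e: "e \<in> arcs (graph_of V A)"
  then show "tail (graph_of V A) e \<in> verts (graph_of V A)"
    "head (graph_of V A) e \<in> verts (graph_of V A)"
    "edge_rev (graph_of V A) (edge_rev (graph_of V A) e) = e"
    "tail (graph_of V A) (edge_rev (graph_of V A) e) = head (graph_of V A) e"
    using assms(1) by (auto simp: graph_of_def edge_rev_def)
next
  fix e show "e \<in> arcs (graph_of V A) \<longleftrightarrow> edge_rev (graph_of V A) e \<noteq> e"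
    using assms(2) by (cases e) (auto simp: graph_of_def edge_rev_def)
qed

lemma bidirected_theta5: "bidirected_digraph theta5 (edge_rev theta5)"
  unfolding theta5_def by (rule bidirected_graph_of) (auto simp: theta5_edges_def)

lemma bidirected_theta7: "bidirected_digraph theta7 (edge_rev theta7)"
  unfolding theta7_def by (rule bidirected_graph_of) (auto simp: P1F5_def)

lemma inv_permutes_not_in: "\<sigma> permutes X \<Longrightarrow> w \<notin> X \<Longrightarrow> inv_into UNIV \<sigma> w = w"
  by (rule permutes_not_in[OF permutes_inv])

lemma inv_permutes_in: "\<sigma> permutes X \<Longrightarrow> inv_into UNIV \<sigma> w \<in> X \<longleftrightarrow> w \<in> X"
  by (rule permutes_in_image[OF permutes_inv])

lemma gen_sym_group:
  assumes "m \<ge> 1"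
  shows "group (gen_sym m X)"
proof (rule groupI)
  fix a b assume "a \<in> carrier (gen_sym m X)" "b \<in> carrier (gen_sym m X)"
  then show "a \<otimes>\<^bsub>gen_sym m X\<^esub> b \<in> carrier (gen_sym m X)"
    using assms
    by (auto simp: gen_sym_def permutes_compose inv_permutes_not_in)
next
  show "\<one>\<^bsub>gen_sym m X\<^esub> \<in> carrier (gen_sym m X)"
    using assms by (auto simp: gen_sym_def permutes_id)
next
  fix a b c
  assume "a \<in> carrier (gen_sym m X)" "b \<in> carrier (gen_sym m X)" "c \<in> carrier (gen_sym m X)"
  then show "a \<otimes>\<^bsub>gen_sym m X\<^esub> b \<otimes>\<^bsub>gen_sym m X\<^esub> c = a \<otimes>\<^bsub>gen_sym m X\<^esub> (b \<otimes>\<^bsub>gen_sym m X\<^esub> c)"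
    by (auto simp: gen_sym_def fun_eq_iff mod_simps o_inv_distrib permutes_bij add.assoc)
next
  fix a assume a: "a \<in> carrier (gen_sym m X)"
  then show "\<one>\<^bsub>gen_sym m X\<^esub> \<otimes>\<^bsub>gen_sym m X\<^esub> a = a"
    by (auto simp: gen_sym_def fun_eq_iff) (metis mod_0 mod_pos_pos_trivial)
  obtain x \<sigma> where xs: "a = (x, \<sigma>)" by (cases a)
  let ?b = "(\<lambda>w. (- x (\<sigma> w)) mod int m, inv_into UNIV \<sigma>)"
  have p: "\<sigma> permutes X" using a xs by (auto simp: gen_sym_def)
  have "?b \<in> carrier (gen_sym m X)"
    using a p assms
    by (auto simp: gen_sym_def xs permutes_inv permutes_not_in)
  moreover have "?b \<otimes>\<^bsub>gen_sym m X\<^esub> a = \<one>\<^bsub>gen_sym m X\<^esub>"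
    using p by (auto simp: gen_sym_def xs fun_eq_iff mod_simps permutes_inv_inv permutes_inv_o
        permutes_inverses)
  ultimately show "\<exists>b\<in>carrier (gen_sym m X). b \<otimes>\<^bsub>gen_sym m X\<^esub> a = \<one>\<^bsub>gen_sym m X\<^esub>"
    by blast
qed

lemma walk_pair_end:
  assumes "wf_digraph G" "\<And>e. e \<in> arcs G \<Longrightarrow> tail G e \<noteq> head G e"
    and "\<gamma> \<in> one_chains m G rv" "m \<ge> 1" "pre_digraph.awalk G u p w"
  shows "walk_pair m G \<gamma> p \<in> carrier (gen_sym m (verts G)) \<and>
    snd (walk_pair m G \<gamma> p) u = w \<and> fst (walk_pair m G \<gamma> p) w = 0"
  using assms(5)
proof (induction p arbitrary: u)
  case Nil
  then show ?case using assms(4)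
    by (auto simp: gen_sym_def pre_digraph.awalk_def pre_digraph.cas.simps permutes_id)
next
  case (Cons f p)
  have f: "f \<in> arcs G" "tail G f = u" "pre_digraph.awalk G (head G f) p w"
    using Cons.prems assms(1)
    by (auto simp: pre_digraph.awalk_def pre_digraph.cas.simps wf_digraph.head_in_verts)
  obtain y \<tau> where yt: "walk_pair m G \<gamma> p = (y, \<tau>)" by fastforce
  have IH: "(y, \<tau>) \<in> carrier (gen_sym m (verts G))" "\<tau> (head G f) = w" "y w = 0"
    using Cons.IH[OF f(3)] yt by auto
  have perm: "\<tau> permutes verts G" using IH(1) by (simp add: gen_sym_def)
  have inv: "inv_into UNIV \<tau> w = head G f"
    using IH(2) perm by (metis permutes_inverses(2))
  have "u \<in> verts G" "head G f \<in> verts G"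
    using f(1,2) assms(1) by (auto simp: wf_digraph.head_in_verts wf_digraph.tail_in_verts)
  moreover have "\<gamma> f \<in> {0..<int m}"
    using assms(3) f(1) by (auto simp: one_chains_def PiE_iff)
  ultimately have "arc_pair G \<gamma> f \<in> carrier (gen_sym m (verts G))"
    using f(2) assms(4) by (auto simp: arc_pair_def gen_sym_def permutes_swap_id)
  then have "walk_pair m G \<gamma> (f # p) \<in> carrier (gen_sym m (verts G))"
    using IH(1) yt group.is_monoid[OF gen_sym_group[OF assms(4), of "verts G"]]
    by (auto intro: monoid.m_closed)
  moreover have "snd (walk_pair m G \<gamma> (f # p)) u = w" "fst (walk_pair m G \<gamma> (f # p)) w = 0"
    using yt IH inv f(2) assms(2)[OF f(1)] by (auto simp: arc_pair_def gen_sym_def)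
  ultimately show ?case by simp
qed

lemma solvable_pairs_subset:
  assumes "wf_digraph G" "\<And>e. e \<in> arcs G \<Longrightarrow> tail G e \<noteq> head G e"
    and "\<gamma> \<in> one_chains m G rv" "m \<ge> 1"
  shows "solvable_pairs m G \<gamma> v \<subseteq> carrier (gen_sym m (verts G - {v}))"
proof
  fix a assume "a \<in> solvable_pairs m G \<gamma> v"
  then obtain p where p: "a = walk_pair m G \<gamma> p" "pre_digraph.awalk G v p v"
    by (auto simp: solvable_pairs_def)
  obtain x \<sigma> where xs: "a = (x, \<sigma>)" by (cases a)
  have "walk_pair m G \<gamma> p = (x, \<sigma>)" using p(1) xs by simp
  with walk_pair_end[OF assms p(2)]
  have *: "(x, \<sigma>) \<in> carrier (gen_sym m (verts G))" "\<sigma> v = v" "x v = 0"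
    by simp_all
  have "\<sigma> permutes verts G"
    using *(1) by (simp add: gen_sym_def)
  then have "\<sigma> permutes (verts G - {v})"
    by (rule permutes_superset) (use *(2) in simp)
  moreover have "x w = 0" if "w \<notin> verts G - {v}" for w
    using * that by (cases "w = v") (simp_all add: gen_sym_def)
  ultimately show "a \<in> carrier (gen_sym m (verts G - {v}))"
    using *(1) unfolding xs by (simp add: gen_sym_def)
qed

end

theory Submission
  imports Defs
begin

text \<open>
  Both graphs consist of three paths between two vertices, so the group of solvable pairs at the
  midpoint \<open>VC\<close> resp. \<open>Center\<close> is generated by the loops around two cycles. Let their \<open>\<gamma>\<close>-sums be
  \<open>b\<close> and \<open>c\<close>. Surjectivity of \<open>\<phi>\<close> means that \<open>b\<close>, \<open>c\<close> and \<open>m\<close> generate the unit ideal. A power of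
  a loop moves every token it meets once around its cycle, so it is \<open>b\<close> (or \<open>c\<close>) times the indicator
  vector of the tokens on the cycle, with trivial permutation. Differences of such vectors under the
  multiply transitive permutation group give \<open>b (e\<^sub>i - e\<^sub>j)\<close> and \<open>c (e\<^sub>i - e\<^sub>j)\<close>, hence all vectors of
  coordinate sum 0. So a pair is solvable as soon as its coordinate sum modulo \<open>m\<close> is attained
  together with its permutation. The attained sums over the identity form an ideal containing 3
  resp. 2, and a word in the loops shows that it is everything unless the congruence in case (1)
  forces a relation between sum and permutation. Other base vertices follow by conjugation.
\<close>

section \<open>Walks in twisted digraphs\<close>

text \<open>That no further pair is solvable needs an invariant, and the pieces of a closed walk are
  not closed. So a walk from \<open>u\<close> to the center is completed by a tree walk from the
  center to \<open>u\<close>: with the permutation of this tree walk taken into account, tree arcs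
  become neutral and every other arc contributes one fundamental cycle. In the smaller graph the two
  loops are 3-cycles in opposite nonzero classes of A_4/K, and in case (1) their sums are opposite
  modulo 3 as well. Hence sum and class are proportional, with factor \<open>\<gamma>_bot\<close>;
  this factor is a unit modulo 3 and selects the identification of A_4/K with Z/3. In the larger
  graph both loops are odd permutations, and for even m case (1) amounts to both sums being odd.
  There the 2-coloring itself keeps track of the parity along walks that are not closed.\<close>

lemma gen_sym_mult:
  "(x, \<sigma>) \<otimes>\<^bsub>gen_sym m X\<^esub> (y, \<tau>) = (\<lambda>w. (x w + y (inv_into UNIV \<sigma> w)) mod int m, \<sigma> \<circ> \<tau>)"
  by (simp add: gen_sym_def)

lemma gen_sym_one: "\<one>\<^bsub>gen_sym m X\<^esub> = (\<lambda>_. 0, id)"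
  by (simp add: gen_sym_def)

lemma snd_gen_sym_mult: "snd (a \<otimes>\<^bsub>gen_sym m X\<^esub> b) = snd a \<circ> snd b"
  by (cases a; cases b) (simp add: gen_sym_mult)

text \<open>Lets products of solvable pairs be computed on all vertices although the pairs are
  regarded as elements of the group without the empty vertex.\<close>

lemma gen_sym_mult_indep: "monoid.mult (gen_sym m X) = monoid.mult (gen_sym m Y)"
  by (simp add: gen_sym_def)

lemma gen_sym_carrier_iff:
  "(x, \<sigma>) \<in> carrier (gen_sym m X) \<longleftrightarrow>
     (\<forall>w\<in>X. 0 \<le> x w \<and> x w < int m) \<and> (\<forall>w. w \<notin> X \<longrightarrow> x w = 0) \<and> \<sigma> permutes X"
  by (simp add: gen_sym_def)

lemma gen_sym_carrier_Diff:
  assumes "m \<ge> 1"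
  shows "a \<in> carrier (gen_sym m (X - {v})) \<longleftrightarrow>
     a \<in> carrier (gen_sym m X) \<and> fst a v = 0 \<and> snd a v = v"
proof -
  obtain x \<sigma> where a: "a = (x, \<sigma>)" by (cases a)
  have "\<sigma> permutes X - {v} \<longleftrightarrow> \<sigma> permutes X \<and> \<sigma> v = v"
    using permutes_superset[of \<sigma> X "X - {v}"]
    by (auto simp: permutes_not_in[of \<sigma> "X - {v}" v] intro: permutes_subset)
  then show ?thesis
    using assms unfolding a by (cases "v \<in> X") (auto simp: gen_sym_carrier_iff permutes_not_in)
qed

text \<open>The permutation only rearranges the entries of the second vector, so the coordinate sum
  modulo m is a homomorphism.\<close>

lemma sum_gen_sym_mult:
  assumes "\<sigma> permutes X"
  shows "(\<Sum>w\<in>X. fst ((x, \<sigma>) \<otimes>\<^bsub>gen_sym m Y\<^esub> (y, \<tau>)) w) mod int m = (sum x X + sum y X) mod int m"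
proof -
  have "(\<Sum>w\<in>X. y (inv_into UNIV \<sigma> w)) = sum y X"
    using sum.permute[OF permutes_inv[OF assms], of y] by (simp add: comp_def)
  then show ?thesis
    by (simp add: gen_sym_mult mod_sum_eq sum.distrib)
qed

locale twisted_digraph = bidirected_digraph G rv for G :: "('v, 'e) pre_digraph" and rv +
  fixes m :: nat and \<gamma> :: "'e \<Rightarrow> int"
  assumes m_pos: "m \<ge> 1" and chain: "\<gamma> \<in> one_chains m G rv"
    and finite_verts: "finite (verts G)"
    and no_loop: "e \<in> arcs G \<Longrightarrow> tail G e \<noteq> head G e"
begin

abbreviation "GS \<equiv> gen_sym m (verts G)"
abbreviation "wp \<equiv> walk_pair m G \<gamma>"
abbreviation "solv \<equiv> solvable_pairs m G \<gamma>"
abbreviation "rev_walk p \<equiv> map rv (rev p)"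

lemma gamma_bounds: "e \<in> arcs G \<Longrightarrow> 0 \<le> \<gamma> e \<and> \<gamma> e < int m"
  using chain by (auto simp: one_chains_def PiE_iff)

lemma gamma_rev: "e \<in> arcs G \<Longrightarrow> \<gamma> (rv e) = (- \<gamma> e) mod int m"
  using chain by (auto simp: one_chains_def)

lemma arc_pair_closed: "e \<in> arcs G \<Longrightarrow> arc_pair G \<gamma> e \<in> carrier GS"
  using gamma_bounds m_pos
  by (auto simp: arc_pair_def gen_sym_carrier_iff permutes_swap_id)

end

sublocale twisted_digraph \<subseteq> GS: group "gen_sym m (verts G)"
  by (rule gen_sym_group[OF m_pos])

context twisted_digraph
begin

lemma wp_closed: "set p \<subseteq> arcs G \<Longrightarrow> wp p \<in> carrier GS"
  by (induction p) (auto intro!: GS.m_closed arc_pair_closed GS.one_closed)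

lemma wp_append:
  "set p \<subseteq> arcs G \<Longrightarrow> set q \<subseteq> arcs G \<Longrightarrow> wp (p @ q) = wp q \<otimes>\<^bsub>GS\<^esub> wp p"
  by (induction p) (simp_all add: wp_closed GS.m_assoc arc_pair_closed)

text \<open>The second transposition carries the entry \<open>\<gamma> e\<close> from the tail to
  the head of \<open>e\<close>, which is where the reversed arc puts its negative.\<close>

lemma arc_pair_rev:
  assumes "e \<in> arcs G"
  shows "arc_pair G \<gamma> (rv e) \<otimes>\<^bsub>GS\<^esub> arc_pair G \<gamma> e = \<one>\<^bsub>GS\<^esub>"
  using assms no_loop[OF assms]
  by (auto simp: arc_pair_def gen_sym_mult gen_sym_one fun_eq_iff gamma_rev mod_simps
      transpose_commute transpose_def)

lemma wp_rev:
  assumes "set p \<subseteq> arcs G"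
  shows "wp (rev_walk p) = inv\<^bsub>GS\<^esub> wp p"
  using assms
proof (induction p)
  case (Cons f p)
  have "set (rev_walk p) \<subseteq> arcs G" using Cons by auto
  then have "wp (rev_walk (f # p)) = arc_pair G \<gamma> (rv f) \<otimes>\<^bsub>GS\<^esub> inv\<^bsub>GS\<^esub> wp p"
    using Cons by (simp add: wp_append arc_pair_closed)
  moreover have "arc_pair G \<gamma> (rv f) = inv\<^bsub>GS\<^esub> arc_pair G \<gamma> f"
    using Cons arc_pair_rev[of f] by (intro GS.inv_equality[symmetric]) (auto intro: arc_pair_closed)
  ultimately show ?case
    using Cons by (simp add: GS.inv_mult_group wp_closed arc_pair_closed)
qed simp

lemma awalk_rev: "awalk u p w \<Longrightarrow> awalk w (rev_walk p) u"
proof (induction p arbitrary: u)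
  case (Cons f p)
  then show ?case
    by (auto simp: awalk_Cons_iff intro!: awalk_appendI[of _ _ "head G f"] simp del: awalk_append_iff)
      (simp add: awalk_simps)
qed (simp add: awalk_simps)

lemma awalk_arcs: "awalk u p w \<Longrightarrow> set p \<subseteq> arcs G"
  by (auto simp: awalk_def)

lemma wp_end:
  assumes "awalk u p w" "wp p = (x, \<sigma>)"
  shows "\<sigma> u = w" "x w = 0" "\<sigma> permutes verts G"
  using walk_pair_end[OF wf_digraph_axioms no_loop chain m_pos assms(1)] assms(2)
  by (simp_all add: gen_sym_carrier_iff)

lemma solv_carrier: "solv v \<subseteq> carrier (gen_sym m (verts G - {v}))"
  by (rule solvable_pairs_subset[OF wf_digraph_axioms no_loop chain m_pos])

lemma solvI: "awalk v p v \<Longrightarrow> wp p \<in> solv v"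
  by (auto simp: solvable_pairs_def)

lemma solv_subgroup:
  assumes "v \<in> verts G"
  shows "subgroup (solv v) (gen_sym m (verts G - {v}))" (is "subgroup _ ?H")
proof
  show "solv v \<subseteq> carrier ?H"
    by (rule solv_carrier)
next
  fix a b assume "a \<in> solv v" "b \<in> solv v"
  then obtain p q where pq: "a = wp p" "b = wp q" "awalk v p v" "awalk v q v"
    by (auto simp: solvable_pairs_def)
  then have "a \<otimes>\<^bsub>GS\<^esub> b = wp (q @ p)" "awalk v (q @ p) v"
    by (simp_all add: wp_append awalk_arcs awalk_appendI)
  then show "a \<otimes>\<^bsub>?H\<^esub> b \<in> solv v"
    using gen_sym_mult_indep[of m "verts G" "verts G - {v}"] solvI by metis
next
  have "awalk v [] v" using assms by (simp add: awalk_simps)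
  then show "\<one>\<^bsub>?H\<^esub> \<in> solv v" using solvI by (fastforce simp: gen_sym_one)
next
  fix a assume a: "a \<in> solv v"
  then obtain p where p: "a = wp p" "awalk v p v" by (auto simp: solvable_pairs_def)
  let ?b = "wp (rev_walk p)"
  have b: "?b \<in> solv v" by (rule solvI[OF awalk_rev[OF p(2)]])
  have "?b \<otimes>\<^bsub>GS\<^esub> a = \<one>\<^bsub>GS\<^esub>"
    using wp_rev[OF awalk_arcs[OF p(2)]] wp_closed[OF awalk_arcs[OF p(2)]] p by simp
  then have "?b \<otimes>\<^bsub>?H\<^esub> a = \<one>\<^bsub>?H\<^esub>"
    using gen_sym_mult_indep[of m "verts G" "verts G - {v}"] by (simp add: gen_sym_one)
  then have "inv\<^bsub>?H\<^esub> a = ?b"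
    using a b solv_carrier by (intro group.inv_equality[OF gen_sym_group[OF m_pos]]) auto
  then show "inv\<^bsub>?H\<^esub> a \<in> solv v" using b by simp
qed

text \<open>A token that the walk never meets is neither moved nor twisted. This supplies the zero
  entries of the loop vectors.\<close>

lemma wp_avoid:
  assumes "set p \<subseteq> arcs G" "\<And>f. f \<in> set p \<Longrightarrow> tail G f \<noteq> w \<and> head G f \<noteq> w" "wp p = (x, \<sigma>)"
  shows "x w = 0 \<and> \<sigma> w = w"
  using assms
proof (induction p arbitrary: x \<sigma>)
  case (Cons f p)
  obtain y \<tau> where p: "wp p = (y, \<tau>)" by fastforce
  have "\<tau> permutes verts G"
    using wp_closed[of p] Cons.prems(1) p by (simp add: gen_sym_carrier_iff)
  moreover have IH: "y w = 0" "\<tau> w = w" using Cons.IH[OF _ _ p] Cons.prems by auto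
  ultimately have "inv_into UNIV \<tau> w = w" by (metis permutes_inverses(2))
  moreover have "w \<noteq> tail G f" "w \<noteq> head G f" using Cons.prems(2)[of f] by auto
  ultimately show ?case
    using IH Cons.prems(3) p by (auto simp: arc_pair_def gen_sym_mult)
qed (simp add: gen_sym_one)

lemma sum_wp:
  "set p \<subseteq> arcs G \<Longrightarrow> (\<Sum>w\<in>verts G. fst (wp p) w) mod int m = (\<Sum>f\<leftarrow>p. \<gamma> f) mod int m"
proof (induction p)
  case (Cons f p)
  obtain x \<sigma> where p: "wp p = (x, \<sigma>)" by fastforce
  have perm: "\<sigma> permutes verts G"
    using wp_closed[of p] Cons.prems p by (simp add: gen_sym_carrier_iff)
  have f: "(\<Sum>w\<in>verts G. fst (arc_pair G \<gamma> f) w) = \<gamma> f"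
    using Cons.prems finite_verts by (simp add: arc_pair_def fun_upd_def sum.delta' tail_in_verts)
  have "(\<Sum>w\<in>verts G. fst (wp (f # p)) w) mod int m
      = (sum x (verts G) + (\<Sum>w\<in>verts G. fst (arc_pair G \<gamma> f) w)) mod int m"
    using sum_gen_sym_mult[OF perm, where x = x and y = "fst (arc_pair G \<gamma> f)"
        and \<tau> = "snd (arc_pair G \<gamma> f)" and m = m and Y = "verts G"] p by simp
  also have "\<dots> = (sum x (verts G) mod int m + \<gamma> f) mod int m"
    by (simp add: f mod_simps)
  also have "\<dots> = (\<Sum>g\<leftarrow>f # p. \<gamma> g) mod int m"
    using Cons p by (simp add: mod_simps add.commute)
  finally show ?case .
qed (simp add: gen_sym_one)

lemma sum_verts_Diff:
  assumes "(x, \<sigma>) \<in> carrier (gen_sym m (verts G - {v}))"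
  shows "sum x (verts G - {v}) = sum x (verts G)"
  using assms by (intro sum.mono_neutral_left) (auto simp: gen_sym_carrier_iff finite_verts)

text \<open>Going along \<open>q\<close>, around a loop at \<open>v\<close> and back conjugates by
  \<open>wp q\<close>. The sums of \<open>wp q\<close> and its inverse cancel, so the coordinate sum
  survives and only the permutation is conjugated. Hence any criterion \<open>\<Phi>\<close> that
  sees just the permutation and the sum modulo m passes from \<open>u\<close> to
  \<open>v\<close>.\<close>

lemma solv_transport:
  assumes q: "awalk u q v" "wp q = (y, \<tau>)"
    and u: "\<And>x \<sigma>. (x, \<sigma>) \<in> carrier (gen_sym m (verts G - {u})) \<Longrightarrow>
      (x, \<sigma>) \<in> solv u \<longleftrightarrow> \<Phi> \<sigma> (sum x (verts G - {u}) mod int m)"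
    and a: "(x, \<sigma>) \<in> carrier (gen_sym m (verts G - {v}))"
  shows "(x, \<sigma>) \<in> solv v \<longleftrightarrow> \<Phi> (inv_into UNIV \<tau> \<circ> \<sigma> \<circ> \<tau>) (sum x (verts G - {v}) mod int m)"
proof -
  let ?a = "(x, \<sigma>)" and ?w = "wp q" and ?w' = "wp (rev_walk q)"
  have arcs: "set q \<subseteq> arcs G" "set (rev_walk q) \<subseteq> arcs G"
    using awalk_arcs[OF q(1)] by auto
  have a': "?a \<in> carrier GS" "x v = 0" "\<sigma> v = v"
    using a by (simp_all add: gen_sym_carrier_Diff[OF m_pos])
  have w: "?w \<in> carrier GS" "?w' = inv\<^bsub>GS\<^esub> ?w" using arcs by (simp_all only: wp_closed wp_rev)
  have perm: "\<tau> permutes verts G" "\<sigma> permutes verts G"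
    using w(1) a' q(2) by (simp_all add: gen_sym_carrier_iff)
  obtain y' \<tau>' where w': "?w' = (y', \<tau>')" by fastforce
  note w_end = wp_end[OF q] and w'_end = wp_end[OF awalk_rev[OF q(1)] w']
  have "?w' \<otimes>\<^bsub>GS\<^esub> ?w = \<one>\<^bsub>GS\<^esub>" using w by simp
  then have ww: "(y', \<tau>') \<otimes>\<^bsub>GS\<^esub> (y, \<tau>) = (\<lambda>_. 0, id)"
    by (simp only: w' q(2) gen_sym_one)
  then have "\<tau>' \<circ> \<tau> = id" by (simp add: gen_sym_mult)
  have sumw: "(sum y' (verts G) + sum y (verts G)) mod int m = 0"
    using sum_gen_sym_mult[OF w'_end(3), where x = y' and y = y and m = m and Y = "verts G" and \<tau> = \<tau>]
    by (simp add: ww)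
  have tau': "\<tau>' = inv_into UNIV \<tau>"
    using \<open>\<tau>' \<circ> \<tau> = id\<close> permutes_inv_o(1)[OF perm(1)] by (metis comp_id o_assoc id_comp)
  \<comment> \<open>The conjugate of the given pair; products run right to left, so
    \<open>wp q\<close> acts first. It remains to see that \<open>b\<close> fixes \<open>u\<close>
    with entry 0 there and has the same coordinate sum.\<close>
  define b where "b = ?w' \<otimes>\<^bsub>GS\<^esub> (?a \<otimes>\<^bsub>GS\<^esub> ?w)"
  obtain z \<rho> where b: "b = (z, \<rho>)" by (cases b)
  have bc: "b \<in> carrier GS" using a' w by (simp add: b_def)
  have aw: "?a \<otimes>\<^bsub>GS\<^esub> ?w = (\<lambda>t. (x t + y (inv_into UNIV \<sigma> t)) mod int m, \<sigma> \<circ> \<tau>)"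
    by (simp add: q(2) gen_sym_mult)
  have rho: "\<rho> = inv_into UNIV \<tau> \<circ> \<sigma> \<circ> \<tau>"
    using b by (auto simp: b_def aw w' tau' gen_sym_mult o_assoc)
  have tv: "\<tau> u = v" "y v = 0" "y' u = 0" using w_end w'_end by simp_all
  have iv: "inv_into UNIV \<sigma> v = v" "inv_into UNIV \<tau> v = u"
    using perm a'(3) tv(1) by (metis permutes_inverses(2))+
  have "inv_into UNIV (inv_into UNIV \<tau>) u = v"
    using perm tv by (simp add: permutes_inv_inv)
  then have "z u = 0"
    using b a' tv iv by (auto simp: b_def aw w' tau' gen_sym_mult)
  moreover have "\<rho> u = u" using rho tv a' iv by simp
  ultimately have bu: "(z, \<rho>) \<in> carrier (gen_sym m (verts G - {u}))"
    using bc b by (simp add: gen_sym_carrier_Diff[OF m_pos])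
  have "sum z (verts G) mod int m
      = (sum y' (verts G) + (\<Sum>t\<in>verts G. fst (?a \<otimes>\<^bsub>GS\<^esub> ?w) t)) mod int m"
    using sum_gen_sym_mult[OF w'_end(3), where x = y' and m = m and Y = "verts G"
        and y = "fst (?a \<otimes>\<^bsub>GS\<^esub> ?w)" and \<tau> = "snd (?a \<otimes>\<^bsub>GS\<^esub> ?w)"] b
    by (simp add: b_def w')
  also have "\<dots> = (sum y' (verts G) + (sum x (verts G) + sum y (verts G))) mod int m"
    using sum_gen_sym_mult[OF perm(2), where x = x and y = y and \<tau> = \<tau> and m = m and Y = "verts G"] q(2)
    by (metis mod_add_right_eq)
  also have "\<dots> = ((sum y' (verts G) + sum y (verts G)) mod int m + sum x (verts G)) mod int m"
    by (simp add: mod_simps algebra_simps)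
  finally have sums: "sum z (verts G - {u}) mod int m = sum x (verts G - {v}) mod int m"
    using sumw sum_verts_Diff[OF bu] sum_verts_Diff[OF a] by simp
  have "?a \<in> solv v \<longleftrightarrow> b \<in> solv u"
  proof
    assume "?a \<in> solv v"
    then obtain p where p: "?a = wp p" "awalk v p v" by (auto simp: solvable_pairs_def)
    have "awalk u (q @ p @ rev_walk q) u"
      using q p awalk_rev[OF q(1)] by (auto intro: awalk_appendI)
    moreover have "wp (q @ p @ rev_walk q) = b"
      using arcs awalk_arcs[OF p(2)] w wp_closed
      by (simp add: wp_append b_def p(1) GS.m_assoc)
    ultimately show "b \<in> solv u" using solvI by metis
  next
    assume "b \<in> solv u"
    then obtain p where p: "b = wp p" "awalk u p u" by (auto simp: solvable_pairs_def)
    have "awalk v (rev_walk q @ p @ q) v"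
      using q p awalk_rev[OF q(1)] by (auto intro: awalk_appendI)
    moreover have "wp (rev_walk q @ p @ q) = ?w \<otimes>\<^bsub>GS\<^esub> b \<otimes>\<^bsub>GS\<^esub> ?w'"
      using arcs awalk_arcs[OF p(2)] wp_closed
      by (simp add: wp_append p(1) GS.m_assoc)
    moreover have "\<dots> = ?a"
      using w a' by (simp add: b_def GS.m_assoc) (simp flip: GS.m_assoc)
    ultimately show "?a \<in> solv v" using solvI by metis
  qed
  then show ?thesis using u[OF bu] b sums rho by simp
qed

end

section \<open>Translations and attained sums\<close>

locale twisted_perms =
  fixes m :: nat and X :: "'v set" and P :: "(('v \<Rightarrow> int) \<times> ('v \<Rightarrow> 'v)) set"
  assumes m_pos: "m \<ge> 1" and finite_X: "finite X"
    and subgroup_P: "subgroup P (gen_sym m X)"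
begin

text \<open>Entries are arbitrary integers and are reduced only on entering \<open>P\<close>. In
  this way the translations form an honest Z-module of integer vectors.\<close>

definition shifts :: "('v \<Rightarrow> int) set" where
  "shifts = {x. (\<lambda>w. x w mod int m, id) \<in> P}"

text \<open>Forgets the vector except for its sum. Once all zero-sum vectors are translations, this
  loses nothing.\<close>

definition attained :: "int \<Rightarrow> ('v \<Rightarrow> 'v) \<Rightarrow> bool" where
  "attained s \<sigma> \<longleftrightarrow> (\<exists>x. (x, \<sigma>) \<in> P \<and> [sum x X = s] (mod int m))"

lemma P_mult: "(x, \<sigma>) \<in> P \<Longrightarrow> (y, \<tau>) \<in> P \<Longrightarrow>
    (\<lambda>w. (x w + y (inv_into UNIV \<sigma> w)) mod int m, \<sigma> \<circ> \<tau>) \<in> P"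
  using subgroup.m_closed[OF subgroup_P] gen_sym_mult by metis

lemma P_one: "(\<lambda>_. 0, id) \<in> P"
  using subgroup.one_closed[OF subgroup_P] by (simp add: gen_sym_one)

lemma P_carrier: "(x, \<sigma>) \<in> P \<Longrightarrow> (x, \<sigma>) \<in> carrier (gen_sym m X)"
  using subgroup.subset[OF subgroup_P] by auto

lemma P_permutes: "(x, \<sigma>) \<in> P \<Longrightarrow> \<sigma> permutes X"
  using P_carrier by (simp add: gen_sym_carrier_iff)

lemma P_inv:
  assumes "(x, \<sigma>) \<in> P"
  obtains y where "(y, inv_into UNIV \<sigma>) \<in> P"
    "\<And>w. (x w + y (inv_into UNIV \<sigma> w)) mod int m = 0"
proof -
  interpret group "gen_sym m X" by (rule gen_sym_group[OF m_pos])
  obtain y \<tau> where i: "inv\<^bsub>gen_sym m X\<^esub> (x, \<sigma>) = (y, \<tau>)" by fastforce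
  have p: "\<sigma> permutes X" by (rule P_permutes[OF assms])
  have "(x, \<sigma>) \<otimes>\<^bsub>gen_sym m X\<^esub> (y, \<tau>) = \<one>\<^bsub>gen_sym m X\<^esub>"
    using P_carrier[OF assms] by (simp flip: i)
  then have 1: "\<sigma> \<circ> \<tau> = id" "\<And>w. (x w + y (inv_into UNIV \<sigma> w)) mod int m = 0"
    by (auto simp: gen_sym_mult gen_sym_one dest: fun_cong)
  have "\<tau> = inv_into UNIV \<sigma>"
    using 1(1) permutes_inv_o(2)[OF p] by (metis comp_id o_assoc id_comp)
  then show thesis
    using that 1(2) subgroup.m_inv_closed[OF subgroup_P assms] i by simp
qed

lemma shifts_cong: "x \<in> shifts \<Longrightarrow> (\<And>w. [x w = y w] (mod int m)) \<Longrightarrow> y \<in> shifts"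
  by (simp add: shifts_def cong_def)

lemma shifts_add: "x \<in> shifts \<Longrightarrow> y \<in> shifts \<Longrightarrow> (\<lambda>w. x w + y w) \<in> shifts"
  using P_mult[of "\<lambda>w. x w mod int m" id "\<lambda>w. y w mod int m" id]
  by (simp add: shifts_def mod_simps)

lemma shifts_zero: "(\<lambda>_. 0) \<in> shifts"
  using P_one by (simp add: shifts_def)

lemma shifts_uminus: "x \<in> shifts \<Longrightarrow> (\<lambda>w. - x w) \<in> shifts"
proof -
  assume "x \<in> shifts"
  then obtain y where y: "(y, id) \<in> P" "\<And>w. (x w mod int m + y w) mod int m = 0"
    using P_inv[of "\<lambda>w. x w mod int m" id] by (auto simp: shifts_def)
  have "y w = - x w mod int m" for w
  proof -
    have "y w mod int m = y w"
      using P_carrier[OF y(1)] by (cases "w \<in> X") (auto simp: gen_sym_carrier_iff)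
    moreover have "[x w + y w = 0] (mod int m)" using y(2)[of w] by (simp add: cong_def mod_simps)
    then have "[y w = - x w] (mod int m)" by (simp add: cong_iff_dvd_diff add.commute)
    ultimately show ?thesis by (simp add: cong_def)
  qed
  then have "y = (\<lambda>w. - x w mod int m)" by blast
  then show ?thesis using y(1) by (simp add: shifts_def)
qed

lemma shifts_diff: "x \<in> shifts \<Longrightarrow> y \<in> shifts \<Longrightarrow> (\<lambda>w. x w - y w) \<in> shifts"
  using shifts_add[OF _ shifts_uminus, of x y] by simp

lemma shifts_scale: "x \<in> shifts \<Longrightarrow> (\<lambda>w. k * x w) \<in> shifts"
proof -
  assume x: "x \<in> shifts"
  have nat: "(\<lambda>w. int n * x w) \<in> shifts" for n
  proof (induction n)
    case (Suc n)
    show ?case using shifts_add[OF Suc x] by (simp add: algebra_simps)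
  qed (simp add: shifts_zero)
  show ?thesis
    using nat[of "nat k"] shifts_uminus[OF nat[of "nat (- k)"]] by (cases "k \<ge> 0") simp_all
qed

lemma shifts_sum:
  "finite I \<Longrightarrow> (\<And>i. i \<in> I \<Longrightarrow> f i \<in> shifts) \<Longrightarrow> (\<lambda>w. \<Sum>i\<in>I. f i w) \<in> shifts"
  by (induction I rule: finite_induct) (simp_all add: shifts_zero shifts_add)

text \<open>\<open>P\<close> need not contain the pure permutation \<open>\<sigma>\<close>, but
  conjugating a translation by any pair over \<open>\<sigma>\<close> cancels the vector
  \<open>z\<close> and permutes the coordinates.\<close>

lemma shifts_perm:
  assumes "x \<in> shifts" "(z, \<sigma>) \<in> P"
  shows "(\<lambda>w. x (inv_into UNIV \<sigma> w)) \<in> shifts"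
proof -
  obtain y where y: "(y, inv_into UNIV \<sigma>) \<in> P"
    "\<And>w. (z w + y (inv_into UNIV \<sigma> w)) mod int m = 0"
    using P_inv[OF assms(2)] by blast
  have "((z w + x (inv_into UNIV \<sigma> w) mod int m) mod int m + y (inv_into UNIV \<sigma> w)) mod int m
      = x (inv_into UNIV \<sigma> w) mod int m" (is "?l = _") for w
  proof -
    have "?l = ((z w + y (inv_into UNIV \<sigma> w)) mod int m + x (inv_into UNIV \<sigma> w)) mod int m"
      by (simp add: mod_simps ac_simps)
    then show ?thesis using y(2)[of w] by simp
  qed
  then show ?thesis
    using P_mult[OF P_mult[OF assms(2) assms(1)[unfolded shifts_def, simplified]] y(1)]
      permutes_inv_o(1)[OF P_permutes[OF assms(2)]]
    by (simp add: shifts_def)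
qed

text \<open>Bezout: the multiples by \<open>b\<close> and \<open>c\<close> of one vector combine to
  the vector itself modulo m.\<close>

lemma shifts_combination:
  assumes "(\<lambda>w. b * x w) \<in> shifts" "(\<lambda>w. c * x w) \<in> shifts" "[b * s + c * t = 1] (mod int m)"
  shows "x \<in> shifts"
proof (rule shifts_cong)
  show "(\<lambda>w. s * (b * x w) + t * (c * x w)) \<in> shifts"
    using shifts_add[OF shifts_scale[OF assms(1), of s] shifts_scale[OF assms(2), of t]] .
  show "[s * (b * x w) + t * (c * x w) = x w] (mod int m)" for w
    using cong_mult[OF assms(3) cong_refl, of "x w"] by (simp add: algebra_simps)
qed

text \<open>Each power collects one more entry along the backward orbit, because the product reads
  the second vector through the inverse of \<open>\<sigma>\<close>.\<close>

lemma P_funpow: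
  assumes "(x, \<sigma>) \<in> P"
  shows "(\<lambda>w. (\<Sum>i<n. x ((inv_into UNIV \<sigma> ^^ i) w)) mod int m, \<sigma> ^^ n) \<in> P"
proof (induction n)
  case (Suc n)
  have "(\<Sum>i<Suc n. x ((inv_into UNIV \<sigma> ^^ i) w))
      = x w + (\<Sum>i<n. x ((inv_into UNIV \<sigma> ^^ i) (inv_into UNIV \<sigma> w)))" for w
    by (simp add: sum.lessThan_Suc_shift funpow_swap1 del: sum.lessThan_Suc)
  then show ?case using P_mult[OF assms Suc] by (simp add: mod_simps comp_def)
qed (simp add: P_one flip: id_def)

lemma shifts_cycle:
  assumes "(x, \<sigma>) \<in> P" "\<sigma> ^^ n = id"
  shows "(\<lambda>w. \<Sum>i<n. x ((inv_into UNIV \<sigma> ^^ i) w)) \<in> shifts"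
  using P_funpow[OF assms(1), of n] assms(2) by (simp add: shifts_def)

lemma attainedI: "(x, \<sigma>) \<in> P \<Longrightarrow> [sum x X = s] (mod int m) \<Longrightarrow> attained s \<sigma>"
  by (auto simp: attained_def)

lemma attained_cong: "attained s \<sigma> \<Longrightarrow> [s = t] (mod int m) \<Longrightarrow> attained t \<sigma>"
  unfolding attained_def using cong_trans by blast

lemma attained_mult:
  assumes "attained s \<sigma>" "attained t \<tau>"
  shows "attained (s + t) (\<sigma> \<circ> \<tau>)"
proof -
  obtain x y where xy: "(x, \<sigma>) \<in> P" "[sum x X = s] (mod int m)"
    "(y, \<tau>) \<in> P" "[sum y X = t] (mod int m)"
    using assms by (auto simp: attained_def)
  have "[(\<Sum>w\<in>X. (x w + y (inv_into UNIV \<sigma> w)) mod int m) = sum x X + sum y X] (mod int m)"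
    using sum_gen_sym_mult[OF P_permutes[OF xy(1)], where x = x and y = y and m = m and Y = X and \<tau> = \<tau>]
    by (simp add: gen_sym_mult cong_def)
  then show ?thesis
    using P_mult[OF xy(1,3)] cong_trans[OF _ cong_add[OF xy(2,4)]] by (auto simp: attained_def)
qed

lemma attained_id_iff: "attained s id \<longleftrightarrow> (\<exists>x\<in>shifts. [sum x X = s] (mod int m))"
proof
  assume "attained s id"
  then obtain x where x: "(x, id) \<in> P" "[sum x X = s] (mod int m)" by (auto simp: attained_def)
  have "x w mod int m = x w" for w
    using P_carrier[OF x(1)] by (cases "w \<in> X") (auto simp: gen_sym_carrier_iff)
  then show "\<exists>x\<in>shifts. [sum x X = s] (mod int m)"
    using x by (intro bexI[of _ x]) (simp_all add: shifts_def)
next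
  assume "\<exists>x\<in>shifts. [sum x X = s] (mod int m)"
  then obtain x where "((\<lambda>w. x w mod int m), id) \<in> P" "[sum x X = s] (mod int m)"
    by (auto simp: shifts_def)
  then show "attained s id"
    by (auto intro!: attainedI simp: cong_def mod_sum_eq)
qed

lemma attained_zero: "attained 0 id"
  by (rule attainedI[OF P_one]) simp

lemma attained_scale: "attained s id \<Longrightarrow> attained (k * s) id"
proof -
  assume "attained s id"
  then obtain x where "x \<in> shifts" "[sum x X = s] (mod int m)" by (auto simp: attained_id_iff)
  then show ?thesis
    using shifts_scale[of x k] cong_scalar_left[of "sum x X" s "int m" k]
    by (auto simp: attained_id_iff sum_distrib_left intro!: bexI)
qed

lemma attained_id_mult: "attained s \<sigma> \<Longrightarrow> attained t id \<Longrightarrow> attained (s + t) \<sigma>"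
  using attained_mult[of s \<sigma> t id] by simp

lemma attained_all: "attained s \<sigma> \<Longrightarrow> attained 1 id \<Longrightarrow> attained t \<sigma>"
  using attained_id_mult[OF _ attained_scale, of s \<sigma> 1 "t - s"] by simp

lemma zero_sum_in_shifts:
  assumes basis: "\<And>i j. i \<in> X \<Longrightarrow> j \<in> X \<Longrightarrow> i \<noteq> j \<Longrightarrow> (\<lambda>w. of_bool (w = i) - of_bool (w = j)) \<in> shifts"
    and x: "\<And>w. w \<notin> X \<Longrightarrow> x w = 0" "[sum x X = 0] (mod int m)"
  shows "x \<in> shifts"
proof (cases "X = {}")
  case True
  then have "x = (\<lambda>_. 0)" using x(1) by auto
  then show ?thesis using shifts_zero by simp
next
  case False
  then obtain p where p: "p \<in> X" by blast
  \<comment> \<open>Each entry \<open>x i\<close> is balanced by its negative at a base point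
    \<open>p\<close>. The total surplus at \<open>p\<close> is minus the coordinate sum, which
    vanishes modulo m; the term with \<open>i = p\<close> is the zero vector.\<close>
  let ?f = "\<lambda>i w. x i * (of_bool (w = i) - of_bool (w = p))"
  have "?f i \<in> shifts" if "i \<in> X" for i
    using basis[OF that p] shifts_scale[of "\<lambda>w. of_bool (w = i) - of_bool (w = p)" "x i"] shifts_zero
    by (cases "i = p") simp_all
  then have "(\<lambda>w. \<Sum>i\<in>X. ?f i w) \<in> shifts"
    by (intro shifts_sum finite_X)
  moreover have "(\<Sum>i\<in>X. ?f i w) = x w - of_bool (w = p) * sum x X" for w
  proof -
    have "?f i w = (if w = i then x i else 0) - of_bool (w = p) * x i" for i
      by simp
    then have "(\<Sum>i\<in>X. ?f i w) = (\<Sum>i\<in>X. if w = i then x i else 0) - of_bool (w = p) * sum x X"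
      by (simp only: sum_subtractf sum_distrib_left)
    then show ?thesis using x(1) finite_X by (simp add: sum.delta)
  qed
  moreover have "[x w - of_bool (w = p) * sum x X = x w] (mod int m)" for w
    using x(2) by (simp add: cong_iff_dvd_diff cong_0_iff)
  ultimately show ?thesis
    using shifts_cong[of "\<lambda>w. \<Sum>i\<in>X. ?f i w" x] by simp
qed

text \<open>Two pairs with the same permutation and the same sum differ by a zero-sum translation,
  which lies in \<open>P\<close>.\<close>

lemma mem_P_iff:
  assumes basis: "\<And>i j. i \<in> X \<Longrightarrow> j \<in> X \<Longrightarrow> i \<noteq> j \<Longrightarrow> (\<lambda>w. of_bool (w = i) - of_bool (w = j)) \<in> shifts"
    and y: "(y, \<sigma>) \<in> carrier (gen_sym m X)"
  shows "(y, \<sigma>) \<in> P \<longleftrightarrow> attained (sum y X) \<sigma>"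
proof
  assume "attained (sum y X) \<sigma>"
  then obtain x where x: "(x, \<sigma>) \<in> P" "[sum x X = sum y X] (mod int m)"
    by (auto simp: attained_def)
  have "(\<lambda>w. y w - x w) \<in> shifts"
    using P_carrier[OF x(1)] y x(2)
    by (intro zero_sum_in_shifts[OF basis])
      (auto simp: gen_sym_carrier_iff sum_subtractf cong_iff_dvd_diff dvd_diff_commute)
  moreover have "((y w - x w) mod int m + x w) mod int m = y w" for w
    using y by (cases "w \<in> X") (auto simp: gen_sym_carrier_iff mod_simps)
  ultimately show "(y, \<sigma>) \<in> P"
    using P_mult[of "\<lambda>w. (y w - x w) mod int m" id x \<sigma>] x(1) by (simp add: shifts_def)
qed (auto simp: attained_def)

end

section \<open>Invariants along walks, and \<open>\<phi>\<close> for a fixed orientation\<close>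

context twisted_digraph
begin

text \<open>The first arc of a walk is the rightmost factor, so induction keeps the end
  \<open>v\<close> fixed and lets the start vary. This is why the step goes from the head of an arc
  to its tail.\<close>

lemma walk_invariant:
  assumes "awalk u p v" "I v 0 id"
    and step: "\<And>e s \<sigma>. e \<in> arcs G \<Longrightarrow> I (head G e) s \<sigma> \<Longrightarrow>
      I (tail G e) (s + \<gamma> e) (\<sigma> \<circ> transpose (tail G e) (head G e))"
  shows "I u (\<Sum>f\<leftarrow>p. \<gamma> f) (snd (wp p))"
  using assms(1)
proof (induction p arbitrary: u)
  case (Cons f p)
  have f: "f \<in> arcs G" "I (head G f) (\<Sum>f\<leftarrow>p. \<gamma> f) (snd (wp p))" "u = tail G f"
    using Cons by (auto simp: awalk_Cons_iff)
  have wp: "snd (wp (f # p)) = snd (wp p) \<circ> transpose (tail G f) (head G f)"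
    by (simp add: snd_gen_sym_mult arc_pair_def)
  then show ?case
    using step[OF f(1,2)] unfolding wp f(3) by (simp only: list.map sum_list.Cons add.commute)
qed (use assms(2) in \<open>auto simp: awalk_Nil_iff gen_sym_one\<close>)

text \<open>The choice operator may pick either orientation of an edge; modulo m both give the same
  product, so any set of representatives \<open>A\<close> will do.\<close>

lemma phi_oriented:
  assumes "arcs G = A \<union> rv ` A" "A \<inter> rv ` A = {}" "\<omega> \<in> one_chains m G rv"
  shows "\<phi> m G rv \<gamma> \<omega> = (\<Sum>e\<in>A. \<gamma> e * \<omega> e) mod int m"
proof -
  have edges: "edges G rv = (\<lambda>e. {e, rv e}) ` A"
    using assms(1) by (auto simp: edges_def image_Un image_image insert_commute)
  have inj: "inj_on (\<lambda>e. {e, rv e}) A"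
    using assms(2) by (auto simp: inj_on_def doubleton_eq_iff)
  have "(\<gamma> (SOME f. f \<in> {e, rv e}) * \<omega> (SOME f. f \<in> {e, rv e})) mod int m = (\<gamma> e * \<omega> e) mod int m"
    if "e \<in> A" for e
  proof -
    have "(SOME f. f \<in> {e, rv e}) \<in> {e, rv e}" by (rule someI[of _ e]) simp
    moreover have "e \<in> arcs G" using that assms(1) by blast
    ultimately show ?thesis
      using one_chains_mult_rev[OF chain assms(3), of e] by auto
  qed
  then have "(\<Sum>e\<in>A. (\<gamma> (SOME f. f \<in> {e, rv e}) * \<omega> (SOME f. f \<in> {e, rv e})) mod int m)
      = (\<Sum>e\<in>A. (\<gamma> e * \<omega> e) mod int m)"
    by (rule sum.cong[OF refl])
  then show ?thesis
    unfolding \<phi>_def edges sum.reindex[OF inj] comp_def Let_def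
    by (subst (1 2) mod_sum_eq[symmetric]) (simp only:)
qed

lemma solv_twisted_perms:
  assumes "v \<in> verts G"
  shows "twisted_perms m (verts G - {v}) (solv v)"
  using solv_subgroup[OF assms] m_pos finite_verts by (simp add: twisted_perms_def)

lemma sum_solv:
  assumes "awalk v p v" "wp p = (x, \<sigma>)"
  shows "[sum x (verts G - {v}) = (\<Sum>f\<leftarrow>p. \<gamma> f)] (mod int m)"
proof -
  have "(x, \<sigma>) \<in> carrier (gen_sym m (verts G - {v}))"
    using solv_carrier solvI[OF assms(1)] assms(2) by fastforce
  then show ?thesis
    using sum_wp[OF awalk_arcs[OF assms(1)]] sum_verts_Diff assms(2) by (simp add: cong_def)
qed

lemma gamma_rev_cong: "e \<in> arcs G \<Longrightarrow> [\<gamma> (rv e) = - \<gamma> e] (mod int m)"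
  by (simp add: gamma_rev cong_def)

end

context twisted_perms
begin

lemma attained_funpow: "attained s \<sigma> \<Longrightarrow> attained (int n * s) (\<sigma> ^^ n)"
proof (induction n)
  case (Suc n)
  then show ?case using attained_mult[OF Suc.prems Suc.IH[OF Suc.prems]] by (simp add: algebra_simps comp_def)
qed (simp add: attained_zero)

lemma attained_linear:
  assumes "attained a id" "attained b id"
  shows "attained (k * a + l * b) id"
  using attained_id_mult[OF attained_scale[OF assms(1)] attained_scale[OF assms(2)]] .

text \<open>The sums over the identity form an ideal; later arguments show that it contains 1 by
  finding coprime members.\<close>

lemma attained_gcd: "attained a id \<Longrightarrow> attained b id \<Longrightarrow> attained (gcd a b) id"
proof -
  assume ab: "attained a id" "attained b id"
  obtain u v where "u * a + v * b = gcd a b" using bezout_int[of a b] by blast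
  then show ?thesis using attained_linear[OF ab, of u v] by simp
qed

lemma attained_mod: "attained (int m) id"
  by (rule attained_cong[OF attained_zero]) (simp add: cong_def)

lemma attained_word:
  assumes "\<And>\<sigma>. \<sigma> \<in> set ws \<Longrightarrow> \<exists>s. attained s \<sigma>"
  shows "\<exists>s. attained s (foldr (\<circ>) ws id)"
  using assms by (induction ws) (auto intro: attained_zero attained_mult)

lemma shifts_attained:
  assumes "x \<in> shifts" "attained s \<sigma>"
  shows "(\<lambda>w. x (inv_into UNIV \<sigma> w)) \<in> shifts"
  using assms(2) shifts_perm[OF assms(1)] unfolding attained_def by blast

end

section \<open>Conjugation between point sets, and the quotient of the alternating group by the
  Klein group\<close>

lemma inv_conj_permutes:
  assumes "\<sigma> permutes Y" "bij \<tau>" "\<tau> ` X = Y"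
  shows "inv_into UNIV \<tau> \<circ> \<sigma> \<circ> \<tau> permutes X"
proof (rule bij_imp_permutes)
  have "inv_into UNIV \<tau> ` Y = X"
    using image_inv_f_f[OF bij_is_inj[OF assms(2)], of X] assms(3) by simp
  then have "bij_betw \<tau> X Y" "bij_betw (inv_into UNIV \<tau>) Y X"
    using assms(3) bij_is_inj[OF assms(2)] bij_is_inj[OF bij_imp_bij_inv[OF assms(2)]]
    by (auto simp: bij_betw_def intro: inj_on_subset)
  then show "bij_betw (inv_into UNIV \<tau> \<circ> \<sigma> \<circ> \<tau>) X X"
    using permutes_imp_bij[OF assms(1)] by (intro bij_betw_trans[of \<tau> X Y] bij_betw_trans[of \<sigma> Y Y])
  fix w assume "w \<notin> X"
  then have "\<tau> w \<notin> Y" using assms(2,3) by (metis bij_is_inj inj_image_mem_iff)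
  then show "(inv_into UNIV \<tau> \<circ> \<sigma> \<circ> \<tau>) w = w"
    using assms by (simp add: permutes_not_in bij_is_inj)
qed

lemma inv_conj_comp:
  assumes "bij \<tau>"
  shows "inv_into UNIV \<tau> \<circ> (\<sigma> \<circ> \<rho>) \<circ> \<tau>
    = (inv_into UNIV \<tau> \<circ> \<sigma> \<circ> \<tau>) \<circ> (inv_into UNIV \<tau> \<circ> \<rho> \<circ> \<tau>)"
  using assms by (simp add: fun_eq_iff bij_is_surj surj_f_inv_f)

lemma inv_conj_conj:
  assumes "bij \<tau>"
  shows "\<tau> \<circ> (inv_into UNIV \<tau> \<circ> \<sigma> \<circ> \<tau>) \<circ> inv_into UNIV \<tau> = \<sigma>"
  using assms by (simp add: fun_eq_iff bij_is_surj surj_f_inv_f)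

lemma evenperm_inv_conj:
  assumes "permutation \<sigma>" "permutation \<tau>"
  shows "evenperm (inv_into UNIV \<tau> \<circ> \<sigma> \<circ> \<tau>) = evenperm \<sigma>"
  using assms by (auto simp: evenperm_comp evenperm_inv permutation_compose permutation_inverse)

text \<open>Conjugation relabels the points of a product of disjoint transpositions and preserves
  their distinctness.\<close>

lemma klein_inv_conj:
  assumes "\<sigma> \<in> klein Y" "bij \<tau>" "\<tau> ` X = Y"
  shows "inv_into UNIV \<tau> \<circ> \<sigma> \<circ> \<tau> \<in> klein X"
proof -
  have i1: "\<tau> (inv_into UNIV \<tau> w) = w" for w
    using assms(2) by (simp add: bij_is_surj surj_f_inv_f)
  have i2: "inv_into UNIV \<tau> (\<tau> w) = w" for w
    using assms(2) by (simp add: bij_is_inj)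
  have i3: "inv_into UNIV \<tau> a = inv_into UNIV \<tau> b \<longleftrightarrow> a = b" for a b
    using i1 by metis
  have tr: "inv_into UNIV \<tau> \<circ> transpose a b \<circ> \<tau> = transpose (inv_into UNIV \<tau> a) (inv_into UNIV \<tau> b)" for a b
    using i1 i2 by (auto simp: fun_eq_iff transpose_def)
  show ?thesis
  proof (cases "\<sigma> = id")
    case True
    then have "inv_into UNIV \<tau> \<circ> \<sigma> \<circ> \<tau> = id" using i2 by (simp add: fun_eq_iff)
    then show ?thesis by (simp add: klein_def)
  next
    case False
    then obtain a b c d where abcd: "\<sigma> = transpose a b \<circ> transpose c d" "distinct [a, b, c, d]" "{a, b, c, d} \<subseteq> Y"
      using assms(1) by (auto simp: klein_def)
    let ?i = "inv_into UNIV \<tau>"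
    have "?i \<circ> \<sigma> \<circ> \<tau> = transpose (?i a) (?i b) \<circ> transpose (?i c) (?i d)"
      using inv_conj_comp[OF assms(2)] tr by (simp add: abcd)
    moreover have "distinct [?i a, ?i b, ?i c, ?i d]"
      using abcd(2) by (simp add: i3)
    moreover have "{?i a, ?i b, ?i c, ?i d} \<subseteq> X"
      using abcd(3) assms(3) i2 by force
    ultimately show ?thesis
      unfolding klein_def by (intro insertI2 CollectI exI conjI)
  qed
qed

lemma klein_subset_alt: "klein X \<subseteq> carrier (alt X)"
proof -
  have "transpose a b \<circ> transpose c d \<in> carrier (alt X)"
    if "distinct [a, b, c, d]" "{a, b, c, d} \<subseteq> X" for a b c d
    using that permutes_compose[OF permutes_swap_id permutes_swap_id, of c X d a b]
    by (simp add: alt_def evenperm_comp permutation_swap_id evenperm_swap)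
  moreover have "id \<in> carrier (alt X)" by (simp add: alt_def permutes_id)
  ultimately show ?thesis unfolding klein_def by blast
qed

lemma group_alt:
  assumes "finite X"
  shows "group (alt X)"
proof (rule groupI)
  fix a assume a: "a \<in> carrier (alt X)"
  then have p: "a permutes X" "evenperm a" "permutation a"
    using assms by (auto simp: alt_def permutation_permutes)
  have "inv_into UNIV a \<in> carrier (alt X)"
    using permutes_inv[OF p(1)] evenperm_inv[OF p(3)] p(2) by (simp add: alt_def)
  moreover have "inv_into UNIV a \<otimes>\<^bsub>alt X\<^esub> a = \<one>\<^bsub>alt X\<^esub>"
    using permutes_inv_o(2)[OF p(1)] by (simp add: alt_def)
  ultimately show "\<exists>b\<in>carrier (alt X). b \<otimes>\<^bsub>alt X\<^esub> a = \<one>\<^bsub>alt X\<^esub>"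
    by blast
next
  fix a b assume "a \<in> carrier (alt X)" "b \<in> carrier (alt X)"
  moreover from this have "permutation a" "permutation b"
    using assms by (auto simp: alt_def permutation_permutes)
  ultimately show "a \<otimes>\<^bsub>alt X\<^esub> b \<in> carrier (alt X)"
    by (simp add: alt_def permutes_compose evenperm_comp)
qed (simp_all add: alt_def permutes_id o_assoc)

text \<open>The first isomorphism theorem, packaged so that the isomorphism is known explicitly on
  cosets.\<close>

lemma alt_Mod_klein_iso:
  assumes "finite X"
    and hom: "\<And>\<sigma> \<tau>. \<sigma> \<in> carrier (alt X) \<Longrightarrow> \<tau> \<in> carrier (alt X) \<Longrightarrow> f (\<sigma> \<circ> \<tau>) = (f \<sigma> + f \<tau>) mod 3"
    and range: "\<And>\<sigma>. f \<sigma> \<in> {0..<3}"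
    and ker: "\<And>\<sigma>. \<sigma> \<in> carrier (alt X) \<Longrightarrow> f \<sigma> = 0 \<longleftrightarrow> \<sigma> \<in> klein X"
    and nontriv: "\<exists>\<sigma>\<in>carrier (alt X). f \<sigma> \<noteq> 0"
  shows "\<exists>\<iota>\<in>iso (alt X Mod klein X) (integer_mod_group 3).
    \<forall>\<sigma>\<in>carrier (alt X). \<iota> (klein X #>\<^bsub>alt X\<^esub> \<sigma>) = f \<sigma>"
proof -
  interpret A: group "alt X" by (rule group_alt[OF assms(1)])
  have mult: "a \<otimes>\<^bsub>alt X\<^esub> b = a \<circ> b" for a b by (simp add: alt_def)
  have "f \<in> hom (alt X) (integer_mod_group 3)"
  proof (rule homI)
    show "f a \<in> carrier (integer_mod_group 3)" for a
      using range[of a] by (simp add: carrier_integer_mod_group)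
    show "f (a \<otimes>\<^bsub>alt X\<^esub> b) = f a \<otimes>\<^bsub>integer_mod_group 3\<^esub> f b"
      if "a \<in> carrier (alt X)" "b \<in> carrier (alt X)" for a b
      using hom[OF that] by (simp add: mult)
  qed
  then interpret group_hom "alt X" "integer_mod_group 3" f
    by (intro group_hom.intro group_hom_axioms.intro A.is_group group_integer_mod_group)
  have k: "kernel (alt X) (integer_mod_group 3) f = klein X"
    using ker klein_subset_alt by (auto simp: kernel_def)
  \<comment> \<open>A nonzero class modulo 3 and its double are the two nonzero classes, so one
    nontrivial value makes \<open>f\<close> onto.\<close>
  obtain g where g: "g \<in> carrier (alt X)" "f g \<noteq> 0" using nontriv by blast
  have "0 \<in> f ` carrier (alt X)"
    by (rule image_eqI[where x = "\<one>\<^bsub>alt X\<^esub>"]) simp_all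
  moreover have "f (g \<circ> g) \<in> f ` carrier (alt X)"
    using A.m_closed[OF g(1) g(1)] by (simp add: mult)
  ultimately have "{0, f g, f (g \<circ> g)} \<subseteq> f ` carrier (alt X)"
    using g(1) by auto
  moreover have "f g = 1 \<or> f g = 2" using g(2) range[of g] by auto
  then have "{0..<3::int} \<subseteq> {0, f g, f (g \<circ> g)}"
    using hom[OF g(1) g(1)] by auto
  ultimately have onto: "f ` carrier (alt X) = carrier (integer_mod_group 3)"
    using range by (auto simp: carrier_integer_mod_group)
  have "the_elem (f ` (klein X #>\<^bsub>alt X\<^esub> \<sigma>)) = f \<sigma>" if "\<sigma> \<in> carrier (alt X)" for \<sigma>
  proof -
    have "f (h \<circ> \<sigma>) = f \<sigma>" if "h \<in> klein X" for h
    proof -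
      have "f h = 0" using that k by (auto simp: kernel_def)
      moreover have "f (h \<circ> \<sigma>) = (f h + f \<sigma>) mod 3"
        using that klein_subset_alt \<open>\<sigma> \<in> carrier (alt X)\<close> by (intro hom) auto
      ultimately show ?thesis using range[of \<sigma>] by simp
    qed
    moreover have "id \<in> klein X" by (simp add: klein_def)
    ultimately have "f ` (klein X #>\<^bsub>alt X\<^esub> \<sigma>) = {f \<sigma>}"
      by (force simp: r_coset_def mult)
    then show ?thesis by simp
  qed
  then show ?thesis
    using FactGroup_iso_set[OF onto] unfolding k
    by (intro bexI[of _ "\<lambda>C. the_elem (f ` C)"] ballI) simp_all
qed

section \<open>Multiples of indicator vectors\<close>

context twisted_perms
begin

text \<open>Indexed by the complement \<open>D\<close>, since a loop misses few tokens: one in the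
  graph with five vertices, two in the graph with seven.\<close>

abbreviation punctured :: "int \<Rightarrow> 'v set \<Rightarrow> 'v \<Rightarrow> int" where
  "punctured k D \<equiv> (\<lambda>w. k * of_bool (w \<in> X - D))"

lemma punctured_perm:
  assumes "punctured k D \<in> shifts" "attained s \<sigma>"
  shows "punctured k (\<sigma> ` D) \<in> shifts"
proof -
  have p: "\<sigma> permutes X" using assms(2) P_permutes by (auto simp: attained_def)
  have "inv_into UNIV \<sigma> w \<in> X - D \<longleftrightarrow> w \<in> X - \<sigma> ` D" for w
    using inv_permutes_in[OF p] permutes_inverses[OF p] by (auto simp: image_iff)
  then show ?thesis using shifts_attained[OF assms] by simp
qed

text \<open>Two indicator vectors whose missing sets differ in one point agree everywhere except at
  \<open>i\<close> and \<open>j\<close>.\<close>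

lemma punctured_diff:
  assumes "punctured k (insert i E) \<in> shifts" "punctured k (insert j E) \<in> shifts"
    and "i \<in> X - E" "j \<in> X - E"
  shows "(\<lambda>w. k * (of_bool (w = i) - of_bool (w = j))) \<in> shifts"
proof -
  have "punctured k (insert j E) w - punctured k (insert i E) w
      = k * (of_bool (w = i) - of_bool (w = j))" for w
    using assms(3,4) by auto
  then show ?thesis using shifts_diff[OF assms(2,1)] by simp
qed

end

lemma permutes_insertE:
  assumes "p permutes insert a S"
  obtains b q where "b \<in> insert a S" "q permutes S" "p = transpose a b \<circ> q"
proof -
  have "p \<in> (\<lambda>(b, q). transpose a b \<circ> q) ` {(b, q). b \<in> insert a S \<and> q \<in> {q. q permutes S}}"
    using assms unfolding permutes_insert[symmetric] by simp
  then obtain bq where "bq \<in> {(b, q). b \<in> insert a S \<and> q \<in> {q. q permutes S}}"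
    "p = (\<lambda>(b, q). transpose a b \<circ> q) bq" by (rule imageE)
  then show thesis by (cases bq) (auto intro: that)
qed

section \<open>The graph with five vertices\<close>

abbreviation ring5 :: "theta5_vertex set" where
  "ring5 \<equiv> {VL, VR, VT, VB}"

text \<open>The permutation of the loop from \<open>VC\<close> through \<open>VL\<close>,
  \<open>VT\<close>, \<open>VR\<close>: tokens move against the empty vertex, so \<open>VT\<close>
  goes to \<open>VL\<close> and \<open>VL\<close> ends at \<open>VR\<close>.\<close>

definition cyc_t :: "theta5_vertex \<Rightarrow> theta5_vertex" where
  "cyc_t = transpose VL VR \<circ> transpose VR VT"

definition cyc_b :: "theta5_vertex \<Rightarrow> theta5_vertex" where
  "cyc_b = transpose VL VR \<circ> transpose VR VB"

lemma theta5_fun_eqI: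
  "f VL = g VL \<Longrightarrow> f VR = g VR \<Longrightarrow> f VT = g VT \<Longrightarrow> f VB = g VB \<Longrightarrow> f VC = g VC \<Longrightarrow> f = g"
  by (rule ext, rename_tac v, case_tac v) simp_all

lemma cyc_t_simps [simp]:
  "cyc_t VL = VR" "cyc_t VR = VT" "cyc_t VT = VL" "cyc_t VB = VB" "cyc_t VC = VC"
  by (simp_all add: cyc_t_def transpose_def)

lemma cyc_b_simps [simp]:
  "cyc_b VL = VR" "cyc_b VR = VB" "cyc_b VB = VL" "cyc_b VT = VT" "cyc_b VC = VC"
  by (simp_all add: cyc_b_def transpose_def)

text \<open>Every permutation of four points is a product of three factors, each trivial or a
  transposition. It is even iff an odd number of the three is trivial, which is what the nested
  equation of Booleans says; this leaves 12 of the 24 triples.\<close>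

lemma alt5_cases:
  assumes "\<sigma> \<in> carrier (alt ring5)"
  obtains x y z where "x \<in> {VL, VR, VT, VB}" "y \<in> {VR, VT, VB}" "z \<in> {VT, VB}"
    "\<sigma> = transpose VL x \<circ> (transpose VR y \<circ> transpose VT z)" "(x = VL) = ((y = VR) = (z = VT))"
proof -
  have p: "\<sigma> permutes ring5" and e: "evenperm \<sigma>" using assms by (simp_all add: alt_def)
  obtain x q1 where 1: "x \<in> {VL, VR, VT, VB}" "q1 permutes {VR, VT, VB}" "\<sigma> = transpose VL x \<circ> q1"
    by (rule permutes_insertE[OF p])
  obtain y q2 where 2: "y \<in> {VR, VT, VB}" "q2 permutes {VT, VB}" "q1 = transpose VR y \<circ> q2"
    by (rule permutes_insertE[OF 1(2)])
  have "q2 = transpose VT VT \<or> q2 = transpose VT VB"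
    using 2(2) by (simp add: permutes_doubleton_iff)
  then obtain z where 3: "z \<in> {VT, VB}" "q2 = transpose VT z"
    by blast
  have "(x = VL) = ((y = VR) = (z = VT))"
    using e unfolding 1(3) 2(3) 3(2)
    by (auto simp: evenperm_comp evenperm_swap permutation_swap_id permutation_compose)
  then show thesis
    by (intro that[OF 1(1) 2(1) 3(1)]) (simp_all only: 1(3) 2(3) 3(2))
qed

text \<open>Two 3-cycles sharing two points generate A_4. The words contain no inverses, so any
  property closed under composition spreads from the generators to the whole group.\<close>

lemma alt5_word:
  assumes "\<sigma> \<in> carrier (alt ring5)"
  shows "\<exists>ws. set ws \<subseteq> {cyc_t, cyc_b} \<and> \<sigma> = foldr (\<circ>) ws id"
proof -
  let ?W = "{foldr (\<circ>) ws id |ws. set ws \<subseteq> {cyc_t, cyc_b}}"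
  have W: "f \<in> ?W" if "set ws \<subseteq> {cyc_t, cyc_b}" "f = foldr (\<circ>) ws id" for f ws
    using that(1) by (intro CollectI exI[of _ ws] conjI that(2))
  obtain x y z where xyz: "x \<in> {VL, VR, VT, VB}" "y \<in> {VR, VT, VB}" "z \<in> {VT, VB}"
    "\<sigma> = transpose VL x \<circ> (transpose VR y \<circ> transpose VT z)" "(x = VL) = ((y = VR) = (z = VT))"
    using alt5_cases[OF assms] .
  have ws:
    "transpose VL VL \<circ> (transpose VR VR \<circ> transpose VT VT) \<in> ?W"
    "transpose VL VL \<circ> (transpose VR VT \<circ> transpose VT VB) \<in> ?W"
    "transpose VL VL \<circ> (transpose VR VB \<circ> transpose VT VB) \<in> ?W"
    "transpose VL VR \<circ> (transpose VR VR \<circ> transpose VT VB) \<in> ?W"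
    "transpose VL VR \<circ> (transpose VR VT \<circ> transpose VT VT) \<in> ?W"
    "transpose VL VR \<circ> (transpose VR VB \<circ> transpose VT VT) \<in> ?W"
    "transpose VL VT \<circ> (transpose VR VR \<circ> transpose VT VB) \<in> ?W"
    "transpose VL VT \<circ> (transpose VR VT \<circ> transpose VT VT) \<in> ?W"
    "transpose VL VT \<circ> (transpose VR VB \<circ> transpose VT VT) \<in> ?W"
    "transpose VL VB \<circ> (transpose VR VR \<circ> transpose VT VB) \<in> ?W"
    "transpose VL VB \<circ> (transpose VR VT \<circ> transpose VT VT) \<in> ?W"
    "transpose VL VB \<circ> (transpose VR VB \<circ> transpose VT VT) \<in> ?W"
    subgoal by (rule W[of "[]"]) (auto intro!: theta5_fun_eqI simp: transpose_def)
    subgoal by (rule W[of "[cyc_b, cyc_b, cyc_t]"]) (auto intro!: theta5_fun_eqI simp: transpose_def)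
    subgoal by (rule W[of "[cyc_t, cyc_t, cyc_b]"]) (auto intro!: theta5_fun_eqI simp: transpose_def)
    subgoal by (rule W[of "[cyc_t, cyc_b, cyc_b, cyc_t]"]) (auto intro!: theta5_fun_eqI simp: transpose_def)
    subgoal by (rule W[of "[cyc_t]"]) (auto intro!: theta5_fun_eqI simp: transpose_def)
    subgoal by (rule W[of "[cyc_b]"]) (auto intro!: theta5_fun_eqI simp: transpose_def)
    subgoal by (rule W[of "[cyc_b, cyc_t, cyc_t]"]) (auto intro!: theta5_fun_eqI simp: transpose_def)
    subgoal by (rule W[of "[cyc_t, cyc_t]"]) (auto intro!: theta5_fun_eqI simp: transpose_def)
    subgoal by (rule W[of "[cyc_t, cyc_b]"]) (auto intro!: theta5_fun_eqI simp: transpose_def)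
    subgoal by (rule W[of "[cyc_t, cyc_b, cyc_b]"]) (auto intro!: theta5_fun_eqI simp: transpose_def)
    subgoal by (rule W[of "[cyc_b, cyc_t]"]) (auto intro!: theta5_fun_eqI simp: transpose_def)
    subgoal by (rule W[of "[cyc_b, cyc_b]"]) (auto intro!: theta5_fun_eqI simp: transpose_def)
    done
  have "(x, y, z) \<in> {(VL, VR, VT), (VL, VT, VB), (VL, VB, VB), (VR, VR, VB), (VR, VT, VT), (VR, VB, VT),
      (VT, VR, VB), (VT, VT, VT), (VT, VB, VT), (VB, VR, VB), (VB, VT, VT), (VB, VB, VT)}"
    using xyz(1-3,5) by (elim insertE emptyE) simp_all
  then have "\<sigma> \<in> ?W"
    unfolding xyz(4) by (elim insertE emptyE Pair_inject) (simp_all only: ws)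
  then show ?thesis by blast
qed

text \<open>
  The alternating group permutes the three partitions of the four points into pairs cyclically, with
  kernel the Klein group; \<open>pairing x y\<close> numbers the partition containing \<open>{x, y}\<close>.
\<close>

definition pairing :: "theta5_vertex \<Rightarrow> theta5_vertex \<Rightarrow> int" where
  "pairing x y = (if {x, y} \<in> {{VL, VT}, {VR, VB}} then 0
     else if {x, y} \<in> {{VT, VR}, {VL, VB}} then 1 else 2)"

lemma pairing_simps [simp]:
  "pairing VL VT = 0" "pairing VT VL = 0" "pairing VR VB = 0" "pairing VB VR = 0"
  "pairing VT VR = 1" "pairing VR VT = 1" "pairing VL VB = 1" "pairing VB VL = 1"
  "pairing VL VR = 2" "pairing VR VL = 2" "pairing VT VB = 2" "pairing VB VT = 2"
  by (simp_all add: pairing_def doubleton_eq_iff)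

text \<open>The partition containing \<open>{VL, VT}\<close> has number 0, so the number of its
  image is the cyclic shift itself. This is one of the two quotient maps from A_4 to Z/3.\<close>

definition quot5 :: "(theta5_vertex \<Rightarrow> theta5_vertex) \<Rightarrow> int" where
  "quot5 \<sigma> = pairing (\<sigma> VL) (\<sigma> VT)"

text \<open>Says that the three partitions are shifted uniformly by \<open>k\<close>. Invariance of
  the four points and preservation of distinctness are included so that the property composes; it
  then needs checking for the two generators only.\<close>

definition adds_pairing :: "(theta5_vertex \<Rightarrow> theta5_vertex) \<Rightarrow> int \<Rightarrow> bool" where
  "adds_pairing \<sigma> k \<longleftrightarrow> (\<forall>x\<in>ring5. \<forall>y\<in>ring5. x \<noteq> y \<longrightarrow>
     \<sigma> x \<in> ring5 \<and> \<sigma> y \<in> ring5 \<and> \<sigma> x \<noteq> \<sigma> y \<and> pairing (\<sigma> x) (\<sigma> y) = (pairing x y + k) mod 3)"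

lemma adds_pairingD:
  assumes "adds_pairing \<sigma> k" "x \<in> ring5" "y \<in> ring5" "x \<noteq> y"
  shows "\<sigma> x \<in> ring5" "\<sigma> y \<in> ring5" "\<sigma> x \<noteq> \<sigma> y" "pairing (\<sigma> x) (\<sigma> y) = (pairing x y + k) mod 3"
  using assms unfolding adds_pairing_def by (metis (no_types))+

lemma adds_pairing_comp:
  assumes "adds_pairing \<sigma> k" "adds_pairing \<tau> l"
  shows "adds_pairing (\<sigma> \<circ> \<tau>) (k + l)"
  unfolding adds_pairing_def comp_apply
proof (intro ballI impI conjI)
  fix x y assume xy: "x \<in> ring5" "y \<in> ring5" "x \<noteq> y"
  note \<tau> = adds_pairingD[OF assms(2) xy]
  note \<sigma> = adds_pairingD[OF assms(1) \<tau>(1-3)]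
  show "\<sigma> (\<tau> x) \<in> ring5" "\<sigma> (\<tau> y) \<in> ring5" "\<sigma> (\<tau> x) \<noteq> \<sigma> (\<tau> y)"
    by (fact \<sigma>)+
  show "pairing (\<sigma> (\<tau> x)) (\<sigma> (\<tau> y)) = (pairing x y + (k + l)) mod 3"
    unfolding \<sigma>(4) \<tau>(4) by (simp add: mod_simps ac_simps)
qed

lemma adds_pairing_word:
  "set ws \<subseteq> {cyc_t, cyc_b} \<Longrightarrow> \<exists>k. adds_pairing (foldr (\<circ>) ws id) k"
proof (induction ws)
  case Nil
  show ?case by (rule exI[of _ 0]) (simp add: adds_pairing_def)
next
  case (Cons \<tau> ws)
  have "adds_pairing cyc_t 2" "adds_pairing cyc_b 1"
    by (simp_all add: adds_pairing_def)
  then obtain l where l: "adds_pairing \<tau> l" using Cons.prems by auto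
  have "set ws \<subseteq> {cyc_t, cyc_b}" using Cons.prems by simp
  then obtain k where k: "adds_pairing (foldr (\<circ>) ws id) k" using Cons.IH by blast
  have "foldr (\<circ>) (\<tau> # ws) id = \<tau> \<circ> foldr (\<circ>) ws id" by simp
  then show ?case using adds_pairing_comp[OF l k] by metis
qed

lemma alt_adds_pairing:
  assumes "\<sigma> \<in> carrier (alt ring5)"
  shows "\<exists>k. adds_pairing \<sigma> k"
proof -
  obtain ws where ws: "set ws \<subseteq> {cyc_t, cyc_b}" "\<sigma> = foldr (\<circ>) ws id"
    using alt5_word[OF assms] by blast
  show ?thesis unfolding ws(2) by (rule adds_pairing_word[OF ws(1)])
qed

lemma pairing_alt:
  assumes "\<sigma> \<in> carrier (alt ring5)" "x \<in> ring5" "y \<in> ring5" "x \<noteq> y"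
  shows "pairing (\<sigma> x) (\<sigma> y) = (pairing x y + quot5 \<sigma>) mod 3"
proof -
  obtain k where k: "adds_pairing \<sigma> k" using alt_adds_pairing[OF assms(1)] by blast
  have "quot5 \<sigma> = k mod 3"
    using adds_pairingD(4)[OF k, of VL VT] by (simp add: quot5_def)
  then show ?thesis using adds_pairingD(4)[OF k assms(2-4)] by (simp add: mod_simps)
qed

lemma quot5_comp:
  assumes "\<sigma> \<in> carrier (alt ring5)" "\<tau> \<in> carrier (alt ring5)"
  shows "quot5 (\<sigma> \<circ> \<tau>) = (quot5 \<sigma> + quot5 \<tau>) mod 3"
proof -
  obtain k where "adds_pairing \<tau> k" using alt_adds_pairing[OF assms(2)] by blast
  then have \<tau>: "\<tau> VL \<in> ring5" "\<tau> VT \<in> ring5" "\<tau> VL \<noteq> \<tau> VT"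
    using adds_pairingD(1-3)[of \<tau> k VL VT] by simp_all
  have "quot5 (\<sigma> \<circ> \<tau>) = (pairing (\<tau> VL) (\<tau> VT) + quot5 \<sigma>) mod 3"
    using pairing_alt[OF assms(1) \<tau>] by (simp only: quot5_def comp_apply)
  then show ?thesis by (simp add: quot5_def add.commute)
qed

text \<open>One direction inspects the 12 even permutations; the other uses that Klein elements have
  order at most 2.\<close>

lemma quot5_eq_0_iff:
  assumes "\<sigma> \<in> carrier (alt ring5)"
  shows "quot5 \<sigma> = 0 \<longleftrightarrow> \<sigma> \<in> klein ring5"
proof
  have kl: "transpose a b \<circ> (transpose c d) \<in> klein ring5"
    if "distinct [a, b, c, d]" "{a, b, c, d} \<subseteq> ring5" for a b c d
    using that unfolding klein_def by blast
  assume q: "quot5 \<sigma> = 0"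
  obtain x y z where xyz: "x \<in> {VL, VR, VT, VB}" "y \<in> {VR, VT, VB}" "z \<in> {VT, VB}"
    "\<sigma> = transpose VL x \<circ> (transpose VR y \<circ> transpose VT z)" "(x = VL) = ((y = VR) = (z = VT))"
    using alt5_cases[OF assms] .
  have "(x, y, z) \<in> {(VL, VR, VT), (VR, VR, VB), (VT, VB, VT), (VB, VT, VT)}"
    using xyz(1-3,5) q unfolding xyz(4)
    by (elim insertE emptyE) (simp_all add: quot5_def transpose_def)
  moreover have "id \<in> klein ring5" by (simp add: klein_def)
  moreover have "transpose VL VR \<circ> transpose VT VB \<in> klein ring5"
    "transpose VL VT \<circ> transpose VR VB \<in> klein ring5" "transpose VL VB \<circ> transpose VR VT \<in> klein ring5"
    by (rule kl; simp)+
  ultimately show "\<sigma> \<in> klein ring5"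
    unfolding xyz(4) by (elim insertE emptyE Pair_inject) (simp_all only: transpose_same id_comp comp_id)
next
  assume "\<sigma> \<in> klein ring5"
  then have k: "\<sigma> = id \<or> (\<exists>a b c d. \<sigma> = transpose a b \<circ> transpose c d \<and> distinct [a, b, c, d])"
    unfolding klein_def by blast
  have sq: "(transpose a b \<circ> transpose c d) \<circ> (transpose a b \<circ> transpose c d) = id"
    if "distinct [a, b, c, d]" for a b c d :: theta5_vertex
    using that by (auto simp: fun_eq_iff transpose_def)
  \<comment> \<open>Twice the class of an involution is 0, and doubling is injective modulo
    3.\<close>
  have "\<sigma> \<circ> \<sigma> = id"
    using k sq by (metis comp_id)
  then have "(quot5 \<sigma> + quot5 \<sigma>) mod 3 = 0"
    using quot5_comp[OF assms assms] by (simp add: quot5_def)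
  moreover have "quot5 \<sigma> \<in> {0, 1, 2}" by (simp add: quot5_def pairing_def)
  ultimately show "quot5 \<sigma> = 0" by (elim insertE emptyE) simp_all
qed

lemma inv_cyc_t: "inv_into UNIV cyc_t = transpose VR VT \<circ> transpose VL VR"
  by (rule inv_unique_comp) (auto intro!: theta5_fun_eqI simp: transpose_def)

lemma inv_cyc_b: "inv_into UNIV cyc_b = transpose VR VB \<circ> transpose VL VR"
  by (rule inv_unique_comp) (auto intro!: theta5_fun_eqI simp: transpose_def)

lemma inv_cyc_t_simps [simp]:
  "inv_into UNIV cyc_t VR = VL" "inv_into UNIV cyc_t VT = VR" "inv_into UNIV cyc_t VL = VT"
  "inv_into UNIV cyc_t VB = VB" "inv_into UNIV cyc_t VC = VC"
  by (simp_all add: inv_cyc_t transpose_def)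

lemma inv_cyc_b_simps [simp]:
  "inv_into UNIV cyc_b VR = VL" "inv_into UNIV cyc_b VB = VR" "inv_into UNIV cyc_b VL = VB"
  "inv_into UNIV cyc_b VT = VT" "inv_into UNIV cyc_b VC = VC"
  by (simp_all add: inv_cyc_b transpose_def)

lemma transpose2_alt5:
  assumes "a \<in> ring5" "b \<in> ring5" "c \<in> ring5" "d \<in> ring5" "a \<noteq> b" "c \<noteq> d"
  shows "transpose a b \<circ> transpose c d \<in> carrier (alt ring5)"
  using permutes_compose[OF permutes_swap_id[OF assms(3,4)] permutes_swap_id[OF assms(1,2)]] assms(5,6)
  by (simp add: alt_def evenperm_comp evenperm_swap permutation_swap_id)

lemma cyc_alt:
  "cyc_t \<in> carrier (alt ring5)" "cyc_b \<in> carrier (alt ring5)"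
  "inv_into UNIV cyc_t \<in> carrier (alt ring5)" "inv_into UNIV cyc_b \<in> carrier (alt ring5)"
  unfolding inv_cyc_t inv_cyc_b unfolding cyc_t_def cyc_b_def
  by (intro transpose2_alt5; simp)+

lemma quot5_cyc [simp]:
  "quot5 cyc_t = 2" "quot5 cyc_b = 1" "quot5 (inv_into UNIV cyc_t) = 1"
  "quot5 (inv_into UNIV cyc_b) = 2" "quot5 id = 0"
  by (simp_all add: quot5_def)

section \<open>Loops and attained sums at \<open>VC\<close>\<close>

lemma theta5_simps:
  "verts theta5 = {VL, VR, VT, VC, VB}" "tail theta5 = fst" "head theta5 = snd"
  "arcs theta5 = {(VL, VT), (VT, VR), (VL, VC), (VC, VR), (VL, VB), (VB, VR),
     (VT, VL), (VR, VT), (VC, VL), (VR, VC), (VB, VL), (VR, VB)}"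
  by (auto simp: theta5_def graph_of_def theta5_edges_def)

lemma verts_theta5_Diff: "verts theta5 - {VC} = ring5"
  by (auto simp: theta5_simps)

lemma edge_rev_theta5:
  "(a, b) \<in> arcs theta5 \<Longrightarrow> edge_rev theta5 (a, b) = (b, a)"
  by (simp add: edge_rev_def)

locale theta5_twist =
  fixes m :: nat and \<gamma> :: "theta5_vertex \<times> theta5_vertex \<Rightarrow> int"
  assumes pos: "m \<ge> 1" and one_chain: "\<gamma> \<in> one_chains m theta5 (edge_rev theta5)"

sublocale theta5_twist \<subseteq> twisted_digraph theta5 "edge_rev theta5" m \<gamma>
proof -
  interpret bidirected_digraph theta5 "edge_rev theta5" by (rule bidirected_theta5)
  show "twisted_digraph theta5 (edge_rev theta5) m \<gamma>"
    using pos one_chain by unfold_locales (auto simp: theta5_simps)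
qed

sublocale theta5_twist \<subseteq> ring: twisted_perms m ring5 "solv VC"
  using solv_twisted_perms[of VC] unfolding verts_theta5_Diff by (simp add: theta5_simps)

context theta5_twist
begin

definition \<gamma>_top :: int where
  "\<gamma>_top = \<gamma> (VC, VL) + \<gamma> (VL, VT) + \<gamma> (VT, VR) + \<gamma> (VR, VC)"

definition \<gamma>_bot :: int where
  "\<gamma>_bot = \<gamma> (VC, VL) + \<gamma> (VL, VB) + \<gamma> (VB, VR) + \<gamma> (VR, VC)"

lemma gamma_rev5: "(a, b) \<in> arcs theta5 \<Longrightarrow> [\<gamma> (b, a) = - \<gamma> (a, b)] (mod int m)"
  using gamma_rev_cong[of "(a, b)"] edge_rev_theta5 by simp

text \<open>The single entries of the vector never matter: its sum is the sum of
  \<open>\<gamma>\<close> along the walk, and the entry at \<open>VB\<close> vanishes because the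
  walk avoids \<open>VB\<close>.\<close>

lemma top_loop:
  obtains x where "(x, cyc_t) \<in> solv VC" "x VB = 0" "[sum x ring5 = \<gamma>_top] (mod int m)"
proof -
  let ?p = "[(VC, VL), (VL, VT), (VT, VR), (VR, VC)]"
  have w: "awalk VC ?p VC" by (simp add: awalk_simps theta5_simps)
  obtain x \<sigma> where wp: "wp ?p = (x, \<sigma>)" by fastforce
  have "snd (wp ?p) = cyc_t"
    by (simp add: snd_gen_sym_mult arc_pair_def theta5_simps gen_sym_one)
      (auto intro!: theta5_fun_eqI simp: transpose_def)
  then have \<sigma>: "\<sigma> = cyc_t" using wp by simp
  have "x VB = 0 \<and> \<sigma> VB = VB"
    by (rule wp_avoid[OF awalk_arcs[OF w] _ wp]) (auto simp: theta5_simps)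
  moreover have "[sum x ring5 = \<gamma>_top] (mod int m)"
    using sum_solv[OF w wp] unfolding verts_theta5_Diff by (simp add: \<gamma>_top_def add.assoc)
  ultimately show thesis using that[of x] solvI[OF w] wp \<sigma> by simp
qed

lemma bot_loop:
  obtains x where "(x, cyc_b) \<in> solv VC" "x VT = 0" "[sum x ring5 = \<gamma>_bot] (mod int m)"
proof -
  let ?p = "[(VC, VL), (VL, VB), (VB, VR), (VR, VC)]"
  have w: "awalk VC ?p VC" by (simp add: awalk_simps theta5_simps)
  obtain x \<sigma> where wp: "wp ?p = (x, \<sigma>)" by fastforce
  have "snd (wp ?p) = cyc_b"
    by (simp add: snd_gen_sym_mult arc_pair_def theta5_simps gen_sym_one)
      (auto intro!: theta5_fun_eqI simp: transpose_def)
  then have \<sigma>: "\<sigma> = cyc_b" using wp by simp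
  have "x VT = 0 \<and> \<sigma> VT = VT"
    by (rule wp_avoid[OF awalk_arcs[OF w] _ wp]) (auto simp: theta5_simps)
  moreover have "[sum x ring5 = \<gamma>_bot] (mod int m)"
    using sum_solv[OF w wp] unfolding verts_theta5_Diff by (simp add: \<gamma>_bot_def add.assoc)
  ultimately show thesis using that[of x] solvI[OF w] wp \<sigma> by simp
qed

lemma attained_top: "ring.attained \<gamma>_top cyc_t"
  by (rule top_loop) (rule ring.attainedI)

lemma attained_bot: "ring.attained \<gamma>_bot cyc_b"
  by (rule bot_loop) (rule ring.attainedI)

lemma attained_alt:
  assumes "\<sigma> \<in> carrier (alt ring5)"
  shows "\<exists>s. ring.attained s \<sigma>"
proof -
  obtain ws where ws: "set ws \<subseteq> {cyc_t, cyc_b}" "\<sigma> = foldr (\<circ>) ws id"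
    using alt5_word[OF assms] by blast
  show ?thesis
    unfolding ws(2) using ws(1) attained_top attained_bot by (intro ring.attained_word) auto
qed

lemma cyc_cubed: "cyc_t ^^ 3 = id" "cyc_b ^^ 3 = id"
  by (auto intro!: theta5_fun_eqI simp: eval_nat_numeral)

text \<open>In the cube of the loop each of the three tokens on the cycle collects all three
  entries, that is, the full sum.\<close>

lemma punctured_top: "ring.punctured \<gamma>_top {VB} \<in> ring.shifts"
proof (rule top_loop)
  fix x assume x: "(x, cyc_t) \<in> solv VC" "x VB = 0" "[sum x ring5 = \<gamma>_top] (mod int m)"
  have "x VC = 0" using ring.P_carrier[OF x(1)] by (simp add: gen_sym_carrier_iff)
  moreover have "sum x ring5 = x VL + x VR + x VT" using x(2) by simp
  ultimately show ?thesis
    using x(2,3)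
    by (intro ring.shifts_cong[OF ring.shifts_cycle[OF x(1) cyc_cubed(1)]], rename_tac w, case_tac w)
      (simp_all add: eval_nat_numeral ac_simps)
qed

lemma punctured_bot: "ring.punctured \<gamma>_bot {VT} \<in> ring.shifts"
proof (rule bot_loop)
  fix x assume x: "(x, cyc_b) \<in> solv VC" "x VT = 0" "[sum x ring5 = \<gamma>_bot] (mod int m)"
  have "x VC = 0" using ring.P_carrier[OF x(1)] by (simp add: gen_sym_carrier_iff)
  moreover have "sum x ring5 = x VL + x VR + x VB" using x(2) by simp
  ultimately show ?thesis
    using x(2,3)
    by (intro ring.shifts_cong[OF ring.shifts_cycle[OF x(1) cyc_cubed(2)]], rename_tac w, case_tac w)
      (simp_all add: eval_nat_numeral ac_simps)
qed

text \<open>The missed token is carried to \<open>VL\<close> by one 3-cycle and from there to all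
  other places.\<close>

lemma punctured_all:
  assumes "ring.punctured k {i} \<in> ring.shifts" "i \<in> {VT, VB}" "j \<in> ring5"
  shows "ring.punctured k {j} \<in> ring.shifts"
proof -
  have t: "ring.punctured k {cyc_t i} \<in> ring.shifts" if "ring.punctured k {i} \<in> ring.shifts" for i
    using ring.punctured_perm[OF that attained_top] by simp
  have b: "ring.punctured k {cyc_b i} \<in> ring.shifts" if "ring.punctured k {i} \<in> ring.shifts" for i
    using ring.punctured_perm[OF that attained_bot] by simp
  have L: "ring.punctured k {VL} \<in> ring.shifts"
    using assms(2)
  proof (elim insertE emptyE)
    assume "i = VT"
    then show ?thesis using t[OF assms(1)] by (simp only: cyc_t_simps)
  next
    assume "i = VB"
    then show ?thesis using b[OF assms(1)] by (simp only: cyc_b_simps)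
  qed
  have R: "ring.punctured k {VR} \<in> ring.shifts" using t[OF L] by (simp only: cyc_t_simps)
  have T: "ring.punctured k {VT} \<in> ring.shifts" using t[OF R] by (simp only: cyc_t_simps)
  have B: "ring.punctured k {VB} \<in> ring.shifts" using b[OF R] by (simp only: cyc_b_simps)
  show ?thesis using assms(3) by (elim insertE emptyE) (simp_all only: L R T B)
qed

lemma basis:
  assumes "[\<gamma>_top * s + \<gamma>_bot * t = 1] (mod int m)" "i \<in> ring5" "j \<in> ring5"
  shows "(\<lambda>w. of_bool (w = i) - of_bool (w = j)) \<in> ring.shifts"
proof (rule ring.shifts_combination[OF _ _ assms(1)])
  show "(\<lambda>w. \<gamma>_top * (of_bool (w = i) - of_bool (w = j))) \<in> ring.shifts"
    using punctured_all[OF punctured_top] assms(2,3)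
    by (intro ring.punctured_diff[where E = "{}"]) auto
  show "(\<lambda>w. \<gamma>_bot * (of_bool (w = i) - of_bool (w = j))) \<in> ring.shifts"
    using punctured_all[OF punctured_bot] assms(2,3)
    by (intro ring.punctured_diff[where E = "{}"]) auto
qed

text \<open>The cubes of the loops give three times both cycle sums; the Bezout relation combines
  them to 3.\<close>

lemma attained_three:
  assumes "[\<gamma>_top * s + \<gamma>_bot * t = 1] (mod int m)"
  shows "ring.attained 3 id"
proof -
  have "ring.attained (3 * \<gamma>_top) id" "ring.attained (3 * \<gamma>_bot) id"
    using ring.attained_funpow[OF attained_top, of 3] ring.attained_funpow[OF attained_bot, of 3]
    by (simp_all add: cyc_cubed)
  then have "ring.attained (s * (3 * \<gamma>_top) + t * (3 * \<gamma>_bot)) id"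
    by (rule ring.attained_linear)
  moreover have "[s * (3 * \<gamma>_top) + t * (3 * \<gamma>_bot) = 3] (mod int m)"
    using cong_scalar_left[OF assms, of 3] by (simp add: algebra_simps)
  ultimately show ?thesis by (rule ring.attained_cong)
qed

definition balanced :: bool where
  "balanced \<longleftrightarrow> 3 dvd m \<and> (\<Sum>e\<in>theta5_edges. \<gamma> e) mod 3 = 0"

lemma gamma_rev_3:
  assumes "3 dvd m" "(a, b) \<in> arcs theta5"
  obtains k where "\<gamma> (b, a) = 3 * k - \<gamma> (a, b)"
proof -
  have "int 3 dvd int m" using assms(1) by (simp only: int_dvd_int_iff)
  then have "[- \<gamma> (a, b) = \<gamma> (b, a)] (mod 3)"
    using cong_dvd_modulus[OF cong_sym[OF gamma_rev5[OF assms(2)]]] by simp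
  then show thesis using that by (auto simp: cong_iff_lin)
qed

text \<open>Both loops run backwards over the two edges at \<open>VC\<close>. So the two cycle sums
  add up to the sum over all six edges minus three times the sum over these two edges, up to
  multiples of m.\<close>

lemma balanced_iff: "balanced \<longleftrightarrow> 3 dvd m \<and> [\<gamma>_top + \<gamma>_bot = 0] (mod 3)"
proof (cases "3 dvd m")
  case True
  obtain k where k: "\<gamma> (VC, VL) = 3 * k - \<gamma> (VL, VC)"
    by (rule gamma_rev_3[OF True, of VL VC]) (simp_all add: theta5_simps)
  obtain l where l: "\<gamma> (VR, VC) = 3 * l - \<gamma> (VC, VR)"
    by (rule gamma_rev_3[OF True, of VC VR]) (simp_all add: theta5_simps)
  have "\<gamma>_top + \<gamma>_bot = (\<Sum>e\<in>theta5_edges. \<gamma> e) + 3 * (2 * k + 2 * l - \<gamma> (VL, VC) - \<gamma> (VC, VR))"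
    by (simp add: \<gamma>_top_def \<gamma>_bot_def theta5_edges_def k l)
  then show ?thesis
    using True unfolding balanced_def cong_def by (simp only: mod_mult_self2 mod_0)
qed (simp add: balanced_def)

text \<open>If 3 does not divide m, then 3 and m are coprime and both are attained. Otherwise a
  relation between the loops supplies a sum prime to 3.\<close>

lemma attained_one:
  assumes "[\<gamma>_top * s + \<gamma>_bot * t = 1] (mod int m)" "\<not> balanced"
  shows "ring.attained 1 id"
proof (cases "3 dvd m")
  case False
  then have "coprime 3 (int m)"
    using prime_imp_coprime[of "3::int" "int m"] int_dvd_int_iff[of 3 m] by simp
  then show ?thesis
    using ring.attained_gcd[OF attained_three[OF assms(1)] ring.attained_mod] by simp
next
  case True
  then have n: "\<not> 3 dvd \<gamma>_top + \<gamma>_bot" using assms(2) by (simp add: balanced_iff cong_0_iff)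
  \<comment> \<open>\<open>cyc_t \<circ> cyc_b\<close> is a product of two disjoint transpositions,
    so its square attains twice the sum of both cycles over the identity.\<close>
  have "(cyc_t \<circ> cyc_b) \<circ> (cyc_t \<circ> cyc_b) = id" by (auto intro!: theta5_fun_eqI)
  then have "ring.attained (2 * (\<gamma>_top + \<gamma>_bot)) id"
    using ring.attained_mult[OF ring.attained_mult ring.attained_mult, OF attained_top attained_bot attained_top attained_bot]
    by (simp add: algebra_simps)
  then have "ring.attained (gcd (2 * (\<gamma>_top + \<gamma>_bot)) 3) id"
    by (rule ring.attained_gcd[OF _ attained_three[OF assms(1)]])
  moreover have "coprime (2 * (\<gamma>_top + \<gamma>_bot)) 3"
    using n prime_imp_coprime[of "3::int" "\<gamma>_top + \<gamma>_bot"]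
    by (simp only: coprime_mult_left_iff coprime_commute[of "\<gamma>_top + \<gamma>_bot"]) simp
  ultimately show ?thesis by simp
qed

end

lemma alt_comp:
  assumes "finite X" "\<sigma> \<in> carrier (alt X)" "\<tau> \<in> carrier (alt X)"
  shows "\<sigma> \<circ> \<tau> \<in> carrier (alt X)"
proof -
  have "\<sigma> \<otimes>\<^bsub>alt X\<^esub> \<tau> \<in> carrier (alt X)"
    using group.is_monoid[OF group_alt[OF assms(1)]] assms(2,3) by (rule monoid.m_closed)
  then show ?thesis by (simp add: alt_def)
qed

lemma alt_inv_conj_iff:
  assumes "\<sigma> permutes Y" "\<tau> permutes Z" "finite Y" "finite Z" "\<tau> ` X = Y"
  shows "inv_into UNIV \<tau> \<circ> \<sigma> \<circ> \<tau> \<in> carrier (alt X) \<longleftrightarrow> \<sigma> \<in> carrier (alt Y)"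
proof -
  have "permutation \<sigma>" "permutation \<tau>" using assms(1-4) by (auto simp: permutation_permutes)
  then show ?thesis
    using assms(1) inv_conj_permutes[OF assms(1) permutes_bij[OF assms(2)] assms(5)]
    by (simp add: alt_def evenperm_inv_conj)
qed

lemma klein_inv_conj_iff:
  assumes "bij \<tau>" "\<tau> ` X = Y"
  shows "inv_into UNIV \<tau> \<circ> \<sigma> \<circ> \<tau> \<in> klein X \<longleftrightarrow> \<sigma> \<in> klein Y"
proof
  assume "inv_into UNIV \<tau> \<circ> \<sigma> \<circ> \<tau> \<in> klein X"
  moreover have "inv_into UNIV \<tau> ` Y = X"
    using image_inv_f_f[OF bij_is_inj[OF assms(1)], of X] assms(2) by simp
  ultimately have "inv_into UNIV (inv_into UNIV \<tau>) \<circ> (inv_into UNIV \<tau> \<circ> \<sigma> \<circ> \<tau>) \<circ> inv_into UNIV \<tau> \<in> klein Y"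
    by (rule klein_inv_conj[OF _ bij_imp_bij_inv[OF assms(1)]])
  then show "\<sigma> \<in> klein Y"
    by (simp only: inv_inv_eq[OF assms(1)] inv_conj_conj[OF assms(1)])
qed (rule klein_inv_conj[OF _ assms])

section \<open>Necessary conditions and the criterion at \<open>VC\<close>\<close>

context theta5_twist
begin

text \<open>
  \<open>rho v\<close> and \<open>potential v\<close> are the permutation and the \<open>\<gamma>\<close>-sum of the walk from \<open>VC\<close> to \<open>v\<close> in the
  spanning tree that omits \<open>VT\<close>--\<open>VR\<close> and \<open>VB\<close>--\<open>VR\<close>.
\<close>

primrec rho :: "theta5_vertex \<Rightarrow> theta5_vertex \<Rightarrow> theta5_vertex" where
  "rho VC = id"
| "rho VL = transpose VC VL"
| "rho VT = transpose VL VT \<circ> transpose VC VL"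
| "rho VB = transpose VL VB \<circ> transpose VC VL"
| "rho VR = transpose VC VR"

primrec potential :: "theta5_vertex \<Rightarrow> int" where
  "potential VC = 0"
| "potential VL = \<gamma> (VC, VL)"
| "potential VT = \<gamma> (VC, VL) + \<gamma> (VL, VT)"
| "potential VB = \<gamma> (VC, VL) + \<gamma> (VL, VB)"
| "potential VR = \<gamma> (VC, VR)"

text \<open>The permutation of the fundamental cycle: tree walk to \<open>a\<close>, the arc to
  \<open>b\<close>, tree walk back. It is trivial for tree arcs.\<close>

definition arc_cycle :: "theta5_vertex \<Rightarrow> theta5_vertex \<Rightarrow> theta5_vertex \<Rightarrow> theta5_vertex" where
  "arc_cycle a b = (if (a, b) = (VT, VR) then cyc_t else if (a, b) = (VR, VT) then inv_into UNIV cyc_t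
     else if (a, b) = (VB, VR) then cyc_b else if (a, b) = (VR, VB) then inv_into UNIV cyc_b else id)"

lemma rho_arc:
  assumes "(a, b) \<in> arcs theta5"
  shows "transpose a b \<circ> rho a = rho b \<circ>
    arc_cycle a b"
  using assms unfolding theta5_simps
  by (elim insertE emptyE Pair_inject; hypsubst)
    (rule theta5_fun_eqI; simp add: arc_cycle_def transpose_def)+

text \<open>Along the fundamental cycle of an arc, \<open>\<gamma>\<close> sums to 0 for tree arcs
  and otherwise to plus or minus one of the two cycle sums, modulo 3. The classes of
  \<open>cyc_t\<close> and \<open>cyc_b\<close> are 2 and 1, and balance makes
  \<open>\<gamma>_top\<close> congruent to \<open>2 * \<gamma>_bot\<close>, so one factor serves
  both cycles.\<close>

lemma potential_arc:
  assumes "(a, b) \<in> arcs theta5" balanced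
  shows "[\<gamma> (a, b) + potential a = potential b + \<gamma>_bot * quot5 (arc_cycle a b)] (mod 3)"
proof -
  have 3: "3 dvd m" "[\<gamma>_top + \<gamma>_bot = 0] (mod 3)" using assms(2) by (simp_all add: balanced_iff)
  note rev = gamma_rev_3[OF 3(1)]
  obtain k1 where k1: "\<gamma> (VT, VL) = 3 * k1 - \<gamma> (VL, VT)" by (rule rev[of VL VT]) (simp_all add: theta5_simps)
  obtain k2 where k2: "\<gamma> (VB, VL) = 3 * k2 - \<gamma> (VL, VB)" by (rule rev[of VL VB]) (simp_all add: theta5_simps)
  obtain k3 where k3: "\<gamma> (VL, VC) = 3 * k3 - \<gamma> (VC, VL)" by (rule rev[of VC VL]) (simp_all add: theta5_simps)
  obtain k4 where k4: "\<gamma> (VR, VC) = 3 * k4 - \<gamma> (VC, VR)" by (rule rev[of VC VR]) (simp_all add: theta5_simps)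
  obtain k5 where k5: "\<gamma> (VR, VT) = 3 * k5 - \<gamma> (VT, VR)" by (rule rev[of VT VR]) (simp_all add: theta5_simps)
  obtain k6 where k6: "\<gamma> (VR, VB) = 3 * k6 - \<gamma> (VB, VR)" by (rule rev[of VB VR]) (simp_all add: theta5_simps)
  obtain d where "\<gamma>_top + \<gamma>_bot = 3 * d" using 3(2) by (auto simp: cong_0_iff)
  then have d: "\<gamma> (VT, VR) = 3 * d - \<gamma>_bot - \<gamma> (VC, VL) - \<gamma> (VL, VT) - \<gamma> (VR, VC)"
    by (simp add: \<gamma>_top_def)
  have e: "\<gamma> (VB, VR) = \<gamma>_bot - \<gamma> (VC, VL) - \<gamma> (VL, VB) - \<gamma> (VR, VC)"
    by (simp add: \<gamma>_bot_def)
  \<comment> \<open>For each of the twelve arcs the witness is the exact quotient of the difference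
    by 3.\<close>
  have "\<exists>w. \<gamma> (a, b) + potential a - (potential b + \<gamma>_bot * quot5 (arc_cycle a b)) = 3 * w"
    using assms(1) unfolding theta5_simps
    apply (elim insertE emptyE Pair_inject; hypsubst)
    subgoal by (intro exI[of _ 0]) (simp add: arc_cycle_def)
    subgoal by (intro exI[of _ "d - k4 - \<gamma>_bot"]) (simp add: arc_cycle_def d k4)
    subgoal by (intro exI[of _ k3]) (simp add: arc_cycle_def k3)
    subgoal by (intro exI[of _ 0]) (simp add: arc_cycle_def)
    subgoal by (intro exI[of _ 0]) (simp add: arc_cycle_def)
    subgoal by (intro exI[of _ "- k4"]) (simp add: arc_cycle_def e k4)
    subgoal by (intro exI[of _ k1]) (simp add: arc_cycle_def k1)
    subgoal by (intro exI[of _ "k5 + k4 - d"]) (simp add: arc_cycle_def k5 d k4)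
    subgoal by (intro exI[of _ 0]) (simp add: arc_cycle_def)
    subgoal by (intro exI[of _ k4]) (simp add: arc_cycle_def k4)
    subgoal by (intro exI[of _ k2]) (simp add: arc_cycle_def k2)
    subgoal by (intro exI[of _ "k6 + k4 - \<gamma>_bot"]) (simp add: arc_cycle_def k6 e k4)
    done
  then show ?thesis by (simp only: cong_iff_dvd_diff dvd_def)
qed

lemma arc_cycle_alt: "arc_cycle a b \<in> carrier (alt ring5)"
  using cyc_alt by (simp add: arc_cycle_def) (simp add: alt_def permutes_id)

text \<open>Composing with \<open>rho u\<close> and adding \<open>potential u\<close> closes the
  walk up through the tree. For a closed walk at \<open>VC\<close> both corrections are
  trivial.\<close>

lemma walk_to_center:
  assumes "awalk u p VC"
  shows "snd (wp p) \<circ> rho u \<in> carrier (alt ring5) \<and>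
    (balanced \<longrightarrow> [(\<Sum>f\<leftarrow>p. \<gamma> f) + potential u = \<gamma>_bot * quot5 (snd (wp p) \<circ> rho u)] (mod 3))"
proof (rule walk_invariant[OF assms, where I = "\<lambda>u s \<sigma>. \<sigma> \<circ> rho u \<in> carrier (alt ring5) \<and>
    (balanced \<longrightarrow> [s + potential u = \<gamma>_bot * quot5 (\<sigma> \<circ> rho u)] (mod 3))"])
  show "id \<circ> rho VC \<in> carrier (alt ring5) \<and>
    (balanced \<longrightarrow> [0 + potential VC = \<gamma>_bot * quot5 (id \<circ> rho VC)] (mod 3))"
    by (simp add: alt_def permutes_id)
next
  fix e s \<sigma>
  assume e: "e \<in> arcs theta5" and I: "\<sigma> \<circ> rho (head theta5 e) \<in> carrier (alt ring5) \<and>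
    (balanced \<longrightarrow> [s + potential (head theta5 e) = \<gamma>_bot * quot5 (\<sigma> \<circ> rho (head theta5 e))] (mod 3))"
  let ?\<rho> = "\<sigma> \<circ> rho (snd e)"
  let ?g = "arc_cycle (fst e) (snd e)"
  have e': "(fst e, snd e) \<in> arcs theta5" using e by simp
  have I1: "?\<rho> \<in> carrier (alt ring5)" using I by (simp only: theta5_simps)
  have eq: "\<sigma> \<circ> transpose (fst e) (snd e) \<circ> rho (fst e) = ?\<rho> \<circ> ?g"
    by (simp only: o_assoc[symmetric] rho_arc[OF e'])
  have "[s + \<gamma> e + potential (fst e) = \<gamma>_bot * quot5 (?\<rho> \<circ> ?g)] (mod 3)" if balanced
  proof -
    have I2: "[s + potential (snd e) = \<gamma>_bot * quot5 ?\<rho>] (mod 3)" using I that by (simp only: theta5_simps)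
    have "[s + \<gamma> e + potential (fst e) = s + (potential (snd e) + \<gamma>_bot * quot5 ?g)] (mod 3)"
      using cong_add[OF cong_refl[of s] potential_arc[OF e' that]]
      by (simp only: add.assoc prod.collapse)
    also have "[s + (potential (snd e) + \<gamma>_bot * quot5 ?g) = \<gamma>_bot * quot5 ?\<rho> + \<gamma>_bot * quot5 ?g] (mod 3)"
      using cong_add[OF I2 cong_refl[of "\<gamma>_bot * quot5 ?g"]] by (simp only: add.assoc)
    also have "[\<gamma>_bot * quot5 ?\<rho> + \<gamma>_bot * quot5 ?g = \<gamma>_bot * quot5 (?\<rho> \<circ> ?g)] (mod 3)"
      unfolding quot5_comp[OF I1 arc_cycle_alt] by (simp add: cong_def mod_simps distrib_left)
    finally show ?thesis .
  qed
  then show "\<sigma> \<circ> transpose (tail theta5 e) (head theta5 e) \<circ> rho (tail theta5 e) \<in> carrier (alt ring5) \<and>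
    (balanced \<longrightarrow> [s + \<gamma> e + potential (tail theta5 e) =
      \<gamma>_bot * quot5 (\<sigma> \<circ> transpose (tail theta5 e) (head theta5 e) \<circ> rho (tail theta5 e))] (mod 3))"
    unfolding theta5_simps eq using alt_comp[OF _ I1 arc_cycle_alt] by simp
qed

lemma solv_center_necessary:
  assumes "(x, \<sigma>) \<in> solv VC"
  shows "\<sigma> \<in> carrier (alt ring5)" "balanced \<Longrightarrow> [sum x ring5 = \<gamma>_bot * quot5 \<sigma>] (mod 3)"
proof -
  obtain p where p: "awalk VC p VC" "wp p = (x, \<sigma>)"
    using assms by (auto simp: solvable_pairs_def)
  have w: "\<sigma> \<in> carrier (alt ring5) \<and> (balanced \<longrightarrow> [(\<Sum>f\<leftarrow>p. \<gamma> f) = \<gamma>_bot * quot5 \<sigma>] (mod 3))"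
    using walk_to_center[OF p(1)] p(2) by simp
  then show "\<sigma> \<in> carrier (alt ring5)" by simp
  assume bal: balanced
  then have "int 3 dvd int m" by (simp only: balanced_def int_dvd_int_iff)
  then have "[sum x ring5 = (\<Sum>f\<leftarrow>p. \<gamma> f)] (mod 3)"
    using cong_dvd_modulus[OF sum_solv[OF p]] unfolding verts_theta5_Diff by simp
  then show "[sum x ring5 = \<gamma>_bot * quot5 \<sigma>] (mod 3)"
    using w bal cong_trans by blast
qed

text \<open>For sufficiency, some solvable pair over \<open>\<sigma>\<close> exists. In the balanced
  case its sum already has the right residue modulo 3 and is corrected by a multiple of 3; otherwise
  every sum over the identity is available.\<close>

lemma mem_solv_center:
  assumes st: "[\<gamma>_top * s + \<gamma>_bot * t = 1] (mod int m)"
    and x: "(x, \<sigma>) \<in> carrier (gen_sym m ring5)"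
  shows "(x, \<sigma>) \<in> solv VC \<longleftrightarrow> \<sigma> \<in> carrier (alt ring5) \<and>
    (balanced \<longrightarrow> [sum x ring5 = \<gamma>_bot * quot5 \<sigma>] (mod 3))"
proof
  assume r: "\<sigma> \<in> carrier (alt ring5) \<and> (balanced \<longrightarrow> [sum x ring5 = \<gamma>_bot * quot5 \<sigma>] (mod 3))"
  obtain s0 y where y: "(y, \<sigma>) \<in> solv VC" "[sum y ring5 = s0] (mod int m)"
    using attained_alt[of \<sigma>] r unfolding ring.attained_def by blast
  have a: "ring.attained (sum y ring5) \<sigma>" using y(1) by (rule ring.attainedI) simp
  have "ring.attained (sum x ring5) \<sigma>"
  proof (cases balanced)
    case True
    have "[sum y ring5 = sum x ring5] (mod 3)"
      using solv_center_necessary(2)[OF y(1) True] r True cong_trans cong_sym by blast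
    then obtain k where "sum x ring5 = sum y ring5 + k * 3"
      by (auto simp: cong_iff_lin mult.commute)
    then show ?thesis
      using ring.attained_id_mult[OF a ring.attained_scale[OF attained_three[OF st], of k]] by (simp only:)
  next
    case False
    show ?thesis using ring.attained_all[OF a attained_one[OF st False]] .
  qed
  then show "(x, \<sigma>) \<in> solv VC"
    using ring.mem_P_iff[OF basis[OF st] x] by blast
qed (use solv_center_necessary in blast)

text \<open>By conservation at the vertices a cycle \<open>\<omega>\<close> is determined by its
  flows through \<open>VT\<close> and \<open>VB\<close>, and \<open>\<phi>\<close> becomes the
  combination of the two cycle sums with these flows as coefficients. A cycle with value 1 yields
  the Bezout relation.\<close>

lemma surj_combination:
  assumes "\<phi> m theta5 (edge_rev theta5) \<gamma> ` H1 m theta5 (edge_rev theta5) = {0..<int m}"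
  obtains s t where "[\<gamma>_top * s + \<gamma>_bot * t = 1] (mod int m)"
proof -
  have "1 mod int m \<in> {0..<int m}" using pos by simp
  then obtain \<omega> where \<omega>: "\<omega> \<in> H1 m theta5 (edge_rev theta5)"
    "\<phi> m theta5 (edge_rev theta5) \<gamma> \<omega> = 1 mod int m"
    unfolding assms[symmetric] by (auto simp del: atLeastLessThan_iff)
  have ch: "\<omega> \<in> one_chains m theta5 (edge_rev theta5)" using \<omega>(1) by (simp add: H1_def)
  have rv: "edge_rev theta5 ` theta5_edges = {(VT, VL), (VR, VT), (VC, VL), (VR, VC), (VB, VL), (VR, VB)}"
    by (simp add: theta5_edges_def edge_rev_def theta5_simps)
  have "arcs theta5 = theta5_edges \<union> edge_rev theta5 ` theta5_edges"
    unfolding rv unfolding theta5_edges_def theta5_simps by (simp only: Un_insert_left Un_empty_left)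
  moreover have "theta5_edges \<inter> edge_rev theta5 ` theta5_edges = {}"
    unfolding rv unfolding theta5_edges_def by simp
  ultimately have "\<phi> m theta5 (edge_rev theta5) \<gamma> \<omega> = (\<Sum>e\<in>theta5_edges. \<gamma> e * \<omega> e) mod int m"
    by (rule phi_oriented[OF _ _ ch])
  then have "[1 = (\<Sum>e\<in>theta5_edges. \<gamma> e * \<omega> e)] (mod int m)"
    using \<omega>(2) by (simp add: cong_def)
  then obtain h where h: "\<gamma> (VL, VT) * \<omega> (VL, VT) + \<gamma> (VT, VR) * \<omega> (VT, VR) + \<gamma> (VL, VC) * \<omega> (VL, VC)
      + \<gamma> (VC, VR) * \<omega> (VC, VR) + \<gamma> (VL, VB) * \<omega> (VL, VB) + \<gamma> (VB, VR) * \<omega> (VB, VR) = 1 + int m * h"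
    by (auto simp: cong_iff_lin theta5_edges_def add.assoc)
  have rev: "\<exists>k. \<eta> (b, a) = - \<eta> (a, b) + int m * k"
    if "\<eta> \<in> one_chains m theta5 (edge_rev theta5)" "(a, b) \<in> arcs theta5" for \<eta> a b
  proof -
    have "\<forall>e\<in>arcs theta5. \<eta> (edge_rev theta5 e) = (- \<eta> e) mod int m"
      using that(1) by (simp add: one_chains_def)
    from bspec[OF this that(2)] have "\<eta> (b, a) = (- \<eta> (a, b)) mod int m"
      by (simp only: edge_rev_theta5[OF that(2)])
    then have "[- \<eta> (a, b) = \<eta> (b, a)] (mod int m)" by (simp add: cong_def)
    then show ?thesis unfolding cong_iff_lin .
  qed
  have ia: "in_arcs theta5 VT = {(VL, VT), (VR, VT)}" "in_arcs theta5 VC = {(VL, VC), (VR, VC)}"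
    "in_arcs theta5 VB = {(VL, VB), (VR, VB)}" "in_arcs theta5 VL = {(VT, VL), (VC, VL), (VB, VL)}"
    by (auto simp: in_arcs_def theta5_simps)
  have flow: "\<exists>k. (\<Sum>e\<in>in_arcs theta5 w. \<omega> e) = int m * k" if "w \<in> verts theta5" for w
  proof -
    have "(\<Sum>e\<in>in_arcs theta5 w. \<omega> e) mod int m = 0" using \<omega>(1) that by (simp add: H1_def)
    then show ?thesis unfolding mod_eq_0_iff_dvd dvd_def .
  qed
  obtain a1 where a1: "\<omega> (VL, VT) + \<omega> (VR, VT) = int m * a1"
    using flow[of VT] by (auto simp: ia theta5_simps)
  obtain a2 where a2: "\<omega> (VL, VC) + \<omega> (VR, VC) = int m * a2"
    using flow[of VC] by (auto simp: ia theta5_simps)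
  obtain a3 where a3: "\<omega> (VL, VB) + \<omega> (VR, VB) = int m * a3"
    using flow[of VB] by (auto simp: ia theta5_simps)
  obtain a4 where a4: "\<omega> (VT, VL) + (\<omega> (VC, VL) + \<omega> (VB, VL)) = int m * a4"
    using flow[of VL] by (auto simp: ia theta5_simps)
  obtain b1 where b1: "\<omega> (VR, VT) = - \<omega> (VT, VR) + int m * b1"
    using rev[OF ch, of VT VR] by (auto simp: theta5_simps)
  obtain b2 where b2: "\<omega> (VR, VC) = - \<omega> (VC, VR) + int m * b2"
    using rev[OF ch, of VC VR] by (auto simp: theta5_simps)
  obtain b3 where b3: "\<omega> (VR, VB) = - \<omega> (VB, VR) + int m * b3"
    using rev[OF ch, of VB VR] by (auto simp: theta5_simps)
  obtain b4 where b4: "\<omega> (VT, VL) = - \<omega> (VL, VT) + int m * b4"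
    using rev[OF ch, of VL VT] by (auto simp: theta5_simps)
  obtain b5 where b5: "\<omega> (VC, VL) = - \<omega> (VL, VC) + int m * b5"
    using rev[OF ch, of VL VC] by (auto simp: theta5_simps)
  obtain b6 where b6: "\<omega> (VB, VL) = - \<omega> (VL, VB) + int m * b6"
    using rev[OF ch, of VL VB] by (auto simp: theta5_simps)
  obtain g where g: "\<gamma> (VC, VL) = - \<gamma> (VL, VC) + int m * g"
    using rev[OF one_chain, of VL VC] by (auto simp: theta5_simps)
  obtain r where r: "\<gamma> (VR, VC) = - \<gamma> (VC, VR) + int m * r"
    using rev[OF one_chain, of VC VR] by (auto simp: theta5_simps)
  have tr: "\<omega> (VT, VR) = \<omega> (VL, VT) + int m * (b1 - a1)" "\<omega> (VC, VR) = \<omega> (VL, VC) + int m * (b2 - a2)"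
    "\<omega> (VB, VR) = \<omega> (VL, VB) + int m * (b3 - a3)"
    "\<omega> (VL, VC) = - \<omega> (VL, VT) - \<omega> (VL, VB) + int m * (b4 + b5 + b6 - a4)"
    unfolding right_diff_distrib distrib_left using a1 a2 a3 a4 b1 b2 b3 b4 b5 b6 by linarith+
  \<comment> \<open>The congruences have been turned into integer equations with explicit multiples
    of m; \<open>?z\<close> collects these multipliers, so that the claim is a polynomial
    identity.\<close>
  let ?z = "\<gamma> (VT, VR) * (b1 - a1) + \<gamma> (VC, VR) * (b2 - a2) + \<gamma> (VB, VR) * (b3 - a3)
    + (\<gamma> (VL, VC) + \<gamma> (VC, VR)) * (b4 + b5 + b6 - a4) - (g + r) * (\<omega> (VL, VT) + \<omega> (VL, VB))"
  have "\<gamma>_top * \<omega> (VL, VT) + \<gamma>_bot * \<omega> (VL, VB) = (1 + int m * h) - int m * ?z"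
    unfolding h[symmetric] \<gamma>_top_def \<gamma>_bot_def g r tr(1-3) unfolding tr(4)
    by (simp add: algebra_simps)
  then have "\<gamma>_top * \<omega> (VL, VT) + \<gamma>_bot * \<omega> (VL, VB) = 1 + int m * (h - ?z)"
    by (simp only: right_diff_distrib add_diff_eq)
  then have "[1 = \<gamma>_top * \<omega> (VL, VT) + \<gamma>_bot * \<omega> (VL, VB)] (mod int m)"
    unfolding cong_iff_lin by (rule exI)
  then show thesis by (rule that[OF cong_sym])
qed

end

section \<open>Arbitrary empty vertices in the graph with five vertices\<close>

lemma permutes_image_Diff:
  assumes "\<tau> permutes V" "\<tau> u = v"
  shows "\<tau> ` (V - {u}) = V - {v}"
  using image_set_diff[OF permutes_inj[OF assms(1)], of V "{u}"] permutes_image[OF assms(1)] assms(2) by simp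

lemma theta5_walk_from_center:
  assumes "v \<in> verts theta5"
  obtains q where "pre_digraph.awalk theta5 VC q v"
proof -
  interpret bidirected_digraph theta5 "edge_rev theta5" by (rule bidirected_theta5)
  have "awalk VC [] VC" "awalk VC [(VC, VL)] VL" "awalk VC [(VC, VR)] VR"
    "awalk VC [(VC, VL), (VL, VT)] VT" "awalk VC [(VC, VL), (VL, VB)] VB"
    by (simp_all add: awalk_simps theta5_simps)
  then show thesis using that by (cases v) blast+
qed

context theta5_twist
begin

text \<open>A single \<open>\<tau>\<close> serves all pairs, as the isomorphism of the quotient will
  be built from it. The transported criterion sees sums modulo m only, and balance includes that 3
  divides m.\<close>

lemma mem_solv_vertex:
  assumes st: "[\<gamma>_top * s + \<gamma>_bot * t = 1] (mod int m)" and v: "v \<in> verts theta5"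
  obtains \<tau> where "\<tau> permutes verts theta5" "\<tau> ` ring5 = verts theta5 - {v}"
    "\<forall>x \<sigma>. (x, \<sigma>) \<in> carrier (gen_sym m (verts theta5 - {v})) \<longrightarrow>
      ((x, \<sigma>) \<in> solv v \<longleftrightarrow> \<sigma> \<in> carrier (alt (verts theta5 - {v})) \<and>
        (balanced \<longrightarrow> [sum x (verts theta5 - {v}) = \<gamma>_bot * quot5 (inv_into UNIV \<tau> \<circ> \<sigma> \<circ> \<tau>)] (mod 3)))"
proof -
  obtain q where q: "awalk VC q v" by (rule theta5_walk_from_center[OF v])
  obtain y \<tau> where wp: "wp q = (y, \<tau>)" by fastforce
  note \<tau> = wp_end[OF q wp]
  have im: "\<tau> ` ring5 = verts theta5 - {v}"
    using permutes_image_Diff[OF \<tau>(3,1)] unfolding verts_theta5_Diff .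
  have mod3: "[s mod int m = s] (mod 3)" if balanced for s :: int
  proof -
    have "int 3 dvd int m" using that by (simp only: balanced_def int_dvd_int_iff)
    then show ?thesis by (simp add: cong_def mod_mod_cancel)
  qed
  let ?\<Phi> = "\<lambda>\<sigma> s. \<sigma> \<in> carrier (alt ring5) \<and> (balanced \<longrightarrow> [s = \<gamma>_bot * quot5 \<sigma>] (mod 3))"
  have mod3_iff: "(balanced \<longrightarrow> [s mod int m = k] (mod 3)) \<longleftrightarrow> (balanced \<longrightarrow> [s = k] (mod 3))" for s k
    using mod3[of s] cong_trans cong_sym by blast
  have "(x, \<sigma>) \<in> solv v \<longleftrightarrow> ?\<Phi> (inv_into UNIV \<tau> \<circ> \<sigma> \<circ> \<tau>) (sum x (verts theta5 - {v}) mod int m)"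
    if "(x, \<sigma>) \<in> carrier (gen_sym m (verts theta5 - {v}))" for x \<sigma>
    using q wp _ that
  proof (rule solv_transport)
    fix x \<sigma> assume "(x, \<sigma>) \<in> carrier (gen_sym m (verts theta5 - {VC}))"
    then show "(x, \<sigma>) \<in> solv VC \<longleftrightarrow> ?\<Phi> \<sigma> (sum x (verts theta5 - {VC}) mod int m)"
      unfolding verts_theta5_Diff mod3_iff by (rule mem_solv_center[OF st])
  qed
  moreover have "inv_into UNIV \<tau> \<circ> \<sigma> \<circ> \<tau> \<in> carrier (alt ring5) \<longleftrightarrow> \<sigma> \<in> carrier (alt (verts theta5 - {v}))"
    if "(x, \<sigma>) \<in> carrier (gen_sym m (verts theta5 - {v}))" for x \<sigma>
    using that finite_verts by (intro alt_inv_conj_iff[OF _ \<tau>(3) _ _ im]) (simp_all add: gen_sym_carrier_iff)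
  ultimately show thesis
    by (intro that[OF \<tau>(3) im] allI impI) (simp only: mod3_iff)
qed

text \<open>Under balance 3 would divide both cycle sums, contradicting Bezout. So multiplication by
  \<open>\<gamma>_bot\<close> is an automorphism of Z/3, and \<open>\<gamma>_bot\<close> times the
  quotient map still has kernel K.\<close>

lemma gamma_bot_not_dvd:
  assumes "[\<gamma>_top * s + \<gamma>_bot * t = 1] (mod int m)" balanced
  shows "\<not> 3 dvd \<gamma>_bot"
proof
  assume d: "3 dvd \<gamma>_bot"
  have "3 dvd \<gamma>_top + \<gamma>_bot" using assms(2) by (simp add: balanced_iff cong_0_iff)
  then have "3 dvd \<gamma>_top" using d by (simp add: dvd_add_left_iff)
  have "int 3 dvd int m" using assms(2) by (simp only: balanced_def int_dvd_int_iff)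
  then have "[\<gamma>_top * s + \<gamma>_bot * t = 1] (mod 3)" using cong_dvd_modulus[OF assms(1)] by simp
  moreover have "[\<gamma>_top * s + \<gamma>_bot * t = 0] (mod 3)"
    using d \<open>3 dvd \<gamma>_top\<close> by (simp add: cong_0_iff)
  ultimately have "[1 = (0::int)] (mod 3)" using cong_sym cong_trans by blast
  then show False by (simp add: cong_def)
qed

theorem theta5_solvable:
  assumes surj: "\<phi> m theta5 (edge_rev theta5) \<gamma> ` H1 m theta5 (edge_rev theta5) = {0..<int m}"
    and v: "v \<in> verts theta5" and X: "X = verts theta5 - {v}"
  shows "if balanced
    then \<exists>\<iota> \<in> iso (alt X Mod klein X) (integer_mod_group 3).
      solv v = {(x, \<sigma>). (x, \<sigma>) \<in> carrier (gen_sym m X) \<and> \<sigma> \<in> carrier (alt X) \<and>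
        (\<Sum>w\<in>X. x w) mod 3 = \<iota> (klein X #>\<^bsub>alt X\<^esub> \<sigma>)}
    else solv v = {(x, \<sigma>). (x, \<sigma>) \<in> carrier (gen_sym m X) \<and> \<sigma> \<in> carrier (alt X)}"
proof -
  obtain s t where st: "[\<gamma>_top * s + \<gamma>_bot * t = 1] (mod int m)" by (rule surj_combination[OF surj])
  obtain \<tau> where \<tau>: "\<tau> permutes verts theta5" "\<tau> ` ring5 = X"
    and mem: "\<forall>x \<sigma>. (x, \<sigma>) \<in> carrier (gen_sym m X) \<longrightarrow>
      ((x, \<sigma>) \<in> solv v \<longleftrightarrow> \<sigma> \<in> carrier (alt X) \<and>
        (balanced \<longrightarrow> [sum x X = \<gamma>_bot * quot5 (inv_into UNIV \<tau> \<circ> \<sigma> \<circ> \<tau>)] (mod 3)))"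
    unfolding X by (rule mem_solv_vertex[OF st v])
  have sub: "solv v \<subseteq> carrier (gen_sym m X)" unfolding X by (rule solv_carrier)
  show ?thesis
  proof (cases balanced)
    case False
    have "solv v = {(x, \<sigma>). (x, \<sigma>) \<in> carrier (gen_sym m X) \<and> \<sigma> \<in> carrier (alt X)}"
      using sub mem False by auto
    then show ?thesis using False by simp
  next
    case True
    let ?conj = "\<lambda>\<sigma>. inv_into UNIV \<tau> \<circ> \<sigma> \<circ> \<tau>"
    let ?f = "\<lambda>\<sigma>. (\<gamma>_bot * quot5 (?conj \<sigma>)) mod 3"
    have bij: "bij \<tau>" using \<tau>(1) by (rule permutes_bij)
    have finX: "finite X" using finite_verts X by simp
    have altX: "?conj \<sigma> \<in> carrier (alt ring5) \<longleftrightarrow> \<sigma> \<in> carrier (alt X)" if "\<sigma> permutes X" for \<sigma>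
      by (rule alt_inv_conj_iff[OF that \<tau>(1) finX finite_verts \<tau>(2)])
    have alt: "?conj \<sigma> \<in> carrier (alt ring5)" if "\<sigma> \<in> carrier (alt X)" for \<sigma>
      using altX[of \<sigma>] that by (simp add: alt_def)
    have ndvd: "\<not> 3 dvd \<gamma>_bot" by (rule gamma_bot_not_dvd[OF st True])
    have "\<exists>\<iota>\<in>iso (alt X Mod klein X) (integer_mod_group 3).
      \<forall>\<sigma>\<in>carrier (alt X). \<iota> (klein X #>\<^bsub>alt X\<^esub> \<sigma>) = ?f \<sigma>"
    proof (rule alt_Mod_klein_iso[OF finX])
      fix \<sigma> \<rho> assume a: "\<sigma> \<in> carrier (alt X)" "\<rho> \<in> carrier (alt X)"
      show "?f (\<sigma> \<circ> \<rho>) = (?f \<sigma> + ?f \<rho>) mod 3"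
        unfolding inv_conj_comp[OF bij] quot5_comp[OF alt[OF a(1)] alt[OF a(2)]]
        by (simp add: mod_simps distrib_left)
    next
      show "?f \<sigma> \<in> {0..<3}" for \<sigma> by simp
    next
      fix \<sigma> assume \<sigma>: "\<sigma> \<in> carrier (alt X)"
      have "?f \<sigma> = 0 \<longleftrightarrow> 3 dvd \<gamma>_bot * quot5 (?conj \<sigma>)" by (rule mod_eq_0_iff_dvd)
      also have "\<dots> \<longleftrightarrow> 3 dvd quot5 (?conj \<sigma>)" using ndvd by (simp add: prime_dvd_mult_iff)
      also have "quot5 (?conj \<sigma>) \<in> {0, 1, 2}" by (simp add: quot5_def pairing_def)
      then have "3 dvd quot5 (?conj \<sigma>) \<longleftrightarrow> quot5 (?conj \<sigma>) = 0"
        by (elim insertE emptyE) simp_all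
      also have "\<dots> \<longleftrightarrow> \<sigma> \<in> klein X"
        by (simp only: quot5_eq_0_iff[OF alt[OF \<sigma>]] klein_inv_conj_iff[OF bij \<tau>(2)])
      finally show "?f \<sigma> = 0 \<longleftrightarrow> \<sigma> \<in> klein X" .
    next
      have im: "inv_into UNIV \<tau> ` X = ring5"
        using image_inv_f_f[OF bij_is_inj[OF bij], of ring5] unfolding \<tau>(2) .
      have "cyc_b permutes ring5" using cyc_alt(2) by (simp add: alt_def)
      then have p: "inv_into UNIV (inv_into UNIV \<tau>) \<circ> cyc_b \<circ> inv_into UNIV \<tau> permutes X"
        by (rule inv_conj_permutes[OF _ bij_imp_bij_inv[OF bij] im])
      \<comment> \<open>\<open>cyc_b\<close> has class 1; moved to \<open>X\<close>, it is an
        element whose value is \<open>\<gamma>_bot\<close>, nonzero modulo 3.\<close>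
      define \<sigma> where "\<sigma> = \<tau> \<circ> cyc_b \<circ> inv_into UNIV \<tau>"
      have c: "?conj \<sigma> = cyc_b"
        using inv_conj_conj[OF bij_imp_bij_inv[OF bij], of cyc_b] by (simp only: \<sigma>_def inv_inv_eq[OF bij])
      have "\<sigma> permutes X" using p by (simp only: \<sigma>_def inv_inv_eq[OF bij])
      then have "\<sigma> \<in> carrier (alt X)" using altX[of \<sigma>] c cyc_alt(2) by simp
      moreover have "?f \<sigma> \<noteq> 0" unfolding c using ndvd by (simp add: mod_eq_0_iff_dvd)
      ultimately show "\<exists>\<sigma>\<in>carrier (alt X). ?f \<sigma> \<noteq> 0" by blast
    qed
    then obtain \<iota> where \<iota>: "\<iota> \<in> iso (alt X Mod klein X) (integer_mod_group 3)"
      "\<And>\<sigma>. \<sigma> \<in> carrier (alt X) \<Longrightarrow> \<iota> (klein X #>\<^bsub>alt X\<^esub> \<sigma>) = ?f \<sigma>" by blast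
    have "(x, \<sigma>) \<in> solv v \<longleftrightarrow> (x, \<sigma>) \<in> carrier (gen_sym m X) \<and> \<sigma> \<in> carrier (alt X) \<and>
        sum x X mod 3 = \<iota> (klein X #>\<^bsub>alt X\<^esub> \<sigma>)" for x \<sigma>
    proof (cases "(x, \<sigma>) \<in> carrier (gen_sym m X) \<and> \<sigma> \<in> carrier (alt X)")
      case c: True
      have "\<iota> (klein X #>\<^bsub>alt X\<^esub> \<sigma>) = ?f \<sigma>" using c by (intro \<iota>(2)) simp
      then show ?thesis using mem[rule_format, of x \<sigma>] True c by (simp only: cong_def) simp
    next
      case False
      then show ?thesis using mem[rule_format, of x \<sigma>] sub by blast
    qed
    then have "solv v = {(x, \<sigma>). (x, \<sigma>) \<in> carrier (gen_sym m X) \<and> \<sigma> \<in> carrier (alt X) \<and>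
        sum x X mod 3 = \<iota> (klein X #>\<^bsub>alt X\<^esub> \<sigma>)}" by auto
    then show ?thesis using True \<iota>(1) by auto
  qed
qed

end

section \<open>The exotic action of the symmetric group on five letters\<close>

text \<open>
  \<open>acts a b c d z w\<close> says that the matrix sends homogeneous coordinates of \<open>z\<close> to a multiple of
  those of \<open>w\<close>.
\<close>

primrec hx :: "theta7_vertex \<Rightarrow> int" where
  "hx Infty = 1" | "hx (Fin z) = z" | "hx Center = 0"

text \<open>\<open>Center\<close> is not a projective point; the coordinates (0, 0) are a default
  value.\<close>

primrec hy :: "theta7_vertex \<Rightarrow> int" where
  "hy Infty = 0" | "hy (Fin z) = 1" | "hy Center = 0"

definition acts :: "int \<Rightarrow> int \<Rightarrow> int \<Rightarrow> int \<Rightarrow> theta7_vertex \<Rightarrow> theta7_vertex \<Rightarrow> bool" where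
  "acts a b c d z w \<longleftrightarrow> (\<exists>k. \<not> 5 dvd k \<and> [a * hx z + b * hy z = k * hx w] (mod 5) \<and>
     [c * hx z + d * hy z = k * hy w] (mod 5))"

lemma P1F5_eq: "P1F5 = {Infty, Fin 0, Fin 1, Fin 2, Fin 3, Fin 4}"
proof -
  have "{0..4::int} = {0, 1, 2, 3, 4}" by auto
  then show ?thesis by (simp add: P1F5_def)
qed

lemma P1F5_cases:
  assumes "z \<in> P1F5"
  obtains "z = Infty" | u where "z = Fin u" "0 \<le> u" "u \<le> 4"
  using assms by (auto simp: P1F5_def)

lemma inverse_mod_5:
  assumes "\<not> (5::int) dvd k"
  obtains l where "[k * l = 1] (mod 5)" "[k * modular_inverse 5 k = 1] (mod 5)" "\<not> 5 dvd l"
proof -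
  have "coprime k 5" using assms prime_imp_coprime[of "5::int" k] by (simp add: coprime_commute)
  then have i: "[k * modular_inverse 5 k = 1] (mod 5)" by (rule cong_modular_inverse1)
  moreover have "\<not> 5 dvd modular_inverse 5 k"
  proof
    assume "5 dvd modular_inverse 5 k"
    then have "[1 = 0] (mod (5::int))" using i by (metis cong_0_iff cong_sym cong_trans dvd_mult)
    then show False by (simp add: cong_def)
  qed
  ultimately show thesis using that by blast
qed

text \<open>The scalar is the nonzero denominator, or the numerator if the denominator vanishes
  modulo 5.\<close>

lemma acts_frac_linear:
  assumes det: "\<not> 5 dvd a * d - b * c" and z: "z \<in> P1F5"
  shows "frac_linear a b c d z \<in> P1F5 \<and> acts a b c d z (frac_linear a b c d z)"
proof -
  have fin: "Fin (n mod 5) \<in> P1F5" for n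
    using pos_mod_sign[of 5 n] pos_mod_bound[of 5 n] by (auto simp: P1F5_def)
  have quotient: "[p = q * ((p * modular_inverse 5 q) mod 5)] (mod 5)" if q: "\<not> 5 dvd q" for p q :: int
  proof -
    obtain l where "[q * modular_inverse 5 q = 1] (mod 5)" by (rule inverse_mod_5[OF q])
    from cong_scalar_left[OF this, of p] have "[p = q * (p * modular_inverse 5 q)] (mod 5)"
      by (simp add: cong_def algebra_simps)
    then show ?thesis by (simp add: cong_def mod_simps)
  qed
  show ?thesis
    using z
  proof (cases rule: P1F5_cases)
    case 1
    show ?thesis
    proof (cases "5 dvd c")
      case True
      then have "\<not> 5 dvd a" using det by (auto simp: dvd_diff)
      then show ?thesis
        using True 1 by (auto simp: acts_def P1F5_def cong_0_iff intro!: exI[of _ a])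
    next
      case False
      then show ?thesis
        using 1 fin quotient[OF False, of a] by (auto simp: acts_def intro!: exI[of _ c])
    qed
  next
    case (2 u)
    show ?thesis
    proof (cases "5 dvd c * u + d")
      case True
      \<comment> \<open>Eliminating \<open>u\<close> from numerator and denominator leaves the
        determinant, so they cannot both vanish modulo 5.\<close>
      have "\<not> 5 dvd a * u + b"
      proof
        assume "5 dvd a * u + b"
        then have "5 dvd a * (c * u + d) - c * (a * u + b)" using True by (intro dvd_diff dvd_mult)
        moreover have "a * (c * u + d) - c * (a * u + b) = a * d - b * c" by (simp add: algebra_simps)
        ultimately show False using det by simp
      qed
      then show ?thesis
        using True 2 by (auto simp: acts_def P1F5_def cong_0_iff intro!: exI[of _ "a * u + b"])
    next
      case False
      then show ?thesis
        using 2 fin quotient[OF False, of "a * u + b"]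
        by (auto simp: acts_def intro!: exI[of _ "c * u + d"])
    qed
  qed
qed

text \<open>Points carry normalized coordinates, (1, 0) or (u, 1) with u a residue, so proportional
  coordinates modulo 5 belong to equal points.\<close>

lemma acts_unique:
  assumes "acts a b c d z w" "acts a b c d z w'" "w \<in> P1F5" "w' \<in> P1F5"
  shows "w = w'"
proof -
  obtain k where k: "\<not> 5 dvd k" "[a * hx z + b * hy z = k * hx w] (mod 5)"
    "[c * hx z + d * hy z = k * hy w] (mod 5)" using assms(1) by (auto simp: acts_def)
  obtain l where l: "\<not> 5 dvd l" "[a * hx z + b * hy z = l * hx w'] (mod 5)"
    "[c * hx z + d * hy z = l * hy w'] (mod 5)" using assms(2) by (auto simp: acts_def)
  have x: "[k * hx w = l * hx w'] (mod 5)" using k(2) l(2) cong_sym cong_trans by blast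
  have y: "[k * hy w = l * hy w'] (mod 5)" using k(3) l(3) cong_sym cong_trans by blast
  show ?thesis
    using assms(3)
  proof (cases rule: P1F5_cases)
    case 1
    show ?thesis using assms(4)
    proof (cases rule: P1F5_cases)
      case (2 u)
      then show ?thesis using 1 y l(1) by (simp add: cong_sym_eq[of 0] cong_0_iff)
    qed (simp add: 1)
  next
    case (2 u)
    show ?thesis using assms(4)
    proof (cases rule: P1F5_cases)
      case 1
      then show ?thesis using 2 y k(1) by (simp add: cong_0_iff)
    next
      fix u' assume u': "w' = Fin u'" "0 \<le> u'" "u' \<le> 4"
      have "[k = l] (mod 5)" using y 2(1) u'(1) by simp
      then have "[l * u' = k * u'] (mod 5)" by (intro cong_scalar_right) (rule cong_sym)
      moreover have "[k * u = l * u'] (mod 5)" using x 2(1) u'(1) by simp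
      ultimately have "[k * u = k * u'] (mod 5)" using cong_trans by blast
      then have "5 dvd k * (u - u')" by (simp add: cong_iff_dvd_diff right_diff_distrib)
      then have "5 dvd u - u'" using k(1) by (simp add: prime_dvd_mult_iff)
      then have "u = u'" using 2(2,3) u'(2,3) by presburger
      then show ?thesis using 2(1) u'(1) by simp
    qed
  qed
qed

lemma acts_comp:
  assumes "acts a b c d z w" "acts a' b' c' d' w v"
  shows "acts (a' * a + b' * c) (a' * b + b' * d) (c' * a + d' * c) (c' * b + d' * d) z v"
proof -
  obtain k where k: "\<not> 5 dvd k" "[a * hx z + b * hy z = k * hx w] (mod 5)"
    "[c * hx z + d * hy z = k * hy w] (mod 5)" using assms(1) by (auto simp: acts_def)
  obtain l where l: "\<not> 5 dvd l" "[a' * hx w + b' * hy w = l * hx v] (mod 5)"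
    "[c' * hx w + d' * hy w = l * hy v] (mod 5)" using assms(2) by (auto simp: acts_def)
  have row: "[(p * a + q * c) * hx z + (p * b + q * d) * hy z = k * l * h] (mod 5)"
    if "[p * hx w + q * hy w = l * h] (mod 5)" for p q h
  proof -
    have "(p * a + q * c) * hx z + (p * b + q * d) * hy z = p * (a * hx z + b * hy z) + q * (c * hx z + d * hy z)"
      by (simp add: algebra_simps)
    also have "[p * (a * hx z + b * hy z) + q * (c * hx z + d * hy z) = p * (k * hx w) + q * (k * hy w)] (mod 5)"
      by (intro cong_add cong_scalar_left k)
    also have "p * (k * hx w) + q * (k * hy w) = k * (p * hx w + q * hy w)" by (simp add: algebra_simps)
    also have "[k * (p * hx w + q * hy w) = k * (l * h)] (mod 5)" by (intro cong_scalar_left that)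
    finally show ?thesis by (simp add: mult.assoc)
  qed
  have "\<not> 5 dvd k * l" using k(1) l(1) by (simp add: prime_dvd_mult_iff)
  then show ?thesis unfolding acts_def using row[OF l(2)] row[OF l(3)] by blast
qed

lemma acts_scale:
  assumes "acts a b c d z w" "\<not> 5 dvd r" "[a' = r * a] (mod 5)" "[b' = r * b] (mod 5)"
    "[c' = r * c] (mod 5)" "[d' = r * d] (mod 5)"
  shows "acts a' b' c' d' z w"
proof -
  obtain k where k: "\<not> 5 dvd k" "[a * hx z + b * hy z = k * hx w] (mod 5)"
    "[c * hx z + d * hy z = k * hy w] (mod 5)" using assms(1) by (auto simp: acts_def)
  have row: "[p' * hx z + q' * hy z = r * k * h] (mod 5)"
    if "[p' = r * p] (mod 5)" "[q' = r * q] (mod 5)" "[p * hx z + q * hy z = k * h] (mod 5)" for p q p' q' h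
  proof -
    have "[p' * hx z + q' * hy z = (r * p) * hx z + (r * q) * hy z] (mod 5)"
      by (intro cong_add cong_scalar_right that)
    also have "(r * p) * hx z + (r * q) * hy z = r * (p * hx z + q * hy z)" by (simp add: algebra_simps)
    also have "[r * (p * hx z + q * hy z) = r * (k * h)] (mod 5)" by (intro cong_scalar_left that)
    finally show ?thesis by (simp add: mult.assoc)
  qed
  have "\<not> 5 dvd r * k" using k(1) assms(2) by (simp add: prime_dvd_mult_iff)
  then show ?thesis unfolding acts_def using row[OF assms(3,4) k(2)] row[OF assms(5,6) k(3)] by blast
qed

text \<open>Replaces modular inverses and the case distinction at infinity by a relation for which
  composition is matrix multiplication.\<close>

lemma mem_PGL25_iff:
  "g \<in> PGL25 \<longleftrightarrow> g permutes P1F5 \<and>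
     (\<exists>a b c d. \<not> 5 dvd (a * d - b * c) \<and> (\<forall>z\<in>P1F5. acts a b c d z (g z)))"
proof -
  have "(\<forall>z\<in>P1F5. g z = frac_linear a b c d z) \<longleftrightarrow> (\<forall>z\<in>P1F5. acts a b c d z (g z))"
    if g: "g permutes P1F5" and det: "\<not> 5 dvd (a * d - b * c)" for a b c d
  proof (intro ball_cong refl)
    fix z assume z: "z \<in> P1F5"
    have "g z \<in> P1F5" using z permutes_in_image[OF g] by simp
    then show "g z = frac_linear a b c d z \<longleftrightarrow> acts a b c d z (g z)"
      using acts_frac_linear[OF det z] acts_unique by metis
  qed
  then show ?thesis unfolding PGL25_def mem_Collect_eq by blast
qed

lemma PGL25_permutes: "g \<in> PGL25 \<Longrightarrow> g permutes P1F5"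
  by (simp add: mem_PGL25_iff)

lemma permutes_eqI:
  assumes "g permutes S" "h permutes S" "\<And>z. z \<in> S \<Longrightarrow> g z = h z"
  shows "g = h"
  using assms by (metis ext permutes_not_in)

lemma PGL25_comp:
  assumes "g \<in> PGL25" "h \<in> PGL25"
  shows "g \<circ> h \<in> PGL25"
proof -
  obtain a b c d where h: "h permutes P1F5" "\<not> 5 dvd (a * d - b * c)" "\<forall>z\<in>P1F5. acts a b c d z (h z)"
    using assms(2) by (auto simp: mem_PGL25_iff)
  obtain a' b' c' d' where g: "g permutes P1F5" "\<not> 5 dvd (a' * d' - b' * c')" "\<forall>z\<in>P1F5. acts a' b' c' d' z (g z)"
    using assms(1) by (auto simp: mem_PGL25_iff)
  have "(a' * a + b' * c) * (c' * b + d' * d) - (a' * b + b' * d) * (c' * a + d' * c)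
      = (a' * d' - b' * c') * (a * d - b * c)" by (simp add: algebra_simps)
  then have "\<not> 5 dvd (a' * a + b' * c) * (c' * b + d' * d) - (a' * b + b' * d) * (c' * a + d' * c)"
    using g(2) h(2) by (simp add: prime_dvd_mult_iff)
  moreover have "\<forall>z\<in>P1F5. acts (a' * a + b' * c) (a' * b + b' * d) (c' * a + d' * c) (c' * b + d' * d) z ((g \<circ> h) z)"
    using g(3) h(1,3) permutes_in_image[OF h(1)] by (auto intro: acts_comp)
  ultimately show ?thesis
    using permutes_compose[OF h(1) g(1)] unfolding mem_PGL25_iff by blast
qed

lemma PGL25_id: "id \<in> PGL25"
proof -
  have "acts 1 0 0 1 z (id z)" for z by (auto simp: acts_def intro!: exI[of _ 1])
  then show ?thesis unfolding mem_PGL25_iff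
    by (intro conjI permutes_id exI[of _ 1] exI[of _ 0]) simp_all
qed

section \<open>The two 4-cycles and what they generate\<close>

definition cyc1 :: "theta7_vertex \<Rightarrow> theta7_vertex" where
  "cyc1 = transpose Infty (Fin 2) \<circ> (transpose (Fin 2) (Fin 1) \<circ> transpose (Fin 1) (Fin 0))"

definition cyc2 :: "theta7_vertex \<Rightarrow> theta7_vertex" where
  "cyc2 = transpose Infty (Fin 2) \<circ> (transpose (Fin 2) (Fin 3) \<circ> transpose (Fin 3) (Fin 4))"

lemma cyc1_simps [simp]:
  "cyc1 Infty = Fin 2" "cyc1 (Fin 0) = Infty" "cyc1 (Fin 1) = Fin 0" "cyc1 (Fin 2) = Fin 1"
  "cyc1 (Fin 3) = Fin 3" "cyc1 (Fin 4) = Fin 4" "cyc1 Center = Center"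
  by (simp_all add: cyc1_def transpose_def)

lemma cyc2_simps [simp]:
  "cyc2 Infty = Fin 2" "cyc2 (Fin 4) = Infty" "cyc2 (Fin 3) = Fin 4" "cyc2 (Fin 2) = Fin 3"
  "cyc2 (Fin 0) = Fin 0" "cyc2 (Fin 1) = Fin 1" "cyc2 Center = Center"
  by (simp_all add: cyc2_def transpose_def)

lemma cyc12_permutes: "cyc1 permutes P1F5" "cyc2 permutes P1F5"
  unfolding cyc1_def cyc2_def P1F5_eq by (intro permutes_compose permutes_swap_id; simp)+

lemma acts_FinI:
  assumes "\<not> 5 dvd c * hx z + d * hy z" "(a * hx z + b * hy z) mod 5 = ((c * hx z + d * hy z) * u) mod 5"
  shows "acts a b c d z (Fin u)"
  using assms unfolding acts_def by (intro exI[of _ "c * hx z + d * hy z"]) (simp add: cong_def)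

lemma acts_InftyI:
  assumes "\<not> 5 dvd a * hx z + b * hy z" "5 dvd c * hx z + d * hy z"
  shows "acts a b c d z Infty"
  using assms unfolding acts_def by (intro exI[of _ "a * hx z + b * hy z"]) (simp add: cong_0_iff)

lemma cyc12_PGL25: "cyc1 \<in> PGL25" "cyc2 \<in> PGL25"
proof -
  \<comment> \<open>The maps are (z + 4) / (3 z) and 2 z / (z + 1). Each is determined by its two
    fixed points, 3 and 4 resp. 0 and 1, together with the image 2 of infinity.\<close>
  have "\<forall>z\<in>P1F5. acts 1 4 3 0 z (cyc1 z)" "\<forall>z\<in>P1F5. acts 2 0 1 1 z (cyc2 z)"
    unfolding P1F5_eq by (simp_all add: acts_FinI acts_InftyI)
  moreover have "\<not> 5 dvd (1 * 0 - 4 * 3 :: int)" "\<not> 5 dvd (2 * 1 - 0 * 1 :: int)" by simp_all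
  ultimately show "cyc1 \<in> PGL25" "cyc2 \<in> PGL25"
    unfolding mem_PGL25_iff using cyc12_permutes by blast+
qed

text \<open>
  Bruhat decomposition: modulo scalars every invertible matrix is a product of translations
  \<open>z + t\<close>, scalings \<open>u z\<close> and the inversion \<open>2 / z\<close>, and each of these is a word in the two
  4-cycles.
\<close>

lemma PGL25_generated:
  assumes id: "H id" and comp: "\<And>f g. H f \<Longrightarrow> H g \<Longrightarrow> H (f \<circ> g)"
    and gens: "H cyc1" "H cyc2" and g: "g \<in> PGL25"
  shows "H g"
proof -
  \<comment> \<open>\<open>R a b c d\<close> says that the matrix is realized by a permutation with
    property \<open>H\<close>. Realizable matrices are closed under products and nonzero scalars, so
    the claim becomes one about factorizing matrices.\<close>
  define R where "R a b c d \<longleftrightarrow>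
    (\<exists>h. H h \<and> h permutes P1F5 \<and> (\<forall>z\<in>P1F5. acts a b c d z (h z)))" for a b c d
  have R_mult: "R (a' * a + b' * c) (a' * b + b' * d) (c' * a + d' * c) (c' * b + d' * d)"
    if R1: "R a b c d" and R2: "R a' b' c' d'" for a b c d a' b' c' d'
  proof -
    obtain h where h: "H h" "h permutes P1F5" "\<forall>z\<in>P1F5. acts a b c d z (h z)"
      using R1 unfolding R_def by blast
    obtain h' where h': "H h'" "h' permutes P1F5" "\<forall>z\<in>P1F5. acts a' b' c' d' z (h' z)"
      using R2 unfolding R_def by blast
    have "acts (a' * a + b' * c) (a' * b + b' * d) (c' * a + d' * c) (c' * b + d' * d) z ((h' \<circ> h) z)"
      if "z \<in> P1F5" for z
      using acts_comp[of a b c d z "h z" a' b' c' d' "h' (h z)"] h(3) h'(3) that permutes_in_image[OF h(2)]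
      by simp
    then show ?thesis
      unfolding R_def using comp[OF h'(1) h(1)] permutes_compose[OF h(2) h'(2)] by blast
  qed
  have R_scale: "R a' b' c' d'"
    if "R a b c d" "\<not> 5 dvd r" "[a' = r * a] (mod 5)" "[b' = r * b] (mod 5)"
      "[c' = r * c] (mod 5)" "[d' = r * d] (mod 5)" for a b c d a' b' c' d' r
    using that(1) acts_scale[OF _ that(2-6)] unfolding R_def by blast
  have T: "R 1 1 0 1"
    unfolding R_def
  proof (intro exI conjI)
    show "H (cyc1 \<circ> (cyc1 \<circ> (cyc1 \<circ> cyc2)))" by (intro comp gens)
    show "cyc1 \<circ> (cyc1 \<circ> (cyc1 \<circ> cyc2)) permutes P1F5"
      by (intro permutes_compose cyc12_permutes)
    show "\<forall>z\<in>P1F5. acts 1 1 0 1 z ((cyc1 \<circ> (cyc1 \<circ> (cyc1 \<circ> cyc2))) z)"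
      unfolding P1F5_eq by (simp add: acts_FinI acts_InftyI)
  qed
  have S: "R 2 0 0 1"
    unfolding R_def
  proof (intro exI conjI)
    show "H (cyc1 \<circ> (cyc1 \<circ> (cyc2 \<circ> (cyc1 \<circ> cyc2))))" by (intro comp gens)
    show "cyc1 \<circ> (cyc1 \<circ> (cyc2 \<circ> (cyc1 \<circ> cyc2))) permutes P1F5"
      by (intro permutes_compose cyc12_permutes)
    show "\<forall>z\<in>P1F5. acts 2 0 0 1 z ((cyc1 \<circ> (cyc1 \<circ> (cyc2 \<circ> (cyc1 \<circ> cyc2)))) z)"
      unfolding P1F5_eq by (simp add: acts_FinI acts_InftyI)
  qed
  have J: "R 0 2 1 0"
    unfolding R_def
  proof (intro exI conjI)
    let ?w = "cyc2 \<circ> (cyc1 \<circ> (cyc2 \<circ> (cyc2 \<circ> (cyc2 \<circ> (cyc1 \<circ> cyc2)))))"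
    show "H ?w" by (intro comp gens)
    show "?w permutes P1F5" by (intro permutes_compose cyc12_permutes)
    show "\<forall>z\<in>P1F5. acts 0 2 1 0 z (?w z)"
      unfolding P1F5_eq by (simp add: acts_FinI acts_InftyI)
  qed
  have trans_nat: "R 1 (int n) 0 1" for n
  proof (induction n)
    case 0
    have "acts 1 0 0 1 z (id z)" for z by (auto simp: acts_def intro!: exI[of _ 1])
    then show ?case unfolding R_def using id permutes_id[of P1F5] by (intro exI[of _ id]) simp
  next
    case (Suc n)
    show ?case using R_mult[OF Suc T] by (simp add: add.commute)
  qed
  have trans: "R 1 t 0 1" for t
  proof -
    have "[t = int (nat (t mod 5))] (mod 5)" by (simp add: cong_def)
    then show ?thesis by (intro R_scale[OF trans_nat[of "nat (t mod 5)"], of 1]) simp_all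
  qed
  have unit: "R u 0 0 1" if "\<not> 5 dvd u" for u
  proof -
    \<comment> \<open>2 generates the units modulo 5: its powers are 1, 2, 4 and 8, the last being
      congruent to 3.\<close>
    have "u mod 5 \<in> {1, 2, 3, 4}" using that by (simp add: dvd_eq_mod_eq_0) presburger
    moreover have "R 4 0 0 1" using R_mult[OF S S] by simp
    moreover have "R 8 0 0 1" using R_mult[OF R_mult[OF S S] S] by simp
    then have "R 3 0 0 1" by (rule R_scale[of _ _ _ _ 1]) (simp_all add: cong_def)
    moreover have "R 1 0 0 1" using trans[of 0] .
    ultimately have "R (u mod 5) 0 0 1" using S by (elim insertE emptyE) simp_all
    then show ?thesis by (rule R_scale[of _ _ _ _ 1]) (simp_all add: cong_def)
  qed
  obtain a b c d where abcd: "g permutes P1F5" "\<not> 5 dvd (a * d - b * c)" "\<forall>z\<in>P1F5. acts a b c d z (g z)"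
    using g unfolding mem_PGL25_iff by blast
  have "R a b c d"
  proof (cases "5 dvd c")
    case True
    have "\<not> 5 dvd d" "\<not> 5 dvd a" using abcd(2) True by auto
    \<comment> \<open>Here the map is affine, namely (a/d) z + b/d, with \<open>d'\<close> in the
      role of 1/d.\<close>
    obtain d' where d': "[d * d' = 1] (mod 5)" "\<not> 5 dvd d'" by (rule inverse_mod_5[OF \<open>\<not> 5 dvd d\<close>])
    have "\<not> 5 dvd a * d'" using \<open>\<not> 5 dvd a\<close> d'(2) by (simp add: prime_dvd_mult_iff)
    from R_mult[OF unit[OF this] trans[of "b * d'"]] have "R (a * d') (b * d') 0 1" by simp
    then show ?thesis
    proof (rule R_scale[OF _ \<open>\<not> 5 dvd d\<close>])
      show "[a = d * (a * d')] (mod 5)" "[b = d * (b * d')] (mod 5)"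
        using cong_scalar_left[OF cong_sym[OF d'(1)], of a] cong_scalar_left[OF cong_sym[OF d'(1)], of b]
        by (simp_all add: ac_simps)
    qed (use True in \<open>simp_all add: cong_0_iff\<close>)
  next
    case False
    obtain c' where c': "[c * c' = 1] (mod 5)" "\<not> 5 dvd c'" by (rule inverse_mod_5[OF False])
    \<comment> \<open>The map equals a/c + ((b c - a d) / c^2) / (z + d/c). The available inversion
      is 2/z, so the scaling must be half of the middle coefficient; 3 is the inverse of 2 modulo
      5.\<close>
    let ?u = "3 * (b * c - a * d) * (c' * c')"
    have "\<not> 5 dvd b * c - a * d" using abcd(2) by (simp add: dvd_diff_commute)
    moreover have "prime (5::int)" by simp
    ultimately have u: "\<not> 5 dvd ?u" using c'(2) by (simp only: prime_dvd_mult_iff) simp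
    have "R (a * c') (2 * ?u + a * c' * (d * c')) 1 (d * c')"
      using R_mult[OF R_mult[OF R_mult[OF trans[of "d * c'"] J] unit[OF u]] trans[of "a * c'"]]
      by (simp add: ac_simps)
    then show ?thesis
    proof (rule R_scale[OF _ False])
      have inv: "[k = c * (k * c')] (mod 5)" for k
        using cong_scalar_left[OF cong_sym[OF c'(1)], of k] by (simp add: ac_simps)
      show "[a = c * (a * c')] (mod 5)" "[d = c * (d * c')] (mod 5)" by (rule inv)+
      have "[b = c * (b * c')] (mod 5)" by (rule inv)
      also have "[c * (b * c') = c * (c * (b * c') * c')] (mod 5)"
        using cong_scalar_left[OF inv[of "b * c'"], of c] by (simp add: ac_simps)
      also have "[c * (c * (b * c') * c') = c * (2 * ?u + a * c' * (d * c'))] (mod 5)"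
      proof -
        have "c * (2 * ?u + a * c' * (d * c')) - c * (c * (b * c') * c') = 5 * (c * ((b * c - a * d) * (c' * c')))"
          by (simp add: algebra_simps)
        then show ?thesis by (metis cong_iff_dvd_diff cong_sym dvd_triv_left)
      qed
      finally show "[b = c * (2 * ?u + a * c' * (d * c'))] (mod 5)" .
    qed simp
  qed
  then obtain h where h: "H h" "h permutes P1F5" "\<forall>z\<in>P1F5. acts a b c d z (h z)"
    unfolding R_def by blast
  have "h = g"
  proof (rule permutes_eqI[OF h(2) abcd(1)])
    fix z assume z: "z \<in> P1F5"
    show "h z = g z"
      using acts_unique[of a b c d z "h z" "g z"] h(3) abcd(3) z
        permutes_in_image[OF h(2)] permutes_in_image[OF abcd(1)] by simp
  qed
  then show ?thesis using h(1) by simp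
qed

text \<open>The 15 unordered pairs form one orbit under the two 4-cycles, and every pair is reached
  using forward steps only. Both possible starting pairs lead into the same search.\<close>

lemma pairs_reachable:
  assumes start: "Q {Fin 3, Fin 4} \<or> Q {Fin 0, Fin 1}"
    and step: "\<And>D. Q D \<Longrightarrow> Q (cyc1 ` D)" "\<And>D. Q D \<Longrightarrow> Q (cyc2 ` D)"
    and ab: "a \<in> P1F5" "b \<in> P1F5" "a \<noteq> b"
  shows "Q {a, b}"
proof -
  have s1: "Q {x, y} \<Longrightarrow> Q {cyc1 x, cyc1 y}" for x y using step(1)[of "{x, y}"] by simp
  have s2: "Q {x, y} \<Longrightarrow> Q {cyc2 x, cyc2 y}" for x y using step(2)[of "{x, y}"] by simp
  have p34: "Q {Fin 3, Fin 4}"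
    using start
  proof
    assume "Q {Fin 0, Fin 1}"
    from s2[OF s2[OF s1[OF s1[OF this]]]] show ?thesis by (simp add: insert_commute)
  qed
  \<comment> \<open>Each fact is named after the pair it reaches, with \<open>i\<close> for
    infinity: \<open>i4\<close> is {infinity, 4} and \<open>e42\<close> is {4, 2}.\<close>
  note i4 = s2[OF p34, simplified] note e42 = s1[OF i4, simplified] note i2 = s2[OF i4, simplified]
  note e41 = s1[OF e42, simplified] note i3 = s2[OF e42, simplified]
  note e12 = s1[OF i2, simplified] note e23 = s2[OF i2, simplified]
  note e04 = s1[OF e41, simplified] note i1 = s2[OF e41, simplified]
  note e01 = s1[OF e12, simplified] note e13 = s2[OF e12, simplified]
  note i0 = s2[OF e04, simplified] note e02 = s1[OF i1, simplified] note e03 = s1[OF e13, simplified]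
  note all = p34 i4 e42 i2 e41 i3 e12 e23 e04 i1 e01 e13 i0 e02 e03
  have "Q {a, b} \<or> Q {b, a}"
    using ab unfolding P1F5_eq by (elim insertE emptyE) (simp_all add: all all[unfolded insert_commute[of _ _ "{}"]])
  then show ?thesis by (simp add: insert_commute)
qed

section \<open>The graph with seven vertices\<close>

lemma theta7_simps:
  "verts theta7 = {Center, Infty, Fin 0, Fin 1, Fin 2, Fin 3, Fin 4}" "tail theta7 = fst" "head theta7 = snd"
  "arcs theta7 = {(Infty, Fin 0), (Fin 0, Fin 1), (Fin 1, Fin 2), (Fin 2, Fin 3), (Fin 3, Fin 4),
     (Fin 4, Infty), (Infty, Center), (Center, Fin 2), (Fin 0, Infty), (Fin 1, Fin 0), (Fin 2, Fin 1),
     (Fin 3, Fin 2), (Fin 4, Fin 3), (Infty, Fin 4), (Center, Infty), (Fin 2, Center)}"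
  by (auto simp: theta7_def graph_of_def P1F5_eq)

lemma verts_theta7_Diff: "verts theta7 - {Center} = P1F5"
  by (auto simp: theta7_simps P1F5_eq)

lemma edge_rev_theta7: "(a, b) \<in> arcs theta7 \<Longrightarrow> edge_rev theta7 (a, b) = (b, a)"
  by (simp add: edge_rev_def)

text \<open>
  The permutation of the walk from \<open>Center\<close> to \<open>v\<close> in the spanning tree that omits \<open>{1, 2}\<close> and
  \<open>{2, 3}\<close>. It also serves as the labelling \<open>\<beta> v\<close>.
\<close>

definition theta7_tree :: "theta7_vertex \<Rightarrow> theta7_vertex \<Rightarrow> theta7_vertex" where
  "theta7_tree v =
    (if v = Infty then transpose Center Infty
     else if v = Fin 0 then transpose Infty (Fin 0) \<circ> transpose Center Infty
     else if v = Fin 1 then transpose (Fin 0) (Fin 1) \<circ> (transpose Infty (Fin 0) \<circ> transpose Center Infty)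
     else if v = Fin 4 then transpose Infty (Fin 4) \<circ> transpose Center Infty
     else if v = Fin 3 then transpose (Fin 4) (Fin 3) \<circ> (transpose Infty (Fin 4) \<circ> transpose Center Infty)
     else if v = Fin 2 then transpose Center (Fin 2)
     else id)"

lemma theta7_tree_permutes: "theta7_tree v permutes verts theta7"
  unfolding theta7_tree_def theta7_simps
  by (auto intro!: permutes_compose permutes_swap_id permutes_id)

lemma theta7_tree_Center:
  "v \<in> verts theta7 \<Longrightarrow> theta7_tree v Center = v"
  by (auto simp: theta7_simps theta7_tree_def transpose_def)

lemma theta7_tree_image:
  assumes "v \<in> verts theta7"
  shows "theta7_tree v ` P1F5 = verts theta7 - {v}"
  using permutes_image_Diff[OF theta7_tree_permutes theta7_tree_Center[OF assms]]
  unfolding verts_theta7_Diff .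

text \<open>Permutations of the fundamental cycles of the tree. The inverses of the 4-cycles are
  written as cubes, so closure under composition places them in \<open>PGL25\<close>.\<close>

definition arc_cycle7 :: "theta7_vertex \<Rightarrow> theta7_vertex \<Rightarrow> theta7_vertex \<Rightarrow> theta7_vertex" where
  "arc_cycle7 a b = (if (a, b) = (Fin 1, Fin 2) then cyc1
     else if (a, b) = (Fin 2, Fin 1) then cyc1 \<circ> (cyc1 \<circ> cyc1)
     else if (a, b) = (Fin 3, Fin 2) then cyc2
     else if (a, b) = (Fin 2, Fin 3) then cyc2 \<circ> (cyc2 \<circ> cyc2) else id)"

lemma arc_cycle7_PGL25: "arc_cycle7 a b \<in> PGL25"
  by (simp add: arc_cycle7_def PGL25_id cyc12_PGL25 PGL25_comp)

lemma cyc12_permutes_verts: "cyc1 permutes verts theta7" "cyc2 permutes verts theta7"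
  using cyc12_permutes permutes_subset[of _ P1F5 "verts theta7"] by (auto simp: verts_theta7_Diff[symmetric])

lemma theta7_tree_arc:
  assumes "(a, b) \<in> arcs theta7"
  shows "transpose a b \<circ> theta7_tree a = theta7_tree b \<circ> arc_cycle7 a b"
proof (rule permutes_eqI)
  have "a \<in> verts theta7" "b \<in> verts theta7" using assms by (auto simp: theta7_simps)
  then show "transpose a b \<circ> theta7_tree a permutes verts theta7"
    by (intro permutes_compose permutes_swap_id theta7_tree_permutes)
  have "arc_cycle7 a b permutes verts theta7"
    unfolding arc_cycle7_def by (simp add: cyc12_permutes_verts permutes_compose permutes_id)
  then show "theta7_tree b \<circ> arc_cycle7 a b permutes verts theta7"
    by (intro permutes_compose theta7_tree_permutes)
  fix z assume "z \<in> verts theta7"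
  with assms show "(transpose a b \<circ> theta7_tree a) z = (theta7_tree b \<circ> arc_cycle7 a b) z"
    unfolding theta7_simps
    by (elim insertE emptyE Pair_inject; hypsubst)
      (simp_all add: theta7_tree_def arc_cycle7_def transpose_def)
qed

section \<open>Loops and attained sums at \<open>Center\<close>\<close>

locale theta7_twist =
  fixes m :: nat and \<gamma> :: "theta7_vertex \<times> theta7_vertex \<Rightarrow> int"
  assumes pos: "m \<ge> 1" and one_chain: "\<gamma> \<in> one_chains m theta7 (edge_rev theta7)"

sublocale theta7_twist \<subseteq> twisted_digraph theta7 "edge_rev theta7" m \<gamma>
proof -
  interpret bidirected_digraph theta7 "edge_rev theta7" by (rule bidirected_theta7)
  show "twisted_digraph theta7 (edge_rev theta7) m \<gamma>"
    using pos one_chain by unfold_locales (auto simp: theta7_simps)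
qed

sublocale theta7_twist \<subseteq> line: twisted_perms m P1F5 "solv Center"
  using solv_twisted_perms[of Center] unfolding verts_theta7_Diff by (simp add: theta7_simps)

context theta7_twist
begin

definition \<gamma>1 :: int where
  "\<gamma>1 = \<gamma> (Center, Infty) + \<gamma> (Infty, Fin 0) + \<gamma> (Fin 0, Fin 1) + \<gamma> (Fin 1, Fin 2) + \<gamma> (Fin 2, Center)"

definition \<gamma>2 :: int where
  "\<gamma>2 = \<gamma> (Center, Infty) + \<gamma> (Infty, Fin 4) + \<gamma> (Fin 4, Fin 3) + \<gamma> (Fin 3, Fin 2) + \<gamma> (Fin 2, Center)"

lemma loop1:
  obtains x where "(x, cyc1) \<in> solv Center" "x (Fin 3) = 0" "x (Fin 4) = 0" "[sum x P1F5 = \<gamma>1] (mod int m)"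
proof -
  let ?p = "[(Center, Infty), (Infty, Fin 0), (Fin 0, Fin 1), (Fin 1, Fin 2), (Fin 2, Center)]"
  have w: "awalk Center ?p Center" by (simp add: awalk_simps theta7_simps)
  obtain x \<sigma> where wp: "wp ?p = (x, \<sigma>)" by fastforce
  \<comment> \<open>The beginning of the loop is the tree walk to \<open>Fin 0\<close>; moving the
    tree permutation across the remaining arcs leaves only the factor of the single arc outside the
    tree.\<close>
  have "snd (wp ?p) = transpose (Fin 2) Center \<circ> (transpose (Fin 1) (Fin 2) \<circ>
      (transpose (Fin 0) (Fin 1) \<circ> theta7_tree (Fin 0)))"
    by (simp add: snd_gen_sym_mult arc_pair_def theta7_simps gen_sym_one theta7_tree_def o_assoc)
  also have "\<dots> = cyc1"
    using theta7_tree_arc[of "Fin 0" "Fin 1"] theta7_tree_arc[of "Fin 1" "Fin 2"] theta7_tree_arc[of "Fin 2" Center]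
    by (simp add: theta7_simps arc_cycle7_def o_assoc) (simp add: theta7_tree_def o_assoc[symmetric])
  finally have \<sigma>: "\<sigma> = cyc1" using wp by simp
  have "x (Fin 3) = 0 \<and> \<sigma> (Fin 3) = Fin 3" "x (Fin 4) = 0 \<and> \<sigma> (Fin 4) = Fin 4"
    by (rule wp_avoid[OF awalk_arcs[OF w] _ wp]; auto simp: theta7_simps)+
  moreover have "[sum x P1F5 = \<gamma>1] (mod int m)"
    using sum_solv[OF w wp] unfolding verts_theta7_Diff by (simp add: \<gamma>1_def add.assoc)
  ultimately show thesis using that[of x] solvI[OF w] wp \<sigma> by simp
qed

lemma loop2:
  obtains x where "(x, cyc2) \<in> solv Center" "x (Fin 0) = 0" "x (Fin 1) = 0" "[sum x P1F5 = \<gamma>2] (mod int m)"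
proof -
  let ?p = "[(Center, Infty), (Infty, Fin 4), (Fin 4, Fin 3), (Fin 3, Fin 2), (Fin 2, Center)]"
  have w: "awalk Center ?p Center" by (simp add: awalk_simps theta7_simps)
  obtain x \<sigma> where wp: "wp ?p = (x, \<sigma>)" by fastforce
  have "snd (wp ?p) = transpose (Fin 2) Center \<circ> (transpose (Fin 3) (Fin 2) \<circ>
      (transpose (Fin 4) (Fin 3) \<circ> theta7_tree (Fin 4)))"
    by (simp add: snd_gen_sym_mult arc_pair_def theta7_simps gen_sym_one theta7_tree_def o_assoc)
  also have "\<dots> = cyc2"
    using theta7_tree_arc[of "Fin 4" "Fin 3"] theta7_tree_arc[of "Fin 3" "Fin 2"] theta7_tree_arc[of "Fin 2" Center]
    by (simp add: theta7_simps arc_cycle7_def o_assoc) (simp add: theta7_tree_def o_assoc[symmetric])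
  finally have \<sigma>: "\<sigma> = cyc2" using wp by simp
  have "x (Fin 0) = 0 \<and> \<sigma> (Fin 0) = Fin 0" "x (Fin 1) = 0 \<and> \<sigma> (Fin 1) = Fin 1"
    by (rule wp_avoid[OF awalk_arcs[OF w] _ wp]; auto simp: theta7_simps)+
  moreover have "[sum x P1F5 = \<gamma>2] (mod int m)"
    using sum_solv[OF w wp] unfolding verts_theta7_Diff by (simp add: \<gamma>2_def add.assoc)
  ultimately show thesis using that[of x] solvI[OF w] wp \<sigma> by simp
qed

lemma attained_cyc: "line.attained \<gamma>1 cyc1" "line.attained \<gamma>2 cyc2"
  by (rule loop1, rule line.attainedI, assumption+) (rule loop2, rule line.attainedI, assumption+)

lemma attained_PGL25:
  assumes "\<sigma> \<in> PGL25"
  shows "\<exists>s. line.attained s \<sigma>"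
proof (rule PGL25_generated[where H = "\<lambda>\<sigma>. \<exists>s. line.attained s \<sigma>", OF _ _ _ _ assms])
  show "\<exists>s. line.attained s id" using line.attained_zero by blast
  show "\<exists>s. line.attained s (f \<circ> g)" if "\<exists>s. line.attained s f" "\<exists>s. line.attained s g" for f g
    using that line.attained_mult by blast
qed (use attained_cyc in blast)+

lemma id_on_P1F5I:
  assumes "f permutes P1F5" "f Infty = Infty" "f (Fin 0) = Fin 0" "f (Fin 1) = Fin 1"
    "f (Fin 2) = Fin 2" "f (Fin 3) = Fin 3" "f (Fin 4) = Fin 4"
  shows "f = id"
  by (rule permutes_eqI[OF assms(1) permutes_id]) (use assms in \<open>auto simp: P1F5_eq\<close>)

lemma cyc12_fourth: "cyc1 ^^ 4 = id" "cyc2 ^^ 4 = id"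
proof -
  have "cyc1 ^^ 4 = cyc1 \<circ> (cyc1 \<circ> (cyc1 \<circ> cyc1))" "cyc2 ^^ 4 = cyc2 \<circ> (cyc2 \<circ> (cyc2 \<circ> cyc2))"
    by (simp_all add: eval_nat_numeral o_assoc)
  moreover have "cyc1 \<circ> (cyc1 \<circ> (cyc1 \<circ> cyc1)) = id" "cyc2 \<circ> (cyc2 \<circ> (cyc2 \<circ> cyc2)) = id"
    by (rule id_on_P1F5I; (intro permutes_compose cyc12_permutes)?; simp)+
  ultimately show "cyc1 ^^ 4 = id" "cyc2 ^^ 4 = id" by simp_all
qed

lemma inv_cyc1_simps [simp]:
  "inv_into UNIV cyc1 (Fin 2) = Infty" "inv_into UNIV cyc1 Infty = Fin 0" "inv_into UNIV cyc1 (Fin 0) = Fin 1"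
  "inv_into UNIV cyc1 (Fin 1) = Fin 2" "inv_into UNIV cyc1 (Fin 3) = Fin 3" "inv_into UNIV cyc1 (Fin 4) = Fin 4"
  by (rule inv_f_eq[OF permutes_inj[OF cyc12_permutes(1)]]; simp)+

lemma inv_cyc2_simps [simp]:
  "inv_into UNIV cyc2 (Fin 2) = Infty" "inv_into UNIV cyc2 Infty = Fin 4" "inv_into UNIV cyc2 (Fin 4) = Fin 3"
  "inv_into UNIV cyc2 (Fin 3) = Fin 2" "inv_into UNIV cyc2 (Fin 0) = Fin 0" "inv_into UNIV cyc2 (Fin 1) = Fin 1"
  by (rule inv_f_eq[OF permutes_inj[OF cyc12_permutes(2)]]; simp)+

text \<open>The fourth power of a loop sums the vector along orbits; off the six points the vector
  vanishes.\<close>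

lemma punctured_cycle:
  assumes x: "(x, \<sigma>) \<in> solv Center" and \<sigma>: "\<sigma> ^^ 4 = id"
    and val: "\<And>w. w \<in> P1F5 \<Longrightarrow> (\<Sum>i<4. x ((inv_into UNIV \<sigma> ^^ i) w)) = of_bool (w \<notin> D) * sum x P1F5"
    and s: "[sum x P1F5 = k] (mod int m)"
  shows "line.punctured k D \<in> line.shifts"
proof (rule line.shifts_cong[OF line.shifts_cycle[OF x \<sigma>]])
  fix w
  show "[(\<Sum>i<4. x ((inv_into UNIV \<sigma> ^^ i) w)) = k * of_bool (w \<in> P1F5 - D)] (mod int m)"
  proof (cases "w \<in> P1F5")
    case True
    then show ?thesis using val[OF True] s by (cases "w \<in> D") simp_all
  next
    case False
    have c: "\<sigma> permutes P1F5" "\<And>w. w \<notin> P1F5 \<Longrightarrow> x w = 0"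
      using line.P_carrier[OF x] by (simp_all add: gen_sym_carrier_iff)
    have "(inv_into UNIV \<sigma> ^^ i) w = w" for i
      by (induction i) (simp_all add: inv_permutes_not_in[OF c(1) False])
    then show ?thesis using False c(2) by simp
  qed
qed

lemma punctured_1: "line.punctured \<gamma>1 {Fin 3, Fin 4} \<in> line.shifts"
proof (rule loop1)
  fix x assume x: "(x, cyc1) \<in> solv Center" "x (Fin 3) = 0" "x (Fin 4) = 0" "[sum x P1F5 = \<gamma>1] (mod int m)"
  show ?thesis
  proof (rule punctured_cycle[OF x(1) cyc12_fourth(1) _ x(4)])
    fix w assume "w \<in> P1F5"
    then show "(\<Sum>i<4. x ((inv_into UNIV cyc1 ^^ i) w)) = of_bool (w \<notin> {Fin 3, Fin 4}) * sum x P1F5"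
      unfolding P1F5_eq using x(2,3)
      by (elim insertE emptyE) (simp_all add: eval_nat_numeral)
  qed
qed

lemma punctured_2: "line.punctured \<gamma>2 {Fin 0, Fin 1} \<in> line.shifts"
proof (rule loop2)
  fix x assume x: "(x, cyc2) \<in> solv Center" "x (Fin 0) = 0" "x (Fin 1) = 0" "[sum x P1F5 = \<gamma>2] (mod int m)"
  show ?thesis
  proof (rule punctured_cycle[OF x(1) cyc12_fourth(2) _ x(4)])
    fix w assume "w \<in> P1F5"
    then show "(\<Sum>i<4. x ((inv_into UNIV cyc2 ^^ i) w)) = of_bool (w \<notin> {Fin 0, Fin 1}) * sum x P1F5"
      unfolding P1F5_eq using x(2,3)
      by (elim insertE emptyE) (simp_all add: eval_nat_numeral)
  qed
qed

lemma punctured_pairs: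
  assumes "line.punctured k {Fin 3, Fin 4} \<in> line.shifts \<or> line.punctured k {Fin 0, Fin 1} \<in> line.shifts"
    "a \<in> P1F5" "b \<in> P1F5" "a \<noteq> b"
  shows "line.punctured k {a, b} \<in> line.shifts"
  by (rule pairs_reachable[where Q = "\<lambda>D. line.punctured k D \<in> line.shifts", OF assms(1) _ _ assms(2-4)])
    (rule line.punctured_perm[OF _ attained_cyc(1)] line.punctured_perm[OF _ attained_cyc(2)]; assumption)+

lemma punctured_basis:
  assumes "line.punctured k {Fin 3, Fin 4} \<in> line.shifts \<or> line.punctured k {Fin 0, Fin 1} \<in> line.shifts"
    "i \<in> P1F5" "j \<in> P1F5"
  shows "(\<lambda>w. k * (of_bool (w = i) - of_bool (w = j))) \<in> line.shifts"
proof -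
  \<comment> \<open>Two tokens are missed here, so a third point \<open>l\<close> is kept common to
    both missing pairs.\<close>
  have "\<exists>l\<in>P1F5. l \<noteq> i \<and> l \<noteq> j"
    using assms(2,3) unfolding P1F5_eq by (elim insertE emptyE) simp_all
  then obtain l where "l \<in> P1F5" "l \<noteq> i" "l \<noteq> j" by blast
  then show ?thesis
    using assms punctured_pairs[OF assms(1)] by (intro line.punctured_diff[where E = "{l}"]) auto
qed

lemma basis:
  assumes "[\<gamma>1 * s + \<gamma>2 * t = 1] (mod int m)" "i \<in> P1F5" "j \<in> P1F5"
  shows "(\<lambda>w. of_bool (w = i) - of_bool (w = j)) \<in> line.shifts"
  by (rule line.shifts_combination[OF punctured_basis[OF disjI1[OF punctured_1] assms(2,3)]
        punctured_basis[OF disjI2[OF punctured_2] assms(2,3)] assms(1)])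

text \<open>The relations that both fourth powers, \<open>?T\<close> to the fifth and
  \<open>?J\<close> squared are trivial give the sums 4b, 4c, 15b + 5c and 4b + 10c for b =
  \<open>\<gamma>1\<close> and c = \<open>\<gamma>2\<close>. Integer combinations yield 2c, c - b
  and 2b, and Bezout turns 2b and 2c into 2.\<close>

lemma attained_two:
  assumes "[\<gamma>1 * s + \<gamma>2 * t = 1] (mod int m)"
  shows "line.attained 2 id" "line.attained (\<gamma>2 - \<gamma>1) id"
proof -
  note mult = line.attained_mult
  note c1 = attained_cyc(1) and c2 = attained_cyc(2)
  have f: "line.attained (4 * \<gamma>1) id" "line.attained (4 * \<gamma>2) id"
    using line.attained_funpow[OF c1, of 4] line.attained_funpow[OF c2, of 4] by (simp_all add: cyc12_fourth)
  \<comment> \<open>\<open>T\<close> is \<open>z + 1\<close>, of order 5, and \<open>J\<close> is the odd involution \<open>2 / z\<close>.\<close>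
  let ?T = "cyc1 \<circ> (cyc1 \<circ> (cyc1 \<circ> cyc2))" and ?J = "cyc2 \<circ> (cyc1 \<circ> (cyc2 \<circ> (cyc2 \<circ> (cyc2 \<circ> (cyc1 \<circ> cyc2)))))"
  have T: "line.attained (\<gamma>1 + (\<gamma>1 + (\<gamma>1 + \<gamma>2))) ?T" by (intro mult c1 c2)
  have J: "line.attained (\<gamma>2 + (\<gamma>1 + (\<gamma>2 + (\<gamma>2 + (\<gamma>2 + (\<gamma>1 + \<gamma>2)))))) ?J" by (intro mult c1 c2)
  have perm: "?T permutes P1F5" "?J permutes P1F5" by (intro permutes_compose cyc12_permutes)+
  have "?T \<circ> (?T \<circ> (?T \<circ> (?T \<circ> ?T))) = id"
    by (rule id_on_P1F5I, (intro permutes_compose perm(1))) simp_all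
  with mult[OF T mult[OF T mult[OF T mult[OF T T]]]]
  have T5: "line.attained (15 * \<gamma>1 + 5 * \<gamma>2) id" by (simp add: algebra_simps)
  have "?J \<circ> ?J = id"
    by (rule id_on_P1F5I, (intro permutes_compose perm(2))) simp_all
  with mult[OF J J] have J2: "line.attained (4 * \<gamma>1 + 10 * \<gamma>2) id" by (simp add: algebra_simps)
  have g2: "line.attained (2 * \<gamma>2) id"
    using line.attained_id_mult[OF J2 line.attained_linear[OF f, of "-1" "-2"]] by simp
  show d: "line.attained (\<gamma>2 - \<gamma>1) id"
    using line.attained_id_mult[OF T5 line.attained_linear[OF f, of "-4" "-1"]] by simp
  have g1: "line.attained (2 * \<gamma>1) id"
    using line.attained_linear[OF g2 d, of 1 "-2"] by simp
  have "[s * (2 * \<gamma>1) + t * (2 * \<gamma>2) = 2] (mod int m)"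
    using cong_scalar_left[OF assms, of 2] by (simp add: algebra_simps)
  then show "line.attained 2 id"
    by (rule line.attained_cong[OF line.attained_linear[OF g1 g2]])
qed

end

lemma PGL25_on_iff:
  assumes "bij \<tau>" "\<tau> ` P1F5 = X" "\<sigma> permutes X"
  shows "\<sigma> \<in> PGL25_on \<tau> X \<longleftrightarrow> inv_into UNIV \<tau> \<circ> \<sigma> \<circ> \<tau> \<in> PGL25"
proof -
  have i1: "\<tau> (inv_into UNIV \<tau> w) = w" for w using assms(1) by (simp add: bij_is_surj surj_f_inv_f)
  have i2: "inv_into UNIV \<tau> (\<tau> w) = w" for w using assms(1) by (simp add: bij_is_inj)
  show ?thesis
  proof
    assume "\<sigma> \<in> PGL25_on \<tau> X"
    then obtain g where g: "g \<in> PGL25" "\<forall>z\<in>P1F5. \<sigma> (\<tau> z) = \<tau> (g z)"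
      unfolding PGL25_on_def by blast
    have "inv_into UNIV \<tau> \<circ> \<sigma> \<circ> \<tau> = g"
      by (rule permutes_eqI[OF inv_conj_permutes[OF assms(3,1,2)] PGL25_permutes[OF g(1)]])
        (simp add: g(2) i2)
    then show "inv_into UNIV \<tau> \<circ> \<sigma> \<circ> \<tau> \<in> PGL25" using g(1) by simp
  next
    assume "inv_into UNIV \<tau> \<circ> \<sigma> \<circ> \<tau> \<in> PGL25"
    then show "\<sigma> \<in> PGL25_on \<tau> X"
      unfolding PGL25_on_def using assms(3) i1
      by (intro CollectI conjI bexI[of _ "inv_into UNIV \<tau> \<circ> \<sigma> \<circ> \<tau>"]) simp_all
  qed
qed

section \<open>Necessary conditions, parity and the criterion at \<open>Center\<close>\<close>

context theta7_twist
begin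

lemma walk_PGL25:
  assumes "awalk u p Center"
  shows "snd (wp p) \<circ> theta7_tree u \<in> PGL25"
proof (rule walk_invariant[OF assms, where I = "\<lambda>u s \<sigma>. \<sigma> \<circ> theta7_tree u \<in> PGL25"])
  show "id \<circ> theta7_tree Center \<in> PGL25" by (simp add: theta7_tree_def PGL25_id)
next
  fix e s \<sigma>
  assume e: "e \<in> arcs theta7" and I: "\<sigma> \<circ> theta7_tree (head theta7 e) \<in> PGL25"
  have "(fst e, snd e) \<in> arcs theta7" using e by simp
  note arc = theta7_tree_arc[OF this]
  have "\<sigma> \<circ> transpose (fst e) (snd e) \<circ> theta7_tree (fst e)
      = (\<sigma> \<circ> theta7_tree (snd e)) \<circ> arc_cycle7 (fst e) (snd e)"
    by (simp only: o_assoc[symmetric] arc)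
  moreover have "(\<sigma> \<circ> theta7_tree (snd e)) \<circ> arc_cycle7 (fst e) (snd e) \<in> PGL25"
    using PGL25_comp[OF I arc_cycle7_PGL25] by (simp only: theta7_simps)
  ultimately show "\<sigma> \<circ> transpose (tail theta7 e) (head theta7 e) \<circ> theta7_tree (tail theta7 e) \<in> PGL25"
    by (simp only: theta7_simps)
qed

abbreviation bipartite :: bool where
  "bipartite \<equiv> twist_bipartite m theta7 \<gamma>"

text \<open>Every arc flips the sign of the permutation, and the color changes exactly along arcs
  with even \<open>\<gamma>\<close>. So agreement of the two parities flips together with the color,
  and a closed walk returns to its color.\<close>

lemma walk_parity:
  assumes "awalk Center p Center" bipartite
  shows "even (\<Sum>f\<leftarrow>p. \<gamma> f) \<longleftrightarrow> evenperm (snd (wp p))"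
proof -
  obtain col :: "theta7_vertex \<Rightarrow> bool" where col: "\<forall>e\<in>arcs theta7.
        (even (\<gamma> e) \<longrightarrow> col (tail theta7 e) \<noteq> col (head theta7 e)) \<and>
        (odd (\<gamma> e) \<longrightarrow> col (tail theta7 e) = col (head theta7 e))"
    using assms(2) unfolding twist_bipartite_def by blast
  have "permutation (snd (wp p)) \<and>
    ((even (\<Sum>f\<leftarrow>p. \<gamma> f) = evenperm (snd (wp p))) = (col Center = col Center))"
  proof (rule walk_invariant[OF assms(1), where I = "\<lambda>u s \<sigma>. permutation \<sigma> \<and>
      ((even s = evenperm \<sigma>) = (col u = col Center))"])
    show "permutation id \<and> (even (0::int) = evenperm id) = (col Center = col Center)" by simp
  next
    fix e and s :: int and \<sigma> :: "theta7_vertex \<Rightarrow> theta7_vertex"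
    assume e: "e \<in> arcs theta7" and I: "permutation \<sigma> \<and>
      ((even s = evenperm \<sigma>) = (col (head theta7 e) = col Center))"
    let ?t = "transpose (tail theta7 e) (head theta7 e)"
    have "permutation (\<sigma> \<circ> ?t)" using I by (simp add: permutation_compose permutation_swap_id)
    moreover have "evenperm (\<sigma> \<circ> ?t) = (\<not> evenperm \<sigma>)"
      using I no_loop[OF e] by (simp add: evenperm_comp permutation_swap_id evenperm_swap)
    moreover have "even (\<gamma> e) = (col (tail theta7 e) \<noteq> col (head theta7 e))" using bspec[OF col e] by blast
    ultimately show "permutation (\<sigma> \<circ> ?t) \<and>
      ((even (s + \<gamma> e) = evenperm (\<sigma> \<circ> ?t)) = (col (tail theta7 e) = col Center))"
      using I by (simp only: even_add) argo
  qed
  then show ?thesis by simp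
qed

lemma even_cong: "[a = b] (mod 2) \<Longrightarrow> even a = even (b::int)"
  by (simp add: cong_def even_iff_mod_2_eq_zero)

lemma cong_even_m:
  assumes "even m" "[a = b] (mod int m)"
  shows "even a = even b"
proof -
  have "int 2 dvd int m" using assms(1) by (simp only: int_dvd_int_iff)
  then show ?thesis using cong_dvd_modulus[OF assms(2)] even_cong by simp
qed

lemma solv_center_necessary:
  assumes "(x, \<sigma>) \<in> solv Center"
  shows "\<sigma> \<in> PGL25" "bipartite \<Longrightarrow> even (sum x P1F5) = evenperm \<sigma>"
proof -
  obtain p where p: "awalk Center p Center" "wp p = (x, \<sigma>)"
    using assms by (auto simp: solvable_pairs_def)
  show "\<sigma> \<in> PGL25" using walk_PGL25[OF p(1)] p(2) by (simp add: theta7_tree_def)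
  assume b: bipartite
  then have "even m" by (simp add: twist_bipartite_def)
  from cong_even_m[OF this sum_solv[OF p]] show "even (sum x P1F5) = evenperm \<sigma>"
    using walk_parity[OF p(1) b] p(2) unfolding verts_theta7_Diff by simp
qed

lemma gamma_rev7: "(a, b) \<in> arcs theta7 \<Longrightarrow> [\<gamma> (b, a) = - \<gamma> (a, b)] (mod int m)"
  using gamma_rev_cong[of "(a, b)"] edge_rev_theta7 by simp

lemma gamma_rev_even: "even m \<Longrightarrow> (a, b) \<in> arcs theta7 \<Longrightarrow> even (\<gamma> (b, a)) = even (\<gamma> (a, b))"
  using cong_even_m[OF _ gamma_rev7] by simp

text \<open>Coloring along the tree is always possible. It closes up on a cycle iff the number of
  arcs with even \<open>\<gamma>\<close> is even, which for a cycle of length 5 means that the sum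
  is odd.\<close>

lemma bipartite_if_odd:
  assumes "even m" "odd \<gamma>1" "odd \<gamma>2"
  shows bipartite
proof -
  \<comment> \<open>\<open>Center\<close> is colored \<open>True\<close>, and each Boolean is the
    color forced by the tree arc leading to its vertex.\<close>
  define cI where "cI = odd (\<gamma> (Center, Infty))"
  define c0 where "c0 = (cI = odd (\<gamma> (Infty, Fin 0)))"
  define c1 where "c1 = (c0 = odd (\<gamma> (Fin 0, Fin 1)))"
  define c4 where "c4 = (cI = odd (\<gamma> (Infty, Fin 4)))"
  define c3 where "c3 = (c4 = odd (\<gamma> (Fin 4, Fin 3)))"
  define c2 where "c2 = odd (\<gamma> (Center, Fin 2))"
  define col where "col v = (if v = Center then True else if v = Infty then cI else if v = Fin 0 then c0
    else if v = Fin 1 then c1 else if v = Fin 2 then c2 else if v = Fin 3 then c3 else c4)" for v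
  have r: "even (\<gamma> (b, a)) = even (\<gamma> (a, b))" if "(a, b) \<in> arcs theta7" for a b
    using gamma_rev_even[OF assms(1) that] .
  have close: "even (\<gamma> (Fin 2, Center)) = even (\<gamma> (Center, Fin 2))"
    by (rule r) (simp add: theta7_simps)
  have e12: "odd (\<gamma> (Fin 1, Fin 2)) = (c1 = c2)"
    using assms(2) close unfolding \<gamma>1_def cI_def c0_def c1_def c2_def even_add by argo
  have e32: "odd (\<gamma> (Fin 3, Fin 2)) = (c3 = c2)"
    using assms(3) close unfolding \<gamma>2_def cI_def c4_def c3_def c2_def even_add by argo
  have "odd (\<gamma> (a, b)) = (col a = col b)"
    if "(a, b) \<in> {(Center, Infty), (Infty, Fin 0), (Fin 0, Fin 1), (Infty, Fin 4), (Fin 4, Fin 3),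
      (Center, Fin 2), (Fin 1, Fin 2), (Fin 3, Fin 2)}" for a b
    using that
    by (elim insertE emptyE Pair_inject; hypsubst)
      (simp_all only: col_def if_True if_False simp_thms theta7_vertex.distinct theta7_vertex.inject
        zero_neq_one one_neq_zero, auto simp: e12 e32 cI_def c0_def c1_def c4_def c3_def c2_def)
  moreover have "odd (\<gamma> (b, a)) = (col b = col a)" if "(a, b) \<in> arcs theta7" "odd (\<gamma> (a, b)) = (col a = col b)" for a b
    using r[OF that(1)] that(2) by auto
  moreover have "(a, b) \<in> {(Center, Infty), (Infty, Fin 0), (Fin 0, Fin 1), (Infty, Fin 4), (Fin 4, Fin 3),
      (Center, Fin 2), (Fin 1, Fin 2), (Fin 3, Fin 2)} \<or> (b, a) \<in> {(Center, Infty), (Infty, Fin 0),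
      (Fin 0, Fin 1), (Infty, Fin 4), (Fin 4, Fin 3), (Center, Fin 2), (Fin 1, Fin 2), (Fin 3, Fin 2)} \<and> (b, a) \<in> arcs theta7"
    if "(a, b) \<in> arcs theta7" for a b
    using that unfolding theta7_simps by (elim insertE emptyE Pair_inject; hypsubst) simp_all
  ultimately have col: "odd (\<gamma> (a, b)) = (col a = col b)" if "(a, b) \<in> arcs theta7" for a b
    using that by metis
  have "\<forall>e\<in>arcs theta7. (even (\<gamma> e) \<longrightarrow> col (tail theta7 e) \<noteq> col (head theta7 e)) \<and>
        (odd (\<gamma> e) \<longrightarrow> col (tail theta7 e) = col (head theta7 e))"
  proof
    fix e assume "e \<in> arcs theta7"
    then have "odd (\<gamma> e) = (col (fst e) = col (snd e))" using col[of "fst e" "snd e"] by simp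
    then show "(even (\<gamma> e) \<longrightarrow> col (tail theta7 e) \<noteq> col (head theta7 e)) \<and>
        (odd (\<gamma> e) \<longrightarrow> col (tail theta7 e) = col (head theta7 e))"
      unfolding theta7_simps by blast
  qed
  then show ?thesis unfolding twist_bipartite_def using assms(1) by blast
qed

text \<open>For even m the Bezout relation makes one cycle sum odd, and failure of bipartiteness
  prevents both from being odd; so the attained difference is odd and coprime to 2. For odd m, 2 is
  coprime to m.\<close>

lemma attained_one:
  assumes "[\<gamma>1 * s + \<gamma>2 * t = 1] (mod int m)" "\<not> bipartite"
  shows "line.attained 1 id"
proof (cases "even m")
  case False
  then have "coprime 2 (int m)" by simp
  then show ?thesis
    using line.attained_gcd[OF attained_two(1)[OF assms(1)] line.attained_mod] by simp
next
  case True
  have "odd (\<gamma>1 * s + \<gamma>2 * t)" using cong_even_m[OF True assms(1)] by simp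
  then have "odd \<gamma>1 \<or> odd \<gamma>2" by auto
  moreover have "\<not> (odd \<gamma>1 \<and> odd \<gamma>2)" using bipartite_if_odd[OF True] assms(2) by blast
  ultimately have "coprime 2 (\<gamma>2 - \<gamma>1)" by auto
  then show ?thesis
    using line.attained_gcd[OF attained_two[OF assms(1)]] by simp
qed

lemma mem_solv_center:
  assumes st: "[\<gamma>1 * s + \<gamma>2 * t = 1] (mod int m)"
    and x: "(x, \<sigma>) \<in> carrier (gen_sym m P1F5)"
  shows "(x, \<sigma>) \<in> solv Center \<longleftrightarrow> \<sigma> \<in> PGL25 \<and> (bipartite \<longrightarrow> even (sum x P1F5) = evenperm \<sigma>)"
proof
  assume r: "\<sigma> \<in> PGL25 \<and> (bipartite \<longrightarrow> even (sum x P1F5) = evenperm \<sigma>)"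
  obtain s0 y where y: "(y, \<sigma>) \<in> solv Center" "[sum y P1F5 = s0] (mod int m)"
    using attained_PGL25[of \<sigma>] r unfolding line.attained_def by blast
  have a: "line.attained (sum y P1F5) \<sigma>" using y(1) by (rule line.attainedI) simp
  have "line.attained (sum x P1F5) \<sigma>"
  proof (cases bipartite)
    case True
    have "even (sum y P1F5) = even (sum x P1F5)"
      using solv_center_necessary(2)[OF y(1) True] r True by blast
    then have "even (sum x P1F5 - sum y P1F5)" by simp
    then obtain k where "sum x P1F5 - sum y P1F5 = 2 * k" by (rule evenE)
    then have "sum y P1F5 + k * 2 = sum x P1F5" by simp
    then show ?thesis
      using line.attained_id_mult[OF a line.attained_scale[OF attained_two(1)[OF st], of k]] by simp
  next
    case False
    show ?thesis using line.attained_all[OF a attained_one[OF st False]] .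
  qed
  then show "(x, \<sigma>) \<in> solv Center"
    using line.mem_P_iff[OF basis[OF st] x] by blast
qed (use solv_center_necessary in blast)

text \<open>A cycle is determined by its flows from \<open>Infty\<close> to \<open>Fin 0\<close> and
  to \<open>Center\<close>; by conservation at \<open>Infty\<close> the flow to \<open>Fin 4\<close>
  is minus their sum, which becomes the coefficient of \<open>\<gamma>2\<close>.\<close>

lemma surj_combination:
  assumes "\<phi> m theta7 (edge_rev theta7) \<gamma> ` H1 m theta7 (edge_rev theta7) = {0..<int m}"
  obtains s t where "[\<gamma>1 * s + \<gamma>2 * t = 1] (mod int m)"
proof -
  have "1 mod int m \<in> {0..<int m}" using pos by simp
  then obtain \<omega> where \<omega>: "\<omega> \<in> H1 m theta7 (edge_rev theta7)"
    "\<phi> m theta7 (edge_rev theta7) \<gamma> \<omega> = 1 mod int m"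
    unfolding assms[symmetric] by (auto simp del: atLeastLessThan_iff)
  have ch: "\<omega> \<in> one_chains m theta7 (edge_rev theta7)" using \<omega>(1) by (simp add: H1_def)
  let ?A = "{(Infty, Fin 0), (Fin 0, Fin 1), (Fin 1, Fin 2), (Fin 2, Fin 3), (Fin 3, Fin 4),
     (Fin 4, Infty), (Infty, Center), (Center, Fin 2)}"
  have rv: "edge_rev theta7 ` ?A = {(Fin 0, Infty), (Fin 1, Fin 0), (Fin 2, Fin 1),
     (Fin 3, Fin 2), (Fin 4, Fin 3), (Infty, Fin 4), (Center, Infty), (Fin 2, Center)}"
    by (simp add: edge_rev_def theta7_simps)
  have "arcs theta7 = ?A \<union> edge_rev theta7 ` ?A"
    unfolding rv unfolding theta7_simps by (simp only: Un_insert_left Un_empty_left)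
  moreover have "?A \<inter> edge_rev theta7 ` ?A = {}"
    unfolding rv by simp
  ultimately have "\<phi> m theta7 (edge_rev theta7) \<gamma> \<omega> = (\<Sum>e\<in>?A. \<gamma> e * \<omega> e) mod int m"
    by (rule phi_oriented[OF _ _ ch])
  then have "[1 = (\<Sum>e\<in>?A. \<gamma> e * \<omega> e)] (mod int m)"
    using \<omega>(2) by (simp only: cong_def)
  then obtain h where h: "\<gamma> (Infty, Fin 0) * \<omega> (Infty, Fin 0) + \<gamma> (Fin 0, Fin 1) * \<omega> (Fin 0, Fin 1)
      + \<gamma> (Fin 1, Fin 2) * \<omega> (Fin 1, Fin 2) + \<gamma> (Fin 2, Fin 3) * \<omega> (Fin 2, Fin 3)
      + \<gamma> (Fin 3, Fin 4) * \<omega> (Fin 3, Fin 4) + \<gamma> (Fin 4, Infty) * \<omega> (Fin 4, Infty)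
      + \<gamma> (Infty, Center) * \<omega> (Infty, Center) + \<gamma> (Center, Fin 2) * \<omega> (Center, Fin 2) = 1 + int m * h"
    by (auto simp: cong_iff_lin add.assoc)
  have rev: "\<exists>k. \<eta> (b, a) = - \<eta> (a, b) + int m * k"
    if "\<eta> \<in> one_chains m theta7 (edge_rev theta7)" "(a, b) \<in> arcs theta7" for \<eta> a b
  proof -
    have "\<forall>e\<in>arcs theta7. \<eta> (edge_rev theta7 e) = (- \<eta> e) mod int m"
      using that(1) by (simp add: one_chains_def)
    from bspec[OF this that(2)] have "\<eta> (b, a) = (- \<eta> (a, b)) mod int m"
      by (simp only: edge_rev_theta7[OF that(2)])
    then have "[- \<eta> (a, b) = \<eta> (b, a)] (mod int m)" by (simp add: cong_def)
    then show ?thesis unfolding cong_iff_lin .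
  qed
  have ia: "in_arcs theta7 (Fin 0) = {(Infty, Fin 0), (Fin 1, Fin 0)}"
    "in_arcs theta7 (Fin 1) = {(Fin 0, Fin 1), (Fin 2, Fin 1)}"
    "in_arcs theta7 (Fin 3) = {(Fin 2, Fin 3), (Fin 4, Fin 3)}"
    "in_arcs theta7 (Fin 4) = {(Fin 3, Fin 4), (Infty, Fin 4)}"
    "in_arcs theta7 Center = {(Infty, Center), (Fin 2, Center)}"
    "in_arcs theta7 Infty = {(Fin 0, Infty), (Fin 4, Infty), (Center, Infty)}"
    by (auto simp: in_arcs_def theta7_simps)
  have flow: "\<exists>k. (\<Sum>e\<in>in_arcs theta7 w. \<omega> e) = int m * k" if "w \<in> verts theta7" for w
  proof -
    have "(\<Sum>e\<in>in_arcs theta7 w. \<omega> e) mod int m = 0" using \<omega>(1) that by (simp add: H1_def)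
    then show ?thesis unfolding mod_eq_0_iff_dvd dvd_def .
  qed
  obtain a1 where a1: "\<omega> (Infty, Fin 0) + \<omega> (Fin 1, Fin 0) = int m * a1"
    using flow[of "Fin 0"] by (auto simp: ia theta7_simps)
  obtain a2 where a2: "\<omega> (Fin 0, Fin 1) + \<omega> (Fin 2, Fin 1) = int m * a2"
    using flow[of "Fin 1"] by (auto simp: ia theta7_simps)
  obtain a3 where a3: "\<omega> (Fin 2, Fin 3) + \<omega> (Fin 4, Fin 3) = int m * a3"
    using flow[of "Fin 3"] by (auto simp: ia theta7_simps)
  obtain a4 where a4: "\<omega> (Fin 3, Fin 4) + \<omega> (Infty, Fin 4) = int m * a4"
    using flow[of "Fin 4"] by (auto simp: ia theta7_simps)
  obtain a5 where a5: "\<omega> (Infty, Center) + \<omega> (Fin 2, Center) = int m * a5"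
    using flow[of "Center"] by (auto simp: ia theta7_simps)
  obtain a6 where a6: "\<omega> (Fin 0, Infty) + (\<omega> (Fin 4, Infty) + \<omega> (Center, Infty)) = int m * a6"
    using flow[of "Infty"] by (auto simp: ia theta7_simps)
  obtain b1 where b1: "\<omega> (Fin 1, Fin 0) = - \<omega> (Fin 0, Fin 1) + int m * b1"
    using rev[OF ch, of "Fin 0" "Fin 1"] by (auto simp: theta7_simps)
  obtain b2 where b2: "\<omega> (Fin 2, Fin 1) = - \<omega> (Fin 1, Fin 2) + int m * b2"
    using rev[OF ch, of "Fin 1" "Fin 2"] by (auto simp: theta7_simps)
  obtain b3 where b3: "\<omega> (Fin 4, Fin 3) = - \<omega> (Fin 3, Fin 4) + int m * b3"
    using rev[OF ch, of "Fin 3" "Fin 4"] by (auto simp: theta7_simps)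
  obtain b4 where b4: "\<omega> (Infty, Fin 4) = - \<omega> (Fin 4, Infty) + int m * b4"
    using rev[OF ch, of "Fin 4" "Infty"] by (auto simp: theta7_simps)
  obtain b5 where b5: "\<omega> (Fin 2, Center) = - \<omega> (Center, Fin 2) + int m * b5"
    using rev[OF ch, of "Center" "Fin 2"] by (auto simp: theta7_simps)
  obtain b6 where b6: "\<omega> (Fin 0, Infty) = - \<omega> (Infty, Fin 0) + int m * b6"
    using rev[OF ch, of "Infty" "Fin 0"] by (auto simp: theta7_simps)
  obtain b7 where b7: "\<omega> (Center, Infty) = - \<omega> (Infty, Center) + int m * b7"
    using rev[OF ch, of "Infty" "Center"] by (auto simp: theta7_simps)
  obtain g1 where g1: "\<gamma> (Center, Infty) = - \<gamma> (Infty, Center) + int m * g1"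
    using rev[OF one_chain, of "Infty" "Center"] by (auto simp: theta7_simps)
  obtain g2 where g2: "\<gamma> (Fin 2, Center) = - \<gamma> (Center, Fin 2) + int m * g2"
    using rev[OF one_chain, of "Center" "Fin 2"] by (auto simp: theta7_simps)
  obtain g3 where g3: "\<gamma> (Infty, Fin 4) = - \<gamma> (Fin 4, Infty) + int m * g3"
    using rev[OF one_chain, of "Fin 4" "Infty"] by (auto simp: theta7_simps)
  obtain g4 where g4: "\<gamma> (Fin 4, Fin 3) = - \<gamma> (Fin 3, Fin 4) + int m * g4"
    using rev[OF one_chain, of "Fin 3" "Fin 4"] by (auto simp: theta7_simps)
  obtain g5 where g5: "\<gamma> (Fin 3, Fin 2) = - \<gamma> (Fin 2, Fin 3) + int m * g5"
    using rev[OF one_chain, of "Fin 2" "Fin 3"] by (auto simp: theta7_simps)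
  \<comment> \<open>The multiplier of m in the conservation law at \<open>Infty\<close>, after its
    three arcs have been reoriented.\<close>
  define c where "c = a6 - b6 - b7"
  have tr: "\<omega> (Fin 0, Fin 1) = \<omega> (Infty, Fin 0) + int m * (b1 - a1)"
    "\<omega> (Fin 1, Fin 2) = \<omega> (Infty, Fin 0) + int m * (b1 - a1 + (b2 - a2))"
    "\<omega> (Fin 4, Infty) = \<omega> (Infty, Fin 0) + \<omega> (Infty, Center) + int m * c"
    "\<omega> (Fin 3, Fin 4) = \<omega> (Infty, Fin 0) + \<omega> (Infty, Center) + int m * (c - (b4 - a4))"
    "\<omega> (Fin 2, Fin 3) = \<omega> (Infty, Fin 0) + \<omega> (Infty, Center) + int m * (c - (b4 - a4) - (b3 - a3))"
    "\<omega> (Center, Fin 2) = \<omega> (Infty, Center) + int m * (b5 - a5)"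
    unfolding c_def right_diff_distrib distrib_left
    using a1 a2 a3 a4 a5 a6 b1 b2 b3 b4 b5 b6 b7 by linarith+
  let ?z = "\<gamma> (Fin 0, Fin 1) * (b1 - a1) + \<gamma> (Fin 1, Fin 2) * (b1 - a1 + (b2 - a2))
    + \<gamma> (Fin 2, Fin 3) * (c - (b4 - a4) - (b3 - a3)) + \<gamma> (Fin 3, Fin 4) * (c - (b4 - a4)) + \<gamma> (Fin 4, Infty) * c
    + \<gamma> (Center, Fin 2) * (b5 - a5) - (g1 + g2) * \<omega> (Infty, Fin 0) + (g1 + g2 + g3 + g4 + g5) * (\<omega> (Infty, Fin 0) + \<omega> (Infty, Center))"
  have "\<gamma>1 * \<omega> (Infty, Fin 0) + \<gamma>2 * (- (\<omega> (Infty, Fin 0) + \<omega> (Infty, Center))) = (1 + int m * h) - int m * ?z"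
    unfolding h[symmetric] \<gamma>1_def \<gamma>2_def g1 g2 g3 g4 g5 tr
    by (simp add: algebra_simps)
  then have "\<gamma>1 * \<omega> (Infty, Fin 0) + \<gamma>2 * (- (\<omega> (Infty, Fin 0) + \<omega> (Infty, Center))) = 1 + int m * (h - ?z)"
    by (simp only: right_diff_distrib add_diff_eq)
  then have "[1 = \<gamma>1 * \<omega> (Infty, Fin 0) + \<gamma>2 * (- (\<omega> (Infty, Fin 0) + \<omega> (Infty, Center)))] (mod int m)"
    unfolding cong_iff_lin by (rule exI)
  then show thesis by (rule that[OF cong_sym])
qed

text \<open>The walk used for conjugation has a permutation that does not involve m or
  \<open>\<gamma>\<close>. This allows one labelling of the points to be fixed ahead of all twist
  data.\<close>

lemma theta7_tree_walk:
  assumes "v \<in> verts theta7"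
  shows "\<exists>q. awalk Center q v \<and> snd (wp q) = theta7_tree v"
proof -
  note simps = awalk_simps theta7_simps snd_gen_sym_mult arc_pair_def gen_sym_one theta7_tree_def o_assoc
  have "awalk Center [] Center \<and> snd (wp []) = theta7_tree Center"
    by (simp add: simps)
  moreover have "awalk Center [(Center, Infty)] Infty \<and> snd (wp [(Center, Infty)]) = theta7_tree Infty"
    by (simp add: simps)
  moreover have "awalk Center [(Center, Infty), (Infty, Fin 0)] (Fin 0) \<and> snd (wp [(Center, Infty), (Infty, Fin 0)]) = theta7_tree (Fin 0)"
    by (simp add: simps)
  moreover have "awalk Center [(Center, Infty), (Infty, Fin 0), (Fin 0, Fin 1)] (Fin 1) \<and> snd (wp [(Center, Infty), (Infty, Fin 0), (Fin 0, Fin 1)]) = theta7_tree (Fin 1)"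
    by (simp add: simps)
  moreover have "awalk Center [(Center, Fin 2)] (Fin 2) \<and> snd (wp [(Center, Fin 2)]) = theta7_tree (Fin 2)"
    by (simp add: simps)
  moreover have "awalk Center [(Center, Infty), (Infty, Fin 4), (Fin 4, Fin 3)] (Fin 3) \<and> snd (wp [(Center, Infty), (Infty, Fin 4), (Fin 4, Fin 3)]) = theta7_tree (Fin 3)"
    by (simp add: simps)
  moreover have "awalk Center [(Center, Infty), (Infty, Fin 4)] (Fin 4) \<and> snd (wp [(Center, Infty), (Infty, Fin 4)]) = theta7_tree (Fin 4)"
    by (simp add: simps)
  ultimately show ?thesis
    using assms unfolding theta7_simps by (elim insertE emptyE; hypsubst) (rule exI, assumption)+
qed

theorem theta7_solvable:
  assumes surj: "\<phi> m theta7 (edge_rev theta7) \<gamma> ` H1 m theta7 (edge_rev theta7) = {0..<int m}"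
    and v: "v \<in> verts theta7" and X: "X = verts theta7 - {v}"
  shows "solv v = {(x, \<sigma>). (x, \<sigma>) \<in> carrier (gen_sym m X) \<and> \<sigma> \<in> PGL25_on (theta7_tree v) X \<and>
    (bipartite \<longrightarrow> (\<Sum>w\<in>X. x w) mod 2 = (if evenperm \<sigma> then 0 else 1))}"
proof -
  obtain s t where st: "[\<gamma>1 * s + \<gamma>2 * t = 1] (mod int m)" by (rule surj_combination[OF surj])
  obtain q where q: "awalk Center q v" and tq: "snd (wp q) = theta7_tree v"
    using theta7_tree_walk[OF v] by blast
  obtain y \<tau> where wp: "wp q = (y, \<tau>)" by fastforce
  have tree: "theta7_tree v = \<tau>" using tq wp by simp
  note \<tau> = wp_end(3)[OF q wp]
  have bij: "bij \<tau>" using \<tau> by (rule permutes_bij)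
  have im: "\<tau> ` P1F5 = X" using theta7_tree_image[OF v] by (simp only: tree X)
  let ?\<Phi> = "\<lambda>\<sigma> s. \<sigma> \<in> PGL25 \<and> (bipartite \<longrightarrow> even s = evenperm \<sigma>)"
  have even_mod: "(bipartite \<longrightarrow> even (s mod int m) = b) \<longleftrightarrow> (bipartite \<longrightarrow> even s = b)" for s b
  proof -
    have "even (s mod int m) = even s" if bipartite
      using that by (intro cong_even_m) (simp_all add: twist_bipartite_def cong_def)
    then show ?thesis by blast
  qed
  have mem: "(x, \<sigma>) \<in> solv v \<longleftrightarrow> ?\<Phi> (inv_into UNIV \<tau> \<circ> \<sigma> \<circ> \<tau>) (sum x X mod int m)"
    if "(x, \<sigma>) \<in> carrier (gen_sym m X)" for x \<sigma>
    using q wp _ that unfolding X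
  proof (rule solv_transport)
    fix x \<sigma> assume "(x, \<sigma>) \<in> carrier (gen_sym m (verts theta7 - {Center}))"
    then show "(x, \<sigma>) \<in> solv Center \<longleftrightarrow> ?\<Phi> \<sigma> (sum x (verts theta7 - {Center}) mod int m)"
      unfolding verts_theta7_Diff even_mod by (rule mem_solv_center[OF st])
  qed
  have sub: "solv v \<subseteq> carrier (gen_sym m X)" unfolding X by (rule solv_carrier)
  have "(x, \<sigma>) \<in> solv v \<longleftrightarrow> \<sigma> \<in> PGL25_on \<tau> X \<and>
      (bipartite \<longrightarrow> sum x X mod 2 = (if evenperm \<sigma> then 0 else 1))"
    if c: "(x, \<sigma>) \<in> carrier (gen_sym m X)" for x \<sigma>
  proof -
    have p: "\<sigma> permutes X" using c by (simp add: gen_sym_carrier_iff)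
    have "finite X" using finite_verts X by simp
    then have "permutation \<sigma>" "permutation \<tau>"
      using p \<tau> finite_verts by (auto simp: permutation_permutes)
    then have ev: "evenperm (inv_into UNIV \<tau> \<circ> \<sigma> \<circ> \<tau>) = evenperm \<sigma>" by (rule evenperm_inv_conj)
    have "even (sum x X) = evenperm \<sigma> \<longleftrightarrow> sum x X mod 2 = (if evenperm \<sigma> then 0 else 1)"
      by (simp add: even_iff_mod_2_eq_zero)
    then show ?thesis
      unfolding mem[OF c] PGL25_on_iff[OF bij im p] even_mod ev by simp
  qed
  then show ?thesis unfolding tree using sub by blast
qed

end

theorem theorem3:
  shows
    "(\<forall>m \<gamma> v. m \<ge> 1 \<longrightarrow> \<gamma> \<in> one_chains m theta5 (edge_rev theta5) \<longrightarrow> v \<in> verts theta5 \<longrightarrow>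
        \<phi> m theta5 (edge_rev theta5) \<gamma> ` H1 m theta5 (edge_rev theta5) = {0..<int m} \<longrightarrow>
        (let X = verts theta5 - {v} in
          if 3 dvd m \<and> (\<Sum>e\<in>theta5_edges. \<gamma> e) mod 3 = 0
          then \<exists>\<iota> \<in> iso (alt X Mod klein X) (integer_mod_group 3).
                 solvable_pairs m theta5 \<gamma> v =
                   {(x, \<sigma>). (x, \<sigma>) \<in> carrier (gen_sym m X) \<and> \<sigma> \<in> carrier (alt X) \<and>
                      (\<Sum>w\<in>X. x w) mod 3 = \<iota> (klein X #>\<^bsub>alt X\<^esub> \<sigma>)}
          else solvable_pairs m theta5 \<gamma> v =
                 {(x, \<sigma>). (x, \<sigma>) \<in> carrier (gen_sym m X) \<and> \<sigma> \<in> carrier (alt X)})) \<and>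
     (\<exists>\<beta> :: theta7_vertex \<Rightarrow> theta7_vertex \<Rightarrow> theta7_vertex.
        (\<forall>v\<in>verts theta7. bij_betw (\<beta> v) P1F5 (verts theta7 - {v})) \<and>
        (\<forall>z\<in>P1F5. \<beta> Center z = z) \<and>
        (\<forall>m \<gamma> v. m \<ge> 1 \<longrightarrow> \<gamma> \<in> one_chains m theta7 (edge_rev theta7) \<longrightarrow> v \<in> verts theta7 \<longrightarrow>
          \<phi> m theta7 (edge_rev theta7) \<gamma> ` H1 m theta7 (edge_rev theta7) = {0..<int m} \<longrightarrow>
          (let X = verts theta7 - {v} in
            if even m \<and> twist_bipartite m theta7 \<gamma>
            then solvable_pairs m theta7 \<gamma> v =
                   {(x, \<sigma>). (x, \<sigma>) \<in> carrier (gen_sym m X) \<and> \<sigma> \<in> PGL25_on (\<beta> v) X \<and>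
                      (\<Sum>w\<in>X. x w) mod 2 = (if evenperm \<sigma> then 0 else 1)}
            else solvable_pairs m theta7 \<gamma> v =
                   {(x, \<sigma>). (x, \<sigma>) \<in> carrier (gen_sym m X) \<and> \<sigma> \<in> PGL25_on (\<beta> v) X})))"
proof (intro conjI allI impI exI[of _ theta7_tree] ballI)
  fix m :: nat and \<gamma> v
  assume "m \<ge> 1" "\<gamma> \<in> one_chains m theta5 (edge_rev theta5)" and v: "v \<in> verts theta5"
    and surj: "\<phi> m theta5 (edge_rev theta5) \<gamma> ` H1 m theta5 (edge_rev theta5) = {0..<int m}"
  then interpret theta5_twist m \<gamma> by unfold_locales
  show "let X = verts theta5 - {v} in
    if 3 dvd m \<and> (\<Sum>e\<in>theta5_edges. \<gamma> e) mod 3 = 0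
    then \<exists>\<iota> \<in> iso (alt X Mod klein X) (integer_mod_group 3).
      solvable_pairs m theta5 \<gamma> v =
        {(x, \<sigma>). (x, \<sigma>) \<in> carrier (gen_sym m X) \<and> \<sigma> \<in> carrier (alt X) \<and>
          (\<Sum>w\<in>X. x w) mod 3 = \<iota> (klein X #>\<^bsub>alt X\<^esub> \<sigma>)}
    else solvable_pairs m theta5 \<gamma> v =
      {(x, \<sigma>). (x, \<sigma>) \<in> carrier (gen_sym m X) \<and> \<sigma> \<in> carrier (alt X)}"
    unfolding Let_def by (rule theta5_solvable[OF surj v refl, unfolded balanced_def])
next
  fix v assume "v \<in> verts theta7"
  then show "bij_betw (theta7_tree v) P1F5 (verts theta7 - {v})"
    using theta7_tree_image permutes_inj_on[OF theta7_tree_permutes] by (simp add: bij_betw_def)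
next
  show "theta7_tree Center z = z" for z by (simp add: theta7_tree_def)
next
  fix m :: nat and \<gamma> v
  assume "m \<ge> 1" "\<gamma> \<in> one_chains m theta7 (edge_rev theta7)" and v: "v \<in> verts theta7"
    and surj: "\<phi> m theta7 (edge_rev theta7) \<gamma> ` H1 m theta7 (edge_rev theta7) = {0..<int m}"
  then interpret theta7_twist m \<gamma> by unfold_locales
  note eq = theta7_solvable[OF surj v refl]
  have bip: "even m \<and> bipartite \<longleftrightarrow> bipartite" by (auto simp: twist_bipartite_def)
  show "let X = verts theta7 - {v} in
    if even m \<and> twist_bipartite m theta7 \<gamma>
    then solvable_pairs m theta7 \<gamma> v =
      {(x, \<sigma>). (x, \<sigma>) \<in> carrier (gen_sym m X) \<and> \<sigma> \<in> PGL25_on (theta7_tree v) X \<and>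
        (\<Sum>w\<in>X. x w) mod 2 = (if evenperm \<sigma> then 0 else 1)}
    else solvable_pairs m theta7 \<gamma> v =
      {(x, \<sigma>). (x, \<sigma>) \<in> carrier (gen_sym m X) \<and> \<sigma> \<in> PGL25_on (theta7_tree v) X}"
    unfolding Let_def bip eq by (cases bipartite) simp_all
qed

end
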